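(* Let $n\ge2$, let $\Omega\subset\mathbb{R}^n$ be a bounded domain, let $q\ge2$, $p=q/(q-1)$, $\alpha\in(0,1)$ and $f\in B^\alpha_{p,\infty,loc}(\Omega)$. Let $u\in W^{1,q}_{loc}(\Omega)$ be a local weak solution in $\Omega$ of $$-\mathrm{div}\left((|\nabla u|-1)_+^{q-1}\frac{\nabla u}{|\nabla u|}\right)=f.$$ Then $H_{\frac q2}(\nabla u)=(|\nabla u|-1)_+^{q/2}\frac{\nabla u}{|\nabla u|}\in B^{\frac{\alpha+1}{2}}_{2,\infty,loc}(\Omega)$. Furthermore, for every ball $B_R\Subset\Omega$ of radius $R$, with $B_{R/2}$ the concentric ball of radius $R/2$, the estimate $$\int_{B_{R/2}}\left|\tau_{s,h}H_{\frac q2}(\nabla u)-H_{\frac q2}(\nabla u)\right|^2dx\le c\left(\|f\|_{B^\alpha_{p,\infty}(B')}\|\nabla u\|_{L^q(B')}|h|^{\alpha+1}+\|\nabla u\|^q_{L^q(B')}|h|^2\right)$$ holds for every $s\in\{1,\dots,n\}$ and every $h\in\mathbb{R}$ with $|h|\le r_0<\frac12\mathrm{dist}(B_R,\partial\Omega)$, where $B'=B_R+B(0,r_0)$ and $c=c(R,q,n)$ is a positive constant depending only on $R,q,n$.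
   Context: Notation. $(\cdot)_+$ is the positive part. For $a>0$, $H_a(\xi)=(|\xi|-1)_+^{a}\,\xi/|\xi|$ for $\xi\in\mathbb{R}^n$, understood to be $0$ when $|\xi|\le1$ (in particular at $\xi=0$). Local weak solution: $u\in W^{1,q}_{loc}(\Omega)$ satisfies $\int_\Omega\langle H_{q-1}(\nabla u),\nabla\varphi\rangle\,dx=\int_\Omega f\varphi\,dx$ for every $\varphi\in W^{1,q}(\Omega)$ with compact support in $\Omega$. Shift: $\tau_{s,h}F(x)=F(x+he_s)$, where $e_s$ is the unit vector in the $x_s$ direction. Besov spaces: for $0<\beta<1$, $1\le m<\infty$, $v\in B^\beta_{m,\infty}(\mathbb{R}^n)$ means $v\in L^m(\mathbb{R}^n)$ and $[v]_{\dot B^\beta_{m,\infty}(\mathbb{R}^n)}=\sup_{h\in\mathbb{R}^n\setminus\{0\}}\left(\int_{\mathbb{R}^n}\frac{|v(x+h)-v(x)|^m}{|h|^{\beta m}}dx\right)^{1/m}<\infty$. $v\in B^\beta_{m,\infty,loc}(\Omega)$ means $\varphi v\in B^\beta_{m,\infty}(\mathbb{R}^n)$ for every $\varphi\in C_c^\infty(\Omega)$ (componentwise for vector-valued $v$). On a ball $B'$, $\|v\|_{B^\beta_{m,\infty}(B')}=\|v\|_{L^m(B')}+[v]_{\dot B^\beta_{m,\infty}(B')}$, where the seminorm on $B'$ is $\sup_{h\ne0}\left(\int_{\{x\in B':\,x+h\in B'\}}\frac{|v(x+h)-v(x)|^m}{|h|^{\beta m}}dx\right)^{1/m}$. *)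

theory Defs
  imports "HOL-Analysis.Analysis"
begin

text \<open>
  Functions on an open set \<open>\<Omega>\<close> of \<open>real ^ 'n\<close> are total functions whose values outside \<open>\<Omega>\<close>
  are irrelevant; all integrals are Lebesgue integrals.
\<close>

definition Lp_space :: "real \<Rightarrow> (real ^ 'n) set \<Rightarrow> (real ^ 'n \<Rightarrow> 'b::euclidean_space) set" where
  "Lp_space m S = {v. v \<in> borel_measurable (lebesgue_on S) \<and>
                      integrable (lebesgue_on S) (\<lambda>x. norm (v x) powr m)}"

definition Lp_norm :: "real \<Rightarrow> (real ^ 'n) set \<Rightarrow> (real ^ 'n \<Rightarrow> 'b::euclidean_space) \<Rightarrow> real" where
  "Lp_norm m S v = (\<integral>x. norm (v x) powr m \<partial>lebesgue_on S) powr (1 / m)"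

definition Lp_loc :: "real \<Rightarrow> (real ^ 'n) set \<Rightarrow> (real ^ 'n \<Rightarrow> 'b::euclidean_space) set" where
  "Lp_loc m \<Omega> = {v. \<forall>K. compact K \<and> K \<subseteq> \<Omega> \<longrightarrow> v \<in> Lp_space m K}"

definition partial :: "'n \<Rightarrow> (real ^ 'n \<Rightarrow> real) \<Rightarrow> real ^ 'n \<Rightarrow> real" where
  "partial i \<phi> x = frechet_derivative \<phi> (at x) (axis i 1)"

text \<open>
  \<open>C_diff k \<phi>\<close> says that \<open>\<phi>\<close> is \<open>k\<close> times continuously differentiable on the whole space.
\<close>

primrec C_diff :: "nat \<Rightarrow> (real ^ 'n \<Rightarrow> real) \<Rightarrow> bool" where
  "C_diff 0 \<phi> \<longleftrightarrow> continuous_on UNIV \<phi>"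
| "C_diff (Suc k) \<phi> \<longleftrightarrow> (\<forall>x. \<phi> differentiable (at x)) \<and> (\<forall>i. C_diff k (partial i \<phi>))"

definition test_functions :: "(real ^ 'n) set \<Rightarrow> (real ^ 'n \<Rightarrow> real) set" where
  "test_functions \<Omega> = {\<phi>. (\<forall>k. C_diff k \<phi>) \<and>
     compact (closure {x. \<phi> x \<noteq> 0}) \<and> closure {x. \<phi> x \<noteq> 0} \<subseteq> \<Omega>}"

definition has_weak_gradient ::
    "(real ^ 'n) set \<Rightarrow> (real ^ 'n \<Rightarrow> real) \<Rightarrow> (real ^ 'n \<Rightarrow> real ^ 'n) \<Rightarrow> bool" where
  "has_weak_gradient \<Omega> u Du \<longleftrightarrow> u \<in> Lp_loc 1 \<Omega> \<and> Du \<in> Lp_loc 1 \<Omega> \<and>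
     (\<forall>\<phi>\<in>test_functions \<Omega>. \<forall>i.
        (\<integral>x. u x * partial i \<phi> x \<partial>lebesgue_on \<Omega>) = - (\<integral>x. Du x $ i * \<phi> x \<partial>lebesgue_on \<Omega>))"

text \<open>
  The Sobolev spaces are relations between a function and (a representative of) its weak gradient,
  which is unique up to null sets.
\<close>

definition sobolev_W1 ::
    "real \<Rightarrow> (real ^ 'n) set \<Rightarrow> (real ^ 'n \<Rightarrow> real) \<Rightarrow> (real ^ 'n \<Rightarrow> real ^ 'n) \<Rightarrow> bool" where
  "sobolev_W1 q \<Omega> u Du \<longleftrightarrow> has_weak_gradient \<Omega> u Du \<and> u \<in> Lp_space q \<Omega> \<and> Du \<in> Lp_space q \<Omega>"

definition sobolev_W1_loc ::
    "real \<Rightarrow> (real ^ 'n) set \<Rightarrow> (real ^ 'n \<Rightarrow> real) \<Rightarrow> (real ^ 'n \<Rightarrow> real ^ 'n) \<Rightarrow> bool" where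
  "sobolev_W1_loc q \<Omega> u Du \<longleftrightarrow> has_weak_gradient \<Omega> u Du \<and> u \<in> Lp_loc q \<Omega> \<and> Du \<in> Lp_loc q \<Omega>"

text \<open>
  Since \<open>0 powr a = 0\<close>, this vanishes for \<open>norm \<xi> \<le> 1\<close>, in particular at the origin.
\<close>

definition H :: "real \<Rightarrow> real ^ 'n \<Rightarrow> real ^ 'n" where
  "H a \<xi> = (max 0 (norm \<xi> - 1) powr a) *\<^sub>R (\<xi> /\<^sub>R norm \<xi>)"

text \<open>
  Compact support of a Sobolev function is meant in the almost everywhere sense.
\<close>

definition local_weak_solution ::
    "real \<Rightarrow> (real ^ 'n) set \<Rightarrow> (real ^ 'n \<Rightarrow> real) \<Rightarrow> (real ^ 'n \<Rightarrow> real) \<Rightarrow>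
     (real ^ 'n \<Rightarrow> real ^ 'n) \<Rightarrow> bool" where
  "local_weak_solution q \<Omega> f u Du \<longleftrightarrow> sobolev_W1_loc q \<Omega> u Du \<and>
     (\<forall>\<phi> D\<phi>. sobolev_W1 q \<Omega> \<phi> D\<phi> \<and>
        (\<exists>K. compact K \<and> K \<subseteq> \<Omega> \<and> (AE x in lebesgue_on \<Omega>. x \<notin> K \<longrightarrow> \<phi> x = 0)) \<longrightarrow>
        (\<integral>x. H (q - 1) (Du x) \<bullet> D\<phi> x \<partial>lebesgue_on \<Omega>) = (\<integral>x. f x * \<phi> x \<partial>lebesgue_on \<Omega>))"

text \<open>
  The Besov space \<open>B\<^sup>\<beta>\<close> with exponents \<open>m\<close>, \<open>\<infinity>\<close> on a set \<open>S\<close>, used for balls and for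
  \<open>S = UNIV\<close>. The integrals below are finite for \<open>v \<in> Lp_space m S\<close>; the supremum is real-valued
  and meaningful only for elements of \<open>besov \<beta> m S\<close>, where boundedness is required.
\<close>

definition besov_quotient ::
    "real \<Rightarrow> real \<Rightarrow> (real ^ 'n) set \<Rightarrow> (real ^ 'n \<Rightarrow> real) \<Rightarrow> real ^ 'n \<Rightarrow> real" where
  "besov_quotient \<beta> m S v h =
     (\<integral>x. \<bar>v (x + h) - v x\<bar> powr m / norm h powr (\<beta> * m) \<partial>lebesgue_on {x \<in> S. x + h \<in> S})
       powr (1 / m)"

definition besov_seminorm ::
    "real \<Rightarrow> real \<Rightarrow> (real ^ 'n) set \<Rightarrow> (real ^ 'n \<Rightarrow> real) \<Rightarrow> real" where
  "besov_seminorm \<beta> m S v = (SUP h\<in>UNIV - {0}. besov_quotient \<beta> m S v h)"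

definition besov_norm ::
    "real \<Rightarrow> real \<Rightarrow> (real ^ 'n) set \<Rightarrow> (real ^ 'n \<Rightarrow> real) \<Rightarrow> real" where
  "besov_norm \<beta> m S v = Lp_norm m S v + besov_seminorm \<beta> m S v"

definition besov :: "real \<Rightarrow> real \<Rightarrow> (real ^ 'n) set \<Rightarrow> (real ^ 'n \<Rightarrow> real) set" where
  "besov \<beta> m S = {v. v \<in> Lp_space m S \<and> bdd_above (besov_quotient \<beta> m S v ` (UNIV - {0}))}"

definition besov_loc :: "real \<Rightarrow> real \<Rightarrow> (real ^ 'n) set \<Rightarrow> (real ^ 'n \<Rightarrow> real) set" where
  "besov_loc \<beta> m \<Omega> = {v. \<forall>\<phi>\<in>test_functions \<Omega>. (\<lambda>x. \<phi> x * v x) \<in> besov \<beta> m UNIV}"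

definition besov_loc_vec :: "real \<Rightarrow> real \<Rightarrow> (real ^ 'n) set \<Rightarrow> (real ^ 'n \<Rightarrow> real ^ 'n) set" where
  "besov_loc_vec \<beta> m \<Omega> = {v. \<forall>i. (\<lambda>x. v x $ i) \<in> besov_loc \<beta> m \<Omega>}"

definition shift :: "'n \<Rightarrow> real \<Rightarrow> (real ^ 'n \<Rightarrow> 'b) \<Rightarrow> real ^ 'n \<Rightarrow> 'b" where
  "shift s h F x = F (x + h *\<^sub>R axis s 1)"

end

theory Submission
  imports Defs
begin

text \<open>
  The estimate rests on two pointwise inequalities for the nonlinearity. Write \<open>V = H (q/2)\<close> of the
  gradient. First, \<open>H (q - 1)\<close> is monotone, quantitatively: its increment paired with that of the
  gradient dominates \<open>4 / q\<^sup>2\<close> times the squared increment of \<open>V\<close> (\<open>H_monotonicity\<close>). Second, its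
  increment is at most \<open>2 M\<^sup>q\<^sup>/\<^sup>2\<^sup>-\<^sup>1\<close> times the increment of \<open>V\<close>, where \<open>M\<close> is the larger excess of the
  gradient over length one (\<open>H_growth\<close>).

  For a vector \<open>h\<close> and a cutoff \<open>\<eta>\<close> on the ball of radius \<open>R\<close>, let \<open>W = \<eta>\<^sup>2 (u (x + h) - u x)\<close> and test
  the equation with \<open>W (x - h) - W x\<close>. After a change of variables the increment falls on the
  nonlinearity and on \<open>f\<close>. Monotonicity bounds the left side from below by the integral of
  \<open>\<eta>\<^sup>2\<close> times the squared increment of \<open>V\<close>, and the term with the gradient of \<open>\<eta>\<close> is absorbed by Young's
  inequality at the cost of \<open>\<bar>h\<bar>\<^sup>2\<close> times the integral of \<open>\<bar>Du\<bar>\<^sup>q\<close>. On the right, Hoelder's inequality leaves the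
  \<open>L\<^sup>p\<close> norm of the increment of \<open>f\<close>, which is at most \<open>\<bar>h\<bar>\<^sup>\<alpha>\<close> times the Besov norm, and the \<open>L\<^sup>q\<close> norm of the
  increment of \<open>u\<close>, which is at most \<open>\<bar>h\<bar>\<close> times the norm of \<open>Du\<close>. This is \<open>energy_estimate\<close>, and
  \<open>local_estimate\<close> is its form for weak solutions.

  The bound for the increment of \<open>u\<close> (\<open>difference_quotient_bound\<close>) comes from the fundamental theorem of
  calculus along almost every segment (\<open>sobolev_segment_integral\<close>), which follows by duality with test
  functions from the fundamental lemma of the calculus of variations; this needs a supply of smooth
  cutoffs.

  Since the estimate holds for translations in every direction, a finite covering of the support of a
  test function by half balls gives the local Besov regularity (\<open>H_gradient_besov_loc\<close>); the estimate
  for the coordinate directions is the special case \<open>h e\<^sub>s\<close>.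
\<close>

section \<open>Smooth functions and cutoffs\<close>

abbreviation smooth :: "(real ^ 'n::finite \<Rightarrow> real) \<Rightarrow> bool" where
  "smooth \<phi> \<equiv> \<forall>k. C_diff k \<phi>"

lemma partial_eq:
  assumes "(\<phi> has_derivative D) (at x)"
  shows "partial i \<phi> x = D (axis i 1)"
  unfolding partial_def by (simp add: frechet_derivative_at[OF assms, symmetric])

lemma has_derivative_partial:
  fixes \<phi> :: "real ^ 'n::finite \<Rightarrow> real"
  assumes "\<phi> differentiable (at x)"
  shows "(\<phi> has_derivative (\<lambda>h. \<Sum>i\<in>UNIV. h $ i * partial i \<phi> x)) (at x)"
proof -
  have D: "(\<phi> has_derivative frechet_derivative \<phi> (at x)) (at x)"
    using assms by (simp add: frechet_derivative_works)
  then interpret bounded_linear "frechet_derivative \<phi> (at x)"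
    by (rule has_derivative_bounded_linear)
  have "frechet_derivative \<phi> (at x) h = (\<Sum>i\<in>UNIV. h $ i * partial i \<phi> x)" for h
  proof -
    have "frechet_derivative \<phi> (at x) h = frechet_derivative \<phi> (at x) (\<Sum>i\<in>UNIV. h $ i *\<^sub>R axis i 1)"
      by (simp add: basis_expansion flip: scalar_mult_eq_scaleR)
    also have "\<dots> = (\<Sum>i\<in>UNIV. h $ i * partial i \<phi> x)"
      by (simp add: sum scale partial_def)
    finally show ?thesis .
  qed
  then have "frechet_derivative \<phi> (at x) = (\<lambda>h. \<Sum>i\<in>UNIV. h $ i * partial i \<phi> x)" by blast
  with D show ?thesis by simp
qed

lemma smooth_differentiable: "smooth \<phi> \<Longrightarrow> \<phi> differentiable (at x)"
  by (metis C_diff.simps(2))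

lemma smooth_partial: "smooth \<phi> \<Longrightarrow> smooth (partial i \<phi>)"
  by (metis C_diff.simps(2))

lemma smooth_continuous: "smooth \<phi> \<Longrightarrow> continuous_on UNIV \<phi>"
  by (metis C_diff.simps(1))

lemma C_diff_continuous: "C_diff k \<phi> \<Longrightarrow> continuous_on UNIV \<phi>"
  by (cases k) (auto intro!: differentiable_imp_continuous_on
      simp: differentiable_on_def differentiable_at_withinI)

lemma C_diff_Suc: "C_diff (Suc k) \<phi> \<Longrightarrow> C_diff k \<phi>"
proof (induction k arbitrary: \<phi>)
  case 0
  then show ?case using C_diff_continuous[of "Suc 0" \<phi>] by simp
next
  case (Suc k)
  then show ?case by (metis C_diff.simps(2))
qed

lemma partial_const: "partial i (\<lambda>x. c) = (\<lambda>x. 0)"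
  by (rule ext) (simp add: partial_eq[OF has_derivative_const])

lemma C_diff_const: "C_diff k (\<lambda>x. c)"
  by (induction k arbitrary: c) (auto simp: partial_const)

lemma smooth_coordinate: "smooth (\<lambda>x. x $ i)"
proof
  have p: "partial j (\<lambda>x. x $ i) = (\<lambda>x. if i = j then 1 else 0)" for j
    by (rule ext) (subst partial_eq[where D = "\<lambda>h. h $ i"], auto intro!: derivative_eq_intros
        bounded_linear.has_derivative[OF bounded_linear_vec_nth] simp: axis_def)
  fix k show "C_diff k (\<lambda>x. x $ i)"
    by (cases k) (auto simp: p C_diff_const intro!: continuous_intros
        bounded_linear_imp_differentiable bounded_linear_vec_nth)
qed

lemma partial_add:
  assumes "\<phi> differentiable (at x)" "\<psi> differentiable (at x)"
  shows "partial i (\<lambda>x. \<phi> x + \<psi> x) x = partial i \<phi> x + partial i \<psi> x"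
  using has_derivative_add[OF assms[unfolded frechet_derivative_works]]
  by (simp add: partial_eq) (simp add: partial_def)

lemma partial_mult:
  assumes "\<phi> differentiable (at x)" "\<psi> differentiable (at x)"
  shows "partial i (\<lambda>x. \<phi> x * \<psi> x) x = \<phi> x * partial i \<psi> x + partial i \<phi> x * \<psi> x"
  using has_derivative_mult[OF assms[unfolded frechet_derivative_works]]
  by (simp add: partial_eq) (simp add: partial_def)

lemma C_diff_add: "C_diff k \<phi> \<Longrightarrow> C_diff k \<psi> \<Longrightarrow> C_diff k (\<lambda>x. \<phi> x + \<psi> x)"
proof (induction k arbitrary: \<phi> \<psi>)
  case (Suc k)
  have "partial i (\<lambda>x. \<phi> x + \<psi> x) = (\<lambda>x. partial i \<phi> x + partial i \<psi> x)" for i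
    using Suc.prems by (intro ext partial_add) auto
  then show ?case using Suc by auto
qed (auto intro: continuous_intros)

lemma C_diff_mult: "C_diff k \<phi> \<Longrightarrow> C_diff k \<psi> \<Longrightarrow> C_diff k (\<lambda>x. \<phi> x * \<psi> x)"
proof (induction k arbitrary: \<phi> \<psi>)
  case (Suc k)
  have "partial i (\<lambda>x. \<phi> x * \<psi> x) = (\<lambda>x. \<phi> x * partial i \<psi> x + partial i \<phi> x * \<psi> x)" for i
    using Suc.prems by (intro ext partial_mult) auto
  moreover have "C_diff k \<phi>" "C_diff k \<psi>" using Suc.prems by (auto intro: C_diff_Suc)
  ultimately show ?case using Suc by (auto intro!: C_diff_add)
qed (auto intro: continuous_intros)

lemma smooth_cmult: "smooth \<phi> \<Longrightarrow> smooth (\<lambda>x. c * \<phi> x)"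
  by (auto intro: C_diff_mult C_diff_const)

lemma smooth_diff: "smooth \<phi> \<Longrightarrow> smooth \<psi> \<Longrightarrow> smooth (\<lambda>x. \<phi> x - \<psi> x)"
  using C_diff_add[of _ \<phi> "\<lambda>x. (-1) * \<psi> x"] smooth_cmult[of \<psi> "-1"] by simp

lemma C_diff_sum: "finite I \<Longrightarrow> (\<And>i. i \<in> I \<Longrightarrow> C_diff k (\<phi> i)) \<Longrightarrow> C_diff k (\<lambda>x. \<Sum>i\<in>I. \<phi> i x)"
  by (induction I rule: finite_induct) (auto intro: C_diff_const C_diff_add)

lemma C_diff_prod: "finite I \<Longrightarrow> (\<And>i. i \<in> I \<Longrightarrow> C_diff k (\<phi> i)) \<Longrightarrow> C_diff k (\<lambda>x. \<Prod>i\<in>I. \<phi> i x)"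
  by (induction I rule: finite_induct) (auto intro: C_diff_const C_diff_mult)

lemma partial_translate:
  assumes "\<phi> differentiable (at (x + a))"
  shows "partial i (\<lambda>x. \<phi> (x + a)) x = partial i \<phi> (x + a)"
proof -
  have "((\<lambda>x. \<phi> (x + a)) has_derivative frechet_derivative \<phi> (at (x + a))) (at x)"
    using assms by (intro has_derivative_compose[where g = \<phi> and f = "\<lambda>x. x + a"]
        derivative_eq_intros) (auto simp: frechet_derivative_works)
  then show ?thesis by (simp add: partial_eq) (simp add: partial_def)
qed

lemma C_diff_translate: "C_diff k \<phi> \<Longrightarrow> C_diff k (\<lambda>x. \<phi> (x + a))"
proof (induction k arbitrary: \<phi>)
  case 0
  then show ?case by (auto intro!: continuous_intros intro: continuous_on_compose2)
next
  case (Suc k)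
  have "partial i (\<lambda>x. \<phi> (x + a)) = (\<lambda>x. partial i \<phi> (x + a))" for i
    using Suc.prems by (intro ext partial_translate) auto
  moreover have "(\<lambda>x. \<phi> (x + a)) differentiable (at x)" for x
    using Suc.prems by (intro differentiable_compose[where f = \<phi> and g = "\<lambda>x. x + a"]) auto
  ultimately show ?case using Suc by auto
qed

text \<open>
  Every derivative of \<open>exp (- 1 / t)\<close> is a polynomial in \<open>1 / t\<close> times the same exponential, so this
  family is closed under differentiation and smoothness follows by a single induction.
\<close>

definition flat :: "real poly \<Rightarrow> real \<Rightarrow> real" where
  "flat P t = (if t > 0 then poly P (1 / t) * exp (- 1 / t) else 0)"

lemma poly_times_exp_neg_tendsto_0: "((\<lambda>s. poly P s * exp (- s)) \<longlongrightarrow> (0::real)) at_top"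
proof -
  have "((\<lambda>s. \<Sum>i\<le>degree P. coeff P i * (s ^ i / exp s)) \<longlongrightarrow> (\<Sum>i\<le>degree P. coeff P i * 0)) at_top"
    by (intro tendsto_intros tendsto_power_div_exp_0)
  then show ?thesis
    by (simp add: poly_altdef sum_distrib_right exp_minus divide_inverse mult.assoc)
qed

lemma flat_has_derivative_at_0: "(flat P has_real_derivative 0) (at 0)"
proof -
  have "((\<lambda>t. flat P t / t) \<longlongrightarrow> 0) (at_right 0)"
  proof (rule Lim_transform_eventually)
    show "((\<lambda>t. poly (pCons 0 P) (inverse t) * exp (- inverse t)) \<longlongrightarrow> 0) (at_right (0::real))"
      by (rule filterlim_compose[OF poly_times_exp_neg_tendsto_0 filterlim_inverse_at_top_right])
    show "eventually (\<lambda>t. poly (pCons 0 P) (inverse t) * exp (- inverse t) = flat P t / t) (at_right 0)"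
      using eventually_at_right_less[of 0]
      by eventually_elim (simp add: flat_def divide_simps)
  qed
  moreover have "((\<lambda>t. flat P t / t) \<longlongrightarrow> 0) (at_left 0)"
    by (rule tendsto_eventually) (auto simp: flat_def eventually_at_filter)
  ultimately have "((\<lambda>t. flat P t / t) \<longlongrightarrow> 0) (at 0)"
    by (rule filterlim_split_at[rotated])
  then show ?thesis
    by (simp add: has_field_derivative_iff flat_def)
qed

lemma flat_has_derivative:
  "(flat P has_real_derivative flat ([:0, 0, 1:] * (P - pderiv P)) t) (at t)"
proof (cases t "0 :: real" rule: linorder_cases)
  case less
  have "((\<lambda>t. 0) has_real_derivative 0) (at t)" by simp
  then have "(flat P has_real_derivative 0) (at t)"
    by (rule has_field_derivative_transform_within_open[where S = "{..<0}"])
      (use less in \<open>auto simp: flat_def\<close>)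
  then show ?thesis using less by (simp add: flat_def)
next
  case equal
  then show ?thesis using flat_has_derivative_at_0[of P] by (simp add: flat_def)
next
  case greater
  have "((\<lambda>t. poly P (1 / t) * exp (- 1 / t)) has_real_derivative
      flat ([:0, 0, 1:] * (P - pderiv P)) t) (at t)"
    using greater by (auto intro!: derivative_eq_intros DERIV_chain'[OF _ poly_DERIV]
        simp: flat_def algebra_simps power2_eq_square)
  then show ?thesis
    by (rule has_field_derivative_transform_within_open[where S = "{0<..}"])
      (use greater in \<open>auto simp: flat_def\<close>)
qed

lemma smooth_flat_compose:
  fixes \<theta> :: "real ^ 'n::finite \<Rightarrow> real"
  assumes "smooth \<theta>"
  shows "smooth (\<lambda>x. flat P (\<theta> x))"
proof
  have D: "((\<lambda>x. flat P (\<theta> x)) has_derivative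
      (\<lambda>h. flat ([:0, 0, 1:] * (P - pderiv P)) (\<theta> x) * frechet_derivative \<theta> (at x) h)) (at x)" for P x
    using has_derivative_compose[OF _ flat_has_derivative[THEN has_field_derivative_imp_has_derivative]]
      smooth_differentiable[OF assms, unfolded frechet_derivative_works] by blast
  fix k show "C_diff k (\<lambda>x. flat P (\<theta> x))"
  proof (induction k arbitrary: P)
    case 0
    show ?case
      using has_derivative_continuous_on[OF has_derivative_at_withinI[OF D]] by simp
  next
    case (Suc k)
    have "partial i (\<lambda>x. flat P (\<theta> x)) =
        (\<lambda>x. flat ([:0, 0, 1:] * (P - pderiv P)) (\<theta> x) * partial i \<theta> x)" for i
      by (rule ext) (simp only: partial_eq[OF D], simp add: partial_def)
    then show ?case
      using D Suc.IH smooth_partial[OF assms]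
      by (auto simp: differentiable_def simp del: mult_pCons_left intro!: C_diff_mult)
  qed
qed

definition bump :: "real \<Rightarrow> real" where
  "bump t = (if t > 0 then exp (- 1 / t) else 0)"

lemma smooth_bump_compose: "smooth \<theta> \<Longrightarrow> smooth (\<lambda>x. bump (\<theta> x))"
  using smooth_flat_compose[of \<theta> "[:1:]"] by (simp add: flat_def bump_def cong: if_cong)

lemma bump_pos_iff: "bump t > 0 \<longleftrightarrow> t > 0" and bump_nonneg: "bump t \<ge> 0" and bump_le_1: "bump t \<le> 1"
  by (auto simp: bump_def)

lemma bump_mono: "s \<le> t \<Longrightarrow> bump s \<le> bump t"
  by (auto simp: bump_def field_simps)

lemma smooth_dist_sq: "smooth (\<lambda>x. (dist x x0)\<^sup>2)"
proof -
  have "(\<lambda>x. (dist x x0)\<^sup>2) = (\<lambda>x. \<Sum>i\<in>UNIV. (x $ i - x0 $ i) * (x $ i - x0 $ i))"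
    by (auto simp: dist_norm power2_norm_eq_inner inner_vec_def)
  moreover have "smooth (\<lambda>x. x $ i - x0 $ i)" for i
    using smooth_coordinate C_diff_const by (intro smooth_diff) blast+
  ultimately show ?thesis by (auto intro!: C_diff_sum C_diff_mult)
qed

text \<open>
  With \<open>w = bump (dist x x0 ^ 2 - r ^ 2)\<close>, which vanishes exactly on the small ball, the function
  \<open>bump (m - w)\<close> is constant where \<open>w = 0\<close> and vanishes where \<open>w \<ge> m\<close>. The value \<open>m\<close> is the one that \<open>w\<close> takes
  on the outer sphere.
\<close>

lemma smooth_cutoff_exists:
  assumes "0 \<le> r" "r < R"
  obtains \<eta> :: "real ^ 'n::finite \<Rightarrow> real"
  where "smooth \<eta>" "\<And>x. 0 \<le> \<eta> x" "\<And>x. \<eta> x \<le> 1"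
    "\<And>x. dist x x0 \<le> r \<Longrightarrow> \<eta> x = 1" "\<And>x. dist x x0 \<ge> R \<Longrightarrow> \<eta> x = 0"
proof -
  define w where "w x = bump ((dist x x0)\<^sup>2 - r\<^sup>2)" for x :: "real ^ 'n"
  define m where "m = bump (R\<^sup>2 - r\<^sup>2)"
  define \<eta> where "\<eta> x = 1 / bump m * bump (m - w x)" for x
  have m: "m > 0" "bump m > 0"
    using assms by (auto simp: m_def bump_pos_iff power_strict_mono)
  show thesis
  proof
    show "smooth \<eta>"
      unfolding \<eta>_def w_def using C_diff_const
      by (intro smooth_cmult smooth_bump_compose smooth_diff smooth_dist_sq) blast+
    fix x
    show "0 \<le> \<eta> x" using m by (simp add: \<eta>_def bump_nonneg)
    show "\<eta> x \<le> 1" using m bump_mono[of "m - w x" m] by (simp add: \<eta>_def w_def bump_nonneg)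
    show "\<eta> x = 1" if "dist x x0 \<le> r"
    proof -
      have "w x = 0" using that by (simp add: w_def bump_def power_mono leD)
      then show ?thesis using m by (simp add: \<eta>_def)
    qed
    show "\<eta> x = 0" if "dist x x0 \<ge> R"
    proof -
      have "m \<le> w x" unfolding m_def w_def using that assms by (intro bump_mono) (simp add: power_mono)
      then show ?thesis by (simp add: \<eta>_def bump_def)
    qed
  qed
qed

lemma smooth_vanishing_outside_ball_test_function:
  fixes \<phi> :: "real ^ 'n::finite \<Rightarrow> real"
  assumes "smooth \<phi>" "\<And>x. x \<notin> ball x0 r \<Longrightarrow> \<phi> x = 0" "cball x0 r \<subseteq> \<Omega>"
  shows "\<phi> \<in> test_functions \<Omega>"
proof -
  have "{x. \<phi> x \<noteq> 0} \<subseteq> ball x0 r" using assms(2) by blast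
  then have "closure {x. \<phi> x \<noteq> 0} \<subseteq> cball x0 r"
    by (intro closure_minimal subset_trans[OF _ ball_subset_cball]) auto
  with assms(1,3) show ?thesis
    by (auto simp: test_functions_def compact_eq_bounded_closed intro: bounded_subset[OF bounded_cball])
qed

lemma partial_zero_off_closed:
  assumes "closed C" "\<And>x. x \<notin> C \<Longrightarrow> \<phi> x = 0" "x \<notin> C"
  shows "partial i \<phi> x = 0"
proof -
  have "((\<lambda>x. 0) has_derivative (\<lambda>x. 0)) (at x)" by simp
  then have "(\<phi> has_derivative (\<lambda>x. 0)) (at x)"
    by (rule has_derivative_transform_within_open[where s = "- C"]) (use assms in auto)
  then show ?thesis by (simp add: partial_eq)
qed

section \<open>Inequalities for the nonlinearity\<close>

lemma powr_diff_le:
  fixes A B r :: real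
  assumes "0 < B" "B \<le> A" "1 \<le> r"
  shows "A powr r - B powr r \<le> r * A powr (r - 1) * (A - B)"
proof (cases "A = B")
  case False
  then have "B < A" using assms by simp
  moreover have "((\<lambda>x. x powr r) has_real_derivative r * z powr (r - 1)) (at z)" if "B \<le> z" for z
    using that assms by (intro has_real_derivative_powr) auto
  ultimately obtain z where z: "B < z" "z < A" "A powr r - B powr r = (A - B) * (r * z powr (r - 1))"
    using MVT2[of B A "\<lambda>x. x powr r" "\<lambda>z. r * z powr (r - 1)"] by auto
  have "z powr (r - 1) \<le> A powr (r - 1)" using z assms by (intro powr_mono2) auto
  then have "(A - B) * (r * z powr (r - 1)) \<le> (A - B) * (r * A powr (r - 1))"
    using assms by (intro mult_left_mono) auto
  with z show ?thesis by (simp add: mult.commute)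
qed simp

text \<open>
  By the mean value theorem \<open>A\<^sup>r - B\<^sup>r \<le> r A\<^sup>r\<^sup>-\<^sup>1 (A - B)\<close> with \<open>r = q / 2\<close>; this is where the constant
  \<open>4 / q\<^sup>2\<close> comes from.
\<close>

lemma scalar_monotonicity_same_sign:
  fixes A B q :: real
  assumes "0 < A" "0 < B" "2 \<le> q"
  shows "4 / q\<^sup>2 * (A powr (q/2) - B powr (q/2))\<^sup>2 \<le> (A powr (q - 1) - B powr (q - 1)) * (A - B)"
  using assms(1,2)
proof (induction A B rule: linorder_wlog)
  case (sym A B)
  then show ?case by (simp add: power2_commute algebra_simps)
next
  case (le B A)
  have "A powr (q/2) - B powr (q/2) \<le> q/2 * A powr (q/2 - 1) * (A - B)"
    using le assms(3) by (intro powr_diff_le) auto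
  moreover have "B powr (q/2) \<le> A powr (q/2)" using le assms by (intro powr_mono2) auto
  ultimately have "(A powr (q/2) - B powr (q/2))\<^sup>2 \<le> (q/2 * A powr (q/2 - 1) * (A - B))\<^sup>2"
    by (intro power_mono) auto
  also have "\<dots> = q\<^sup>2 / 4 * ((A powr (q/2 - 1))\<^sup>2 * (A - B)\<^sup>2)"
    by (simp add: power2_eq_square)
  also have "(A powr (q/2 - 1))\<^sup>2 = A powr (q - 2)"
    by (simp add: power2_eq_square flip: powr_add)
  finally have "4 / q\<^sup>2 * (A powr (q/2) - B powr (q/2))\<^sup>2 \<le> A powr (q - 2) * (A - B)\<^sup>2"
    using assms(3) by (simp add: field_simps)
  also have "\<dots> = (A powr (q - 2) * A - A powr (q - 2) * B) * (A - B)"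
    by (simp add: power2_eq_square algebra_simps)
  also have "\<dots> \<le> (A powr (q - 1) - B powr (q - 1)) * (A - B)"
  proof (intro mult_right_mono diff_mono)
    have "x powr (q - 2) * x = x powr (q - 1)" if "x > 0" for x
      using that powr_add[of x "q - 2" 1] by simp
    moreover have "B powr (q - 2) \<le> A powr (q - 2)" using le assms by (intro powr_mono2) auto
    ultimately show "A powr (q - 2) * A \<le> A powr (q - 1)" "B powr (q - 1) \<le> A powr (q - 2) * B"
      using le by (auto simp: mult_right_mono simp flip: \<open>\<And>x. _ \<Longrightarrow> _ = x powr (q - 1)\<close>)
  qed (use le in auto)
  finally show ?case by (simp add: power2_commute algebra_simps)
qed

text \<open>
  The Cauchy-Schwarz inequality in the plane, since \<open>q / 2\<close> is the mean of \<open>q - 1\<close> and \<open>1\<close>.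
\<close>

lemma scalar_monotonicity_opposite_sign:
  fixes A B q :: real
  assumes "0 < A" "0 < B"
  shows "(A powr (q/2) + B powr (q/2))\<^sup>2 \<le> (A powr (q - 1) + B powr (q - 1)) * (A + B)"
proof -
  define a b where "a = A powr ((q - 1)/2)" and "b = B powr ((q - 1)/2)"
  define c d where "c = A powr (1/2)" and "d = B powr (1/2)"
  have "q - 1 = (q - 1)/2 + (q - 1)/2" "q/2 = (q - 1)/2 + 1/2" "(1::real) = 1/2 + 1/2"
    by (simp_all add: field_simps)
  then have "A powr (q/2) = a * c" "B powr (q/2) = b * d" "A powr (q - 1) = a\<^sup>2" "B powr (q - 1) = b\<^sup>2"
    "A = c\<^sup>2" "B = d\<^sup>2"
    using assms unfolding a_def b_def c_def d_def power2_eq_square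
    by (metis powr_add powr_one less_imp_le)+
  moreover have "(a\<^sup>2 + b\<^sup>2) * (c\<^sup>2 + d\<^sup>2) - (a * c + b * d)\<^sup>2 = (a * d - b * c)\<^sup>2"
    by (simp add: power2_eq_square algebra_simps)
  ultimately show ?thesis
    by (metis diff_ge_0_iff_ge zero_le_power2)
qed

definition excess :: "real ^ 'n::finite \<Rightarrow> real" where
  "excess \<xi> = max 0 (norm \<xi> - 1)"

lemma excess_nonneg [simp]: "0 \<le> excess \<xi>" and excess_le_norm: "excess \<xi> \<le> norm \<xi>"
  by (auto simp: excess_def)

lemma H_eq_sgn: "H a \<xi> = excess \<xi> powr a *\<^sub>R sgn \<xi>"
  by (simp add: H_def excess_def sgn_div_norm)

lemma norm_H: "norm (H a \<xi>) = excess \<xi> powr a"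
  by (cases "\<xi> = 0") (auto simp: H_eq_sgn excess_def norm_sgn)

lemma H_zero: "excess \<xi> = 0 \<Longrightarrow> H a \<xi> = 0"
  by (simp add: H_eq_sgn)

text \<open>
  If \<open>X\<close> and \<open>Y\<close> are the two excess vectors, the inequality is affine in the cosine of the angle
  between them, so it suffices to check equal and opposite directions; removing the unit parts
  of \<open>\<xi>\<close> and \<open>\<zeta>\<close> only lowers the right-hand side.
\<close>

lemma H_monotonicity:
  assumes "2 \<le> q"
  shows "4 / q\<^sup>2 * (norm (H (q/2) \<xi> - H (q/2) \<zeta>))\<^sup>2 \<le> (H (q - 1) \<xi> - H (q - 1) \<zeta>) \<bullet> (\<xi> - \<zeta>)"
proof -
  have q: "4 / q\<^sup>2 \<le> 1" using assms power_mono[of 2 q 2] by simp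
  have one: "4 / q\<^sup>2 * (norm (H (q/2) \<xi>))\<^sup>2 \<le> H (q - 1) \<xi> \<bullet> (\<xi> - \<zeta>)"
    if "excess \<zeta> = 0" for \<xi> \<zeta> :: "real ^ 'n"
  proof (cases "excess \<xi> = 0")
    case False
    then have \<xi>: "norm \<xi> > 1" "excess \<xi> = norm \<xi> - 1" by (auto simp: excess_def max_def split: if_splits)
    have "norm \<zeta> \<le> 1" using that by (auto simp: excess_def max_def split: if_splits)
    then have "sgn \<xi> \<bullet> \<zeta> \<le> 1"
      using norm_cauchy_schwarz[of "sgn \<xi>" \<zeta>] \<xi> by (auto simp: norm_sgn split: if_splits)
    moreover have "sgn \<xi> \<bullet> \<xi> = norm \<xi>" using \<xi>
      by (auto simp: sgn_div_norm dot_square_norm power2_eq_square field_simps)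
    ultimately have "excess \<xi> \<le> sgn \<xi> \<bullet> (\<xi> - \<zeta>)"
      using \<xi> by (simp add: inner_diff_right)
    then have "excess \<xi> powr (q - 1) * excess \<xi> \<le> H (q - 1) \<xi> \<bullet> (\<xi> - \<zeta>)"
      unfolding H_eq_sgn inner_scaleR_left by (rule mult_left_mono) simp
    moreover have "excess \<xi> powr (q - 1) * excess \<xi> = (norm (H (q/2) \<xi>))\<^sup>2"
      using \<xi> powr_add[of "excess \<xi>" "q - 1" 1] powr_add[of "excess \<xi>" "q/2" "q/2"]
      by (simp add: norm_H power2_eq_square)
    ultimately show ?thesis
      using mult_right_mono[OF q, of "(norm (H (q/2) \<xi>))\<^sup>2"] by simp
  qed (simp add: H_zero)
  \<comment> \<open>\<open>one\<close> settles the case where one of the two vectors lies in the unit ball.\<close>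
  consider "excess \<zeta> = 0" | "excess \<xi> = 0" | "excess \<xi> > 0" "excess \<zeta> > 0"
    using excess_nonneg[of \<xi>] excess_nonneg[of \<zeta>] by linarith
  then show ?thesis
  proof cases
    case 1
    then show ?thesis using one[of \<zeta> \<xi>] by (simp add: H_zero)
  next
    case 2
    then show ?thesis using one[of \<xi> \<zeta>] by (simp add: H_zero inner_diff_right)
  next
    case 3
    define A B \<kappa> where "A = excess \<xi>" "B = excess \<zeta>" "\<kappa> = sgn \<xi> \<bullet> sgn \<zeta>"
    have n: "norm \<xi> = 1 + A" "norm \<zeta> = 1 + B"
      using 3 by (auto simp: excess_def A_B_\<kappa>_def max_def split: if_splits)
    then have unit: "norm (sgn \<xi>) = 1" "norm (sgn \<zeta>) = 1" "sgn \<xi> \<bullet> sgn \<xi> = 1" "sgn \<zeta> \<bullet> sgn \<zeta> = 1"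
      using 3 by (auto simp: norm_sgn dot_square_norm A_B_\<kappa>_def)
    then have \<kappa>: "\<bar>\<kappa>\<bar> \<le> 1"
      using Cauchy_Schwarz_ineq2[of "sgn \<xi>" "sgn \<zeta>"] by (simp add: A_B_\<kappa>_def)
    have eq: "\<xi> = (1 + A) *\<^sub>R sgn \<xi>" "\<zeta> = (1 + B) *\<^sub>R sgn \<zeta>"
      unfolding n[symmetric] using n 3 by (auto simp: sgn_div_norm A_B_\<kappa>_def)
    define a b where "a = A powr (q - 1)" "b = B powr (q - 1)"
    define c d where "c = A powr (q/2)" "d = B powr (q/2)"
    have cd: "c\<^sup>2 = a * A" "d\<^sup>2 = b * B"
      using 3 powr_add[of A "q - 1" 1] powr_add[of A "q/2" "q/2"] powr_add[of B "q - 1" 1] powr_add[of B "q/2" "q/2"]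
      by (simp_all add: A_B_\<kappa>_def a_b_def c_d_def power2_eq_square)
    have "(norm (H (q/2) \<xi> - H (q/2) \<zeta>))\<^sup>2 = (1 + \<kappa>) / 2 * (c - d)\<^sup>2 + (1 - \<kappa>) / 2 * (c + d)\<^sup>2"
      unfolding power2_norm_eq_inner H_eq_sgn inner_diff_left inner_diff_right inner_scaleR_left inner_scaleR_right unit
        inner_commute[of "sgn \<zeta>" "sgn \<xi>"] A_B_\<kappa>_def[symmetric] c_d_def[symmetric]
      by (simp add: power2_eq_square field_simps)
    then have "4 / q\<^sup>2 * (norm (H (q/2) \<xi> - H (q/2) \<zeta>))\<^sup>2 =
        (1 + \<kappa>) / 2 * (4 / q\<^sup>2 * (c - d)\<^sup>2) + (1 - \<kappa>) / 2 * (4 / q\<^sup>2 * (c + d)\<^sup>2)"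
      by (simp only: distrib_left mult.left_commute)
    also have "\<dots> \<le> (1 + \<kappa>) / 2 * ((a - b) * (A - B)) + (1 - \<kappa>) / 2 * ((a + b) * (A + B))"
    proof (intro add_mono mult_left_mono)
      show "4 / q\<^sup>2 * (c - d)\<^sup>2 \<le> (a - b) * (A - B)"
        unfolding a_b_def c_d_def using 3 assms by (intro scalar_monotonicity_same_sign) (auto simp: A_B_\<kappa>_def)
      have "(c + d)\<^sup>2 \<le> (a + b) * (A + B)"
        unfolding a_b_def c_d_def using 3 assms by (intro scalar_monotonicity_opposite_sign) (auto simp: A_B_\<kappa>_def)
      then show "4 / q\<^sup>2 * (c + d)\<^sup>2 \<le> (a + b) * (A + B)"
        using mult_right_mono[OF q, of "(c + d)\<^sup>2"] by simp
    qed (use \<kappa> in auto)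
    also have "\<dots> \<le> (1 + \<kappa>) / 2 * ((a - b) * (A - B)) + (1 - \<kappa>) / 2 * ((a + b) * (A + B)) + (a + b) * (1 - \<kappa>)"
      using \<kappa> by (simp add: a_b_def)
    also have "\<dots> = (H (q - 1) \<xi> - H (q - 1) \<zeta>) \<bullet> (\<xi> - \<zeta>)"
    proof -
      have "(H (q - 1) \<xi> - H (q - 1) \<zeta>) \<bullet> (\<xi> - \<zeta>) =
          (a *\<^sub>R sgn \<xi> - b *\<^sub>R sgn \<zeta>) \<bullet> ((1 + A) *\<^sub>R sgn \<xi> - (1 + B) *\<^sub>R sgn \<zeta>)"
        by (simp add: H_eq_sgn A_B_\<kappa>_def a_b_def flip: eq[unfolded A_B_\<kappa>_def])
      also have "\<dots> = a * ((1 + A) - (1 + B) * \<kappa>) - b * ((1 + A) * \<kappa> - (1 + B))"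
        unfolding inner_diff_left inner_diff_right inner_scaleR_left inner_scaleR_right unit
          inner_commute[of "sgn \<zeta>" "sgn \<xi>"] A_B_\<kappa>_def[symmetric] by (simp add: algebra_simps)
      finally show ?thesis by (simp add: field_simps)
    qed
    finally show ?thesis .
  qed
qed

text \<open>
  With \<open>x\<close> and \<open>y\<close> the two values of \<open>H (q/2)\<close> and \<open>A \<ge> B\<close> the excesses, \<open>H (q - 1)\<close> differs by
  \<open>A\<^sup>r\<^sup>-\<^sup>1 (x - y) + (A\<^sup>r\<^sup>-\<^sup>1 - B\<^sup>r\<^sup>-\<^sup>1) y\<close>, \<open>r = q / 2\<close>, and \<open>(A\<^sup>r\<^sup>-\<^sup>1 - B\<^sup>r\<^sup>-\<^sup>1) B \<le> A\<^sup>r - B\<^sup>r\<close> bounds the second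
  term by the first.
\<close>

lemma H_growth_ordered:
  assumes "2 \<le> q" and le: "excess \<zeta> \<le> excess \<xi>"
  shows "norm (H (q - 1) \<xi> - H (q - 1) \<zeta>)
    \<le> 2 * max (excess \<xi>) (excess \<zeta>) powr (q/2 - 1) * norm (H (q/2) \<xi> - H (q/2) \<zeta>)"
proof -
  define A B where "A = excess \<xi>" "B = excess \<zeta>"
  define x y where "x = H (q/2) \<xi>" "y = H (q/2) \<zeta>"
  have AB: "0 \<le> B" "B \<le> A" using le by (auto simp: A_B_def)
  have split: "z powr (q/2 - 1) * z powr (q/2) = z powr (q - 1)" for z :: real
    by (simp flip: powr_add)
  have "H (q - 1) \<xi> - H (q - 1) \<zeta> =
      A powr (q/2 - 1) *\<^sub>R (x - y) + (A powr (q/2 - 1) - B powr (q/2 - 1)) *\<^sub>R y"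
    unfolding A_B_def x_y_def H_eq_sgn split[symmetric] by (simp add: algebra_simps)
  moreover have "norm \<dots> \<le> A powr (q/2 - 1) * norm (x - y) + (A powr (q/2 - 1) - B powr (q/2 - 1)) * norm y"
  proof -
    have "B powr (q/2 - 1) \<le> A powr (q/2 - 1)" using AB assms by (intro powr_mono2) auto
    then show ?thesis
      using norm_triangle_ineq[of "A powr (q/2 - 1) *\<^sub>R (x - y)" "(A powr (q/2 - 1) - B powr (q/2 - 1)) *\<^sub>R y"]
      by simp
  qed
  moreover have "(A powr (q/2 - 1) - B powr (q/2 - 1)) * norm y \<le> A powr (q/2 - 1) * norm (x - y)"
  proof -
    have mono: "B powr (q/2 - 1) \<le> A powr (q/2 - 1)" using AB assms by (intro powr_mono2) auto
    have pow: "z powr (q/2) = z powr (q/2 - 1) * z" if "z \<ge> 0" for z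
      using that powr_add[of z "q/2 - 1" 1] by simp
    have "(A powr (q/2 - 1) - B powr (q/2 - 1)) * norm y
        = (A powr (q/2 - 1) * B - B powr (q/2)) * B powr (q/2 - 1)"
      using AB by (simp add: x_y_def norm_H A_B_def pow algebra_simps)
    also have "\<dots> \<le> (A powr (q/2) - B powr (q/2)) * A powr (q/2 - 1)"
    proof (intro mult_mono mono)
      show "A powr (q/2 - 1) * B - B powr (q/2) \<le> A powr (q/2) - B powr (q/2)"
        using AB pow[of A] by (simp add: mult_left_mono)
      show "0 \<le> A powr (q/2) - B powr (q/2)" using AB assms by (simp add: powr_mono2)
    qed simp
    also have "\<dots> \<le> norm (x - y) * A powr (q/2 - 1)"
      using norm_triangle_ineq2[of x y] by (intro mult_right_mono) (simp_all add: x_y_def norm_H A_B_def)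
    finally show ?thesis by (simp only: mult.commute)
  qed
  moreover have "max A B = A" using AB by simp
  ultimately show ?thesis unfolding A_B_def x_y_def by (simp add: max.absorb1)
qed

lemma H_growth:
  assumes "2 \<le> q"
  shows "norm (H (q - 1) \<xi> - H (q - 1) \<zeta>)
    \<le> 2 * max (excess \<xi>) (excess \<zeta>) powr (q/2 - 1) * norm (H (q/2) \<xi> - H (q/2) \<zeta>)"
  using H_growth_ordered[OF assms, of \<xi> \<zeta>] H_growth_ordered[OF assms, of \<zeta> \<xi>]
  by (cases "excess \<zeta> \<le> excess \<xi>") (simp_all add: max.commute norm_minus_commute)

section \<open>Integration tools\<close>

lemma lborel_integral_translate:
  fixes f :: "'a::euclidean_space \<Rightarrow> 'b::{banach, second_countable_topology}"
  assumes [measurable]: "f \<in> borel_measurable borel"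
  shows "(\<integral>x. f (x + a) \<partial>lborel) = (\<integral>x. f x \<partial>lborel)"
proof -
  have "(\<integral>x. f x \<partial>lborel) = (\<integral>x. f x \<partial>distr lborel borel ((+) a))"
    by (simp add: lborel_distr_plus)
  also have "\<dots> = (\<integral>x. f (x + a) \<partial>lborel)"
    by (subst integral_distr) (auto simp: add.commute)
  finally show ?thesis by simp
qed

lemma lborel_integrable_translate:
  fixes f :: "'a::euclidean_space \<Rightarrow> 'b::{banach, second_countable_topology}"
  assumes "integrable lborel f"
  shows "integrable lborel (\<lambda>x. f (x + a))"
proof -
  have [measurable]: "f \<in> borel_measurable borel" using assms by (simp add: borel_measurable_integrable)
  have "integrable (distr lborel borel ((+) a)) f" using assms by (simp add: lborel_distr_plus)
  then show ?thesis by (subst (asm) integrable_distr_eq) (auto simp: add.commute)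
qed

lemma lborel_nn_integral_translate:
  fixes f :: "'a::euclidean_space \<Rightarrow> ennreal"
  assumes [measurable]: "f \<in> borel_measurable borel"
  shows "(\<integral>\<^sup>+x. f (x + a) \<partial>lborel) = (\<integral>\<^sup>+x. f x \<partial>lborel)"
proof -
  have "(\<integral>\<^sup>+x. f x \<partial>lborel) = (\<integral>\<^sup>+x. f x \<partial>distr lborel borel ((+) a))"
    by (simp add: lborel_distr_plus)
  also have "\<dots> = (\<integral>\<^sup>+x. f (x + a) \<partial>lborel)"
    by (subst nn_integral_distr) (auto simp: add.commute)
  finally show ?thesis by simp
qed

lemma Hoelder:
  fixes f g :: "'a \<Rightarrow> real"
  assumes pq: "p > 1" "q > 1" "1/p + 1/q = 1"
    and [measurable]: "f \<in> borel_measurable M" "g \<in> borel_measurable M"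
    and f: "integrable M (\<lambda>x. \<bar>f x\<bar> powr p)" and g: "integrable M (\<lambda>x. \<bar>g x\<bar> powr q)"
  shows "integrable M (\<lambda>x. f x * g x)"
    and "\<bar>\<integral>x. f x * g x \<partial>M\<bar> \<le> (\<integral>x. \<bar>f x\<bar> powr p \<partial>M) powr (1/p) * (\<integral>x. \<bar>g x\<bar> powr q \<partial>M) powr (1/q)"
proof -
  have Y: "\<bar>f x * g x\<bar> \<le> \<bar>f x\<bar> powr p / p + \<bar>g x\<bar> powr q / q" for x
    using Youngs_inequality[OF pq, of "\<bar>f x\<bar>" "\<bar>g x\<bar>"] by (simp add: abs_mult)
  show fg: "integrable M (\<lambda>x. f x * g x)"
    by (rule Bochner_Integration.integrable_bound[where f = "\<lambda>x. \<bar>f x\<bar> powr p / p + \<bar>g x\<bar> powr q / q"])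
      (use f g Y in \<open>auto intro: order_trans[OF Y abs_ge_self]\<close>)
  define I J where "I = (\<integral>x. \<bar>f x\<bar> powr p \<partial>M)" and "J = (\<integral>x. \<bar>g x\<bar> powr q \<partial>M)"
  have nonneg: "I \<ge> 0" "J \<ge> 0" by (auto simp: I_def J_def)
  show "\<bar>\<integral>x. f x * g x \<partial>M\<bar> \<le> I powr (1/p) * J powr (1/q)"
  proof (cases "I = 0 \<or> J = 0")
    case True
    then have "(AE x in M. \<bar>f x\<bar> powr p = 0) \<or> (AE x in M. \<bar>g x\<bar> powr q = 0)"
      using integral_nonneg_eq_0_iff_AE[OF f] integral_nonneg_eq_0_iff_AE[OF g] by (auto simp: I_def J_def)
    then have "AE x in M. f x * g x = 0" by (auto elim: eventually_mono)
    then have "(\<integral>x. f x * g x \<partial>M) = (\<integral>x. 0 \<partial>M)" by (intro integral_cong_AE) auto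
    then show ?thesis by simp
  next
    case False
    define a b where "a = I powr (1/p)" and "b = J powr (1/q)"
    have ab: "a > 0" "b > 0" "a powr p = I" "b powr q = J"
      using False nonneg pq by (auto simp: a_def b_def powr_powr)
    have "\<bar>\<integral>x. f x * g x \<partial>M\<bar> \<le> (\<integral>x. \<bar>f x * g x\<bar> \<partial>M)" by (rule integral_abs_bound)
    also have "\<dots> \<le> (\<integral>x. a * b * (\<bar>f x\<bar> powr p / I / p + \<bar>g x\<bar> powr q / J / q) \<partial>M)"
    proof (rule integral_mono)
      fix x
      have "\<bar>f x\<bar> / a * (\<bar>g x\<bar> / b) \<le> (\<bar>f x\<bar> / a) powr p / p + (\<bar>g x\<bar> / b) powr q / q"
        using ab by (intro Youngs_inequality[OF pq]) auto
      also have "\<dots> = \<bar>f x\<bar> powr p / I / p + \<bar>g x\<bar> powr q / J / q"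
        using ab by (simp add: powr_divide)
      finally show "\<bar>f x * g x\<bar> \<le> a * b * (\<bar>f x\<bar> powr p / I / p + \<bar>g x\<bar> powr q / J / q)"
        using ab(1,2) by (simp add: abs_mult field_simps)
    qed (use f g fg in auto)
    also have "\<dots> = a * b * (I / I / p + J / J / q)"
      using f g by (simp add: I_def J_def)
    also have "\<dots> = a * b" using False pq by simp
    finally show ?thesis by (simp add: a_def b_def)
  qed
qed

text \<open>
  Jensen's inequality for a power, obtained from Hoelder's inequality against the constant one. With
  the nonnegative integral on the right it also covers the case where the power is not integrable.
\<close>

lemma powr_integral_le_nn_integral_powr:
  fixes k :: "'a \<Rightarrow> real"
  assumes q: "q > 1" and [measurable]: "k \<in> borel_measurable M" and one: "emeasure M (space M) = 1"
  shows "ennreal (\<bar>\<integral>x. k x \<partial>M\<bar> powr q) \<le> (\<integral>\<^sup>+x. ennreal (\<bar>k x\<bar> powr q) \<partial>M)"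
proof (cases "(\<integral>\<^sup>+x. ennreal (\<bar>k x\<bar> powr q) \<partial>M) = \<infinity>")
  case False
  then have int: "integrable M (\<lambda>x. \<bar>k x\<bar> powr q)"
    by (intro integrableI_bounded) (auto simp: less_top)
  define p where "p = q / (q - 1)"
  have pq: "p > 1" "1/q + 1/p = 1" using q by (auto simp: p_def field_simps)
  interpret finite_measure M using one by (intro finite_measureI) simp
  have "\<bar>\<integral>x. k x * 1 \<partial>M\<bar> \<le> (\<integral>x. \<bar>k x\<bar> powr q \<partial>M) powr (1/q) * (\<integral>x. \<bar>1\<bar> powr p \<partial>M) powr (1/p)"
    by (rule Hoelder[OF q pq]) (use int in auto)
  moreover have "measure M (space M) = 1" using one by (simp add: measure_def)
  ultimately have "\<bar>\<integral>x. k x \<partial>M\<bar> powr q \<le> ((\<integral>x. \<bar>k x\<bar> powr q \<partial>M) powr (1/q)) powr q"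
    using q by (intro powr_mono2) auto
  also have "\<dots> = (\<integral>x. \<bar>k x\<bar> powr q \<partial>M)" using q by (simp add: powr_powr)
  finally show ?thesis using int by (simp add: nn_integral_eq_integral ennreal_leI)
qed simp

text \<open>
  Boxes form an intersection-stable generator of the Borel sets, and the sets over which \<open>F\<close> has
  integral zero form a Dynkin system.
\<close>

lemma AE_zero_if_box_integrals_zero:
  fixes F :: "'a::euclidean_space \<Rightarrow> real"
  assumes F: "integrable lborel F" and box: "\<And>a b. (\<integral>x. indicator (box a b) x * F x \<partial>lborel) = 0"
  shows "AE x in lborel. F x = 0"
proof (rule density_unique_real[OF F])
  have int: "integrable lborel (\<lambda>x. indicator A x * F x)" if "A \<in> sets borel" for A
    using integrable_mult_indicator[OF _ F, of A] that by simp
  have total: "(\<integral>x. F x \<partial>lborel) = 0"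
  proof -
    have "(\<lambda>n. \<integral>x. indicator (box (- real n *\<^sub>R One) (real n *\<^sub>R One)) x * F x \<partial>lborel) \<longlonglongrightarrow> (\<integral>x. F x \<partial>lborel)"
    proof (rule integral_dominated_convergence[where w = "\<lambda>x. \<bar>F x\<bar>"])
      show "AE x in lborel. (\<lambda>n. indicator (box (- real n *\<^sub>R One) (real n *\<^sub>R One)) x * F x) \<longlonglongrightarrow> F x"
      proof (rule AE_I2)
        fix x :: 'a
        obtain N :: nat where N: "norm x < real N" using reals_Archimedean2 by blast
        have "eventually (\<lambda>n. indicator (box (- real n *\<^sub>R One) (real n *\<^sub>R One)) x * F x = F x) sequentially"
          using eventually_ge_at_top[of N]
        proof eventually_elim
          case (elim n)
          have "\<bar>x \<bullet> i\<bar> < real n" if "i \<in> Basis" for i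
            using Basis_le_norm[OF that, of x] N elim by simp
          then have "x \<in> box (- real n *\<^sub>R One) (real n *\<^sub>R One)"
            by (auto simp: mem_box abs_less_iff minus_less_iff)
          then show ?case by simp
        qed
        then show "(\<lambda>n. indicator (box (- real n *\<^sub>R One) (real n *\<^sub>R One)) x * F x) \<longlonglongrightarrow> F x"
          by (rule tendsto_eventually)
      qed
    qed (use F in \<open>auto split: split_indicator\<close>)
    then show ?thesis using box by (simp add: LIMSEQ_const_iff)
  qed
  fix A :: "'a set" assume "A \<in> sets lborel"
  then have A: "A \<in> sigma_sets UNIV (range (\<lambda>(a, b). box a b))"
    by (simp add: borel_eq_box)
  have "Int_stable (range (\<lambda>(a, b). box a b :: 'a set))"
    by (auto simp: Int_stable_def box_Int_box)
  then have "(\<integral>x. indicator A x * F x \<partial>lborel) = 0"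
    using subset_Pow_Union[THEN subset_trans[OF _ Pow_mono[OF subset_UNIV]]] A
  proof (induction A rule: sigma_sets_induct_disjoint)
    case (compl A)
    then have A: "A \<in> sets borel" by (simp add: borel_eq_box)
    have "(\<integral>x. indicator (UNIV - A) x * F x \<partial>lborel) = (\<integral>x. F x - indicator A x * F x \<partial>lborel)"
      by (intro Bochner_Integration.integral_cong) (auto split: split_indicator)
    also have "\<dots> = 0" using F int[OF A] total compl by simp
    finally show ?case .
  next
    case (union A)
    then have "range A \<subseteq> sets borel" by (simp add: borel_eq_box)
    then have A: "A i \<in> sets borel" "\<Union> (range A) \<in> sets borel" for i by auto
    have "(LINT x:(\<Union>i. A i)|lborel. F x) = (\<Sum>i. LINT x:A i|lborel. F x)"
      using A union int[OF A(2)] by (intro lebesgue_integral_countable_add)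
        (auto simp: disjoint_family_on_def set_integrable_def)
    then show ?case using union by (simp add: set_lebesgue_integral_def)
  qed (use box in auto)
  then show "(LINT x:A|lborel. F x) = (LINT x:A|lborel. 0)"
    by (simp add: set_lebesgue_integral_def)
qed simp

lemma bump_scaled_tendsto: "(\<lambda>n. bump (real n * t)) \<longlonglongrightarrow> (if t > 0 then 1 else 0)"
proof (cases "t > 0")
  case True
  have "(\<lambda>n. exp (- (1 / t) * inverse (real n))) \<longlonglongrightarrow> exp (- (1 / t) * 0)"
    by (intro tendsto_intros tendsto_inverse_0_at_top filterlim_real_sequentially)
  moreover have "eventually (\<lambda>n. exp (- (1 / t) * inverse (real n)) = bump (real n * t)) sequentially"
    using eventually_gt_at_top[of 0]
    by eventually_elim (use True in \<open>simp add: bump_def field_simps\<close>)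
  ultimately show ?thesis using True by (simp add: Lim_transform_eventually)
next
  case False
  then show ?thesis by (simp add: bump_def mult_le_0_iff zero_less_mult_iff)
qed

text \<open>
  The indicator of a box is the limit of products of \<open>bump (n * (x $ i - a $ i))\<close> and
  \<open>bump (n * (b $ i - x $ i))\<close>; the weight \<open>bump (R ^ 2 - dist x x0 ^ 2)\<close>, positive exactly on the
  ball, turns them into admissible test functions.
\<close>

lemma fundamental_lemma_ball:
  fixes F :: "real ^ 'n::finite \<Rightarrow> real"
  assumes F: "integrable lborel F" and R: "R > 0"
    and zero: "\<And>\<phi>. smooth \<phi> \<Longrightarrow> (\<And>x. x \<notin> ball x0 R \<Longrightarrow> \<phi> x = 0) \<Longrightarrow> (\<integral>x. F x * \<phi> x \<partial>lborel) = 0"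
  shows "AE x in lborel. x \<in> ball x0 R \<longrightarrow> F x = 0"
proof -
  define \<theta> where "\<theta> x = bump (R\<^sup>2 - (dist x x0)\<^sup>2)" for x
  have \<theta>: "smooth \<theta>"
    unfolding \<theta>_def using C_diff_const by (intro smooth_bump_compose smooth_diff smooth_dist_sq) blast+
  have \<theta>_pos: "\<theta> x > 0 \<longleftrightarrow> x \<in> ball x0 R" for x
    using R by (auto simp: \<theta>_def bump_pos_iff dist_commute power_strict_mono dest: power_less_imp_less_base)
  have \<theta>_bounds: "0 \<le> \<theta> x" "\<theta> x \<le> 1" for x by (auto simp: \<theta>_def bump_nonneg bump_le_1)
  have meas: "\<phi> \<in> borel_measurable borel" if "smooth \<phi>" for \<phi> :: "real ^ 'n \<Rightarrow> real"
    using smooth_continuous[OF that] by (rule borel_measurable_continuous_onI)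
  have [measurable]: "F \<in> borel_measurable borel" "\<theta> \<in> borel_measurable borel"
    using F meas[OF \<theta>] by (auto simp: borel_measurable_integrable)
  have F\<theta>: "integrable lborel (\<lambda>x. F x * \<theta> x)"
    by (rule Bochner_Integration.integrable_bound[OF F])
      (auto simp: abs_mult \<theta>_bounds mult_left_le intro!: AE_I2)
  have "AE x in lborel. F x * \<theta> x = 0"
  proof (rule AE_zero_if_box_integrals_zero[OF F\<theta>])
    fix a b :: "real ^ 'n"
    define \<psi> where "\<psi> n x = (\<Prod>i\<in>UNIV. bump (real n * (x $ i - a $ i)) * bump (real n * (b $ i - x $ i)))" for n x
    have \<psi>: "smooth (\<psi> n)" for n
    proof
      fix k show "C_diff k (\<psi> n)"
        unfolding \<psi>_def
        by (intro C_diff_prod C_diff_mult smooth_bump_compose[THEN spec] smooth_cmult smooth_diff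
            smooth_coordinate allI C_diff_const finite_class.finite_UNIV) 
    qed
    note [measurable] = meas[OF \<psi>]
    have \<psi>_bounds: "0 \<le> \<psi> n x" "\<psi> n x \<le> 1" for n x
      by (auto simp: \<psi>_def bump_nonneg bump_le_1 intro!: prod_nonneg prod_le_1 mult_le_one)
    have lim: "(\<lambda>n. \<psi> n x) \<longlonglongrightarrow> indicator (box a b) x" for x
    proof -
      let ?l = "\<Prod>i\<in>UNIV. (if x $ i - a $ i > 0 then 1 else 0) * (if b $ i - x $ i > 0 then 1 else (0::real))"
      have "(\<lambda>n. \<psi> n x) \<longlonglongrightarrow> ?l"
        unfolding \<psi>_def by (intro tendsto_intros bump_scaled_tendsto)
      moreover have "?l = indicator (box a b) x"
      proof (cases "x \<in> box a b")
        case True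
        then show ?thesis by (simp add: mem_box_cart)
      next
        case False
        then obtain i where "\<not> (a $ i < x $ i \<and> x $ i < b $ i)" by (auto simp: mem_box_cart)
        then have "?l = 0" by (intro prod_zero) auto
        with False show ?thesis by simp
      qed
      ultimately show ?thesis by simp
    qed
    have "(\<lambda>n. \<integral>x. F x * (\<theta> x * \<psi> n x) \<partial>lborel) \<longlonglongrightarrow> (\<integral>x. indicator (box a b) x * (F x * \<theta> x) \<partial>lborel)"
    proof (rule integral_dominated_convergence[where w = "\<lambda>x. \<bar>F x\<bar>"])
      show "AE x in lborel. (\<lambda>n. F x * (\<theta> x * \<psi> n x)) \<longlonglongrightarrow> indicator (box a b) x * (F x * \<theta> x)"
        by (auto intro!: AE_I2 tendsto_eq_intros lim)
      show "AE x in lborel. norm (F x * (\<theta> x * \<psi> n x)) \<le> \<bar>F x\<bar>" for n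
        using \<theta>_bounds \<psi>_bounds by (auto intro!: AE_I2 mult_left_le mult_le_one simp: abs_mult)
    qed (use F in auto)
    moreover have "(\<integral>x. F x * (\<theta> x * \<psi> n x) \<partial>lborel) = 0" for n
    proof (rule zero)
      show "smooth (\<lambda>x. \<theta> x * \<psi> n x)" using \<theta> \<psi> by (auto intro: C_diff_mult)
      show "\<theta> x * \<psi> n x = 0" if "x \<notin> ball x0 R" for x
        using \<theta>_pos[of x] \<theta>_bounds(1)[of x] that by simp
    qed
    ultimately show "(\<integral>x. indicator (box a b) x * (F x * \<theta> x) \<partial>lborel) = 0"
      by (simp add: LIMSEQ_const_iff)
  qed
  then show ?thesis
    by eventually_elim (use \<theta>_pos in \<open>auto simp: less_le\<close>)
qed

section \<open>Difference quotients of Sobolev functions\<close>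

text \<open>
  Test functions are only required to vanish outside \<open>B\<close>: their support may touch the boundary of a ball,
  which is harmless because the ball is used well inside the domain, and for \<open>B = UNIV\<close> they
  range over all smooth functions, which suits functions \<open>U\<close> of compact support.
\<close>

definition weak_gradient_in ::
    "(real ^ 'n::finite) set \<Rightarrow> (real ^ 'n \<Rightarrow> real) \<Rightarrow> (real ^ 'n \<Rightarrow> real ^ 'n) \<Rightarrow> bool" where
  "weak_gradient_in B U G \<longleftrightarrow> (\<forall>\<phi>. smooth \<phi> \<longrightarrow> (\<forall>x. x \<notin> B \<longrightarrow> \<phi> x = 0) \<longrightarrow>
     (\<forall>i. (\<integral>x. U x * partial i \<phi> x \<partial>lborel) = - (\<integral>x. G x $ i * \<phi> x \<partial>lborel)))"

lemma smooth_borel_measurable: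
  "smooth \<phi> \<Longrightarrow> \<phi> \<in> borel_measurable borel"
  using smooth_continuous by (rule borel_measurable_continuous_onI)

lemma smooth_vanishing_bounded:
  fixes \<phi> :: "real ^ 'n::finite \<Rightarrow> real"
  assumes "smooth \<phi>" "\<And>x. x \<notin> cball x0 R \<Longrightarrow> \<phi> x = 0"
  obtains C where "0 \<le> C" "\<And>x. \<bar>\<phi> x\<bar> \<le> C"
proof -
  have "compact (\<phi> ` cball x0 R)"
    using smooth_continuous[OF assms(1)] by (intro compact_continuous_image) (auto intro: continuous_on_subset)
  then obtain C where "\<forall>y\<in>\<phi> ` cball x0 R. norm y \<le> C"
    using compact_imp_bounded bounded_iff by blast
  then have C: "\<bar>\<phi> x\<bar> \<le> C" if "x \<in> cball x0 R" for x using that by auto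
  have "\<bar>\<phi> x\<bar> \<le> max C 0" for x using C[of x] assms(2)[of x] by (cases "x \<in> cball x0 R") auto
  with that[of "max C 0"] show thesis by simp
qed

lemma smooth_partial_bounded:
  fixes \<phi> :: "real ^ 'n::finite \<Rightarrow> real"
  assumes "smooth \<phi>" "\<And>x. x \<notin> cball x0 R \<Longrightarrow> \<phi> x = 0"
  obtains C where "0 \<le> C" "\<And>i x. \<bar>partial i \<phi> x\<bar> \<le> C"
proof -
  have "\<forall>i. \<exists>C. 0 \<le> C \<and> (\<forall>x. \<bar>partial i \<phi> x\<bar> \<le> C)"
  proof
    fix i
    have "partial i \<phi> x = 0" if "x \<notin> cball x0 R" for x
      by (rule partial_zero_off_closed[OF closed_cball assms(2) that])
    from smooth_vanishing_bounded[OF smooth_partial[OF assms(1)] this]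
    show "\<exists>C. 0 \<le> C \<and> (\<forall>x. \<bar>partial i \<phi> x\<bar> \<le> C)" by (metis (full_types))
  qed
  from choice[OF this] obtain C where C: "\<And>i. 0 \<le> C i" "\<And>i x. \<bar>partial i \<phi> x\<bar> \<le> C i" by blast
  have "\<bar>partial i \<phi> x\<bar> \<le> (\<Sum>i\<in>UNIV. C i)" for i x
    using C(2)[of i x] member_le_sum[of i UNIV C] C(1) by (auto intro: order_trans)
  with that[of "\<Sum>i\<in>UNIV. C i"] C(1) show thesis by (simp add: sum_nonneg)
qed

lemma integrable_times_bounded:
  fixes f g :: "'a \<Rightarrow> real"
  assumes "integrable M f" "g \<in> borel_measurable M" "\<And>x. \<bar>g x\<bar> \<le> C"
  shows "integrable M (\<lambda>x. f x * g x)"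
proof (rule Bochner_Integration.integrable_bound)
  show "integrable M (\<lambda>x. C * f x)" using assms(1) by simp
  show "AE x in M. norm (f x * g x) \<le> norm (C * f x)"
  proof (rule AE_I2)
    fix x have "\<bar>g x\<bar> * \<bar>f x\<bar> \<le> \<bar>C\<bar> * \<bar>f x\<bar>"
      using assms(3)[of x] by (intro mult_right_mono) auto
    then show "norm (f x * g x) \<le> norm (C * f x)" by (simp add: abs_mult mult.commute)
  qed
qed (use assms in auto)

abbreviation unit_interval_measure :: "real measure" where
  "unit_interval_measure \<equiv> restrict_space lborel {0..1}"

lemma unit_interval_measure_total [simp]: "emeasure unit_interval_measure {0..1} = 1"
  by (simp add: emeasure_restrict_space)

lemma pair_lborel_unit_interval: "pair_sigma_finite lborel unit_interval_measure"
proof -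
  have "finite_measure unit_interval_measure"
    by (rule finite_measureI) simp
  then show ?thesis
    by (intro pair_sigma_finite.intro sigma_finite_lborel finite_measure.axioms(1)) 
qed

lemma translate_along_measurable:
  fixes G :: "'a::euclidean_space \<Rightarrow> 'b::{second_countable_topology, topological_space}"
  assumes [measurable]: "G \<in> borel_measurable borel"
  shows "(\<lambda>(x, t). G (x + t *\<^sub>R h)) \<in> borel_measurable (lborel \<Otimes>\<^sub>M unit_interval_measure)"
proof -
  have [measurable]: "(\<lambda>t. t) \<in> borel_measurable unit_interval_measure"
    by (rule measurable_restrict_space1) simp
  show ?thesis by measurable
qed

lemma translate_along_integrable:
  fixes g :: "'a::euclidean_space \<Rightarrow> 'b::{banach, second_countable_topology}"
  assumes g: "integrable lborel g"
  shows "integrable (lborel \<Otimes>\<^sub>M unit_interval_measure) (\<lambda>(x, t). g (x + t *\<^sub>R h))"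
proof -
  interpret pair_sigma_finite lborel unit_interval_measure by (rule pair_lborel_unit_interval)
  have [measurable]: "g \<in> borel_measurable borel" using g by (simp add: borel_measurable_integrable)
  note m = translate_along_measurable[of g h]
  note [measurable] = m
  have "(\<integral>\<^sup>+z. ennreal (norm (case z of (x, t) \<Rightarrow> g (x + t *\<^sub>R h))) \<partial>(lborel \<Otimes>\<^sub>M unit_interval_measure))
      = (\<integral>\<^sup>+t. \<integral>\<^sup>+x. ennreal (norm (g (x + t *\<^sub>R h))) \<partial>lborel \<partial>unit_interval_measure)"
    by (subst nn_integral_snd[symmetric]) auto
  also have "\<dots> = (\<integral>\<^sup>+t. \<integral>\<^sup>+x. ennreal (norm (g x)) \<partial>lborel \<partial>unit_interval_measure)"
    by (intro nn_integral_cong lborel_nn_integral_translate[of "\<lambda>x. ennreal (norm (g x))"]) simp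
  also have "\<dots> = (\<integral>\<^sup>+x. ennreal (norm (g x)) \<partial>lborel)"
    by simp
  also have "\<dots> < \<infinity>" using g by (simp add: integrable_iff_bounded)
  finally show ?thesis using m by (intro integrableI_bounded) auto
qed

lemma smooth_segment_integral:
  fixes \<phi> :: "real ^ 'n::finite \<Rightarrow> real"
  assumes \<phi>: "smooth \<phi>"
  shows "\<phi> (x - h) - \<phi> x = - (\<integral>t. (\<Sum>i\<in>UNIV. h $ i * partial i \<phi> (x - t *\<^sub>R h)) \<partial>unit_interval_measure)"
proof -
  define D where "D t = (\<Sum>i\<in>UNIV. h $ i * partial i \<phi> (x - t *\<^sub>R h))" for t
  have cont: "continuous_on UNIV D"
    unfolding D_def
    by (intro continuous_intros continuous_on_compose2[OF smooth_continuous[OF smooth_partial[OF \<phi>]]]) auto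
  have deriv: "((\<lambda>t. \<phi> (x - t *\<^sub>R h)) has_vector_derivative - D t) (at t within {0..1})" for t
  proof -
    have "((\<lambda>t. \<phi> (x - t *\<^sub>R h)) has_derivative
        (\<lambda>s. \<Sum>i\<in>UNIV. (- (s *\<^sub>R h)) $ i * partial i \<phi> (x - t *\<^sub>R h))) (at t)"
      by (rule has_derivative_compose[OF _ has_derivative_partial[OF smooth_differentiable[OF \<phi>]]])
        (auto intro!: derivative_eq_intros)
    moreover have "(\<lambda>s. \<Sum>i\<in>UNIV. (- (s *\<^sub>R h)) $ i * partial i \<phi> (x - t *\<^sub>R h)) = (\<lambda>s. s *\<^sub>R - D t)"
      by (simp add: D_def sum_distrib_left sum_negf mult.assoc)
    ultimately show ?thesis
      unfolding has_vector_derivative_def by (metis has_derivative_at_withinI)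
  qed
  have "(\<integral>t. indicator {0..1} t *\<^sub>R - D t \<partial>lborel) = \<phi> (x - 1 *\<^sub>R h) - \<phi> (x - 0 *\<^sub>R h)"
    by (rule integral_FTC_atLeastAtMost[OF zero_le_one deriv continuous_on_minus[OF continuous_on_subset[OF cont subset_UNIV]]])
  moreover have "(\<integral>t. D t \<partial>unit_interval_measure) = (\<integral>t. indicator {0..1} t *\<^sub>R D t \<partial>lborel)"
    by (rule integral_restrict_space) simp
  ultimately show ?thesis by (simp add: D_def)
qed

text \<open>
  Testing with \<open>\<phi> (x - h) - \<phi> x\<close>, which is an average of derivatives of translates of \<open>\<phi>\<close>, moves
  the derivative from \<open>\<phi>\<close> to \<open>U\<close>; Fubini's theorem and the fundamental lemma then give the
  fundamental theorem of calculus for \<open>U\<close> along almost every segment.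
\<close>

lemma sobolev_segment_integral:
  fixes U :: "real ^ 'n::finite \<Rightarrow> real" and G :: "real ^ 'n \<Rightarrow> real ^ 'n"
  assumes U: "integrable lborel U" and G: "integrable lborel G"
    and wg: "weak_gradient_in (ball x0 (R + r)) U G" and R: "R > 0" and h: "norm h \<le> r"
  shows "AE x in lborel. x \<in> ball x0 R \<longrightarrow>
    U (x + h) - U x = (\<integral>t. G (x + t *\<^sub>R h) \<bullet> h \<partial>unit_interval_measure)"
proof -
  interpret pair_sigma_finite lborel unit_interval_measure by (rule pair_lborel_unit_interval)
  let ?P = "lborel \<Otimes>\<^sub>M unit_interval_measure :: ((real ^ 'n) \<times> real) measure"
  have [measurable]: "U \<in> borel_measurable borel" "G \<in> borel_measurable borel"
    using U G by (auto simp: borel_measurable_integrable)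
  have Gi: "integrable lborel (\<lambda>x. G x $ i)" for i
    using integrable_bounded_linear[OF bounded_linear_vec_nth G] .
  have Gh: "integrable lborel (\<lambda>x. G x \<bullet> h)" using G by simp
  define g where "g x = (\<integral>t. G (x + t *\<^sub>R h) \<bullet> h \<partial>unit_interval_measure)" for x
  have Gh_prod: "integrable ?P (\<lambda>(x, t). G (x + t *\<^sub>R h) \<bullet> h)"
    by (rule translate_along_integrable[OF Gh])
  then have g: "integrable lborel g" unfolding g_def by (rule integrable_fst)
  have "AE x in lborel. x \<in> ball x0 R \<longrightarrow> U (x + h) - U x - g x = 0"
  proof (rule fundamental_lemma_ball[OF _ R])
    show "integrable lborel (\<lambda>x. U (x + h) - U x - g x)"
      using U g lborel_integrable_translate[OF U] by auto
    fix \<phi> :: "real ^ 'n \<Rightarrow> real" assume \<phi>: "smooth \<phi>" and zero: "\<And>x. x \<notin> ball x0 R \<Longrightarrow> \<phi> x = 0"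
    have zero': "\<phi> x = 0" if "x \<notin> cball x0 R" for x using that by (intro zero) auto
    obtain C where C: "\<And>x. \<bar>\<phi> x\<bar> \<le> C" using smooth_vanishing_bounded[OF \<phi> zero'] by blast
    obtain D where D: "\<And>i x. \<bar>partial i \<phi> x\<bar> \<le> D" using smooth_partial_bounded[OF \<phi> zero'] by blast
    note [measurable] = smooth_borel_measurable[OF \<phi>] smooth_borel_measurable[OF smooth_partial[OF \<phi>]]
    have int\<phi>: "integrable lborel (\<lambda>x. f x * \<phi> (x - a))" if "integrable lborel f" for f a
      by (rule integrable_times_bounded[OF that _ C]) measurable
    have U\<phi>: "integrable lborel (\<lambda>x. U x * \<phi> (x - h))" "integrable lborel (\<lambda>x. U x * \<phi> x)"
      "integrable lborel (\<lambda>x. g x * \<phi> x)" "integrable lborel (\<lambda>x. U (x + h) * \<phi> x)"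
      using int\<phi>[OF U, of h] int\<phi>[OF U, of 0] int\<phi>[OF g, of 0]
        int\<phi>[OF lborel_integrable_translate[OF U, of h], of 0] by simp_all
    have m: "(\<lambda>(x, t). partial i \<phi> (x - t *\<^sub>R h)) \<in> borel_measurable ?P" for i
      using translate_along_measurable[of "partial i \<phi>" "- h"] smooth_borel_measurable[OF smooth_partial[OF \<phi>]]
      by simp
    have int1: "integrable ?P (\<lambda>(x, t). U x * (h $ i * partial i \<phi> (x - t *\<^sub>R h)))" for i
    proof -
      have "integrable ?P (\<lambda>z. (case z of (x, t) \<Rightarrow> U (x + t *\<^sub>R 0)) * (h $ i * (case z of (x, t) \<Rightarrow> partial i \<phi> (x - t *\<^sub>R h))))"
      proof (rule integrable_times_bounded)
        show "\<bar>h $ i * (case z of (x, t) \<Rightarrow> partial i \<phi> (x - t *\<^sub>R h))\<bar> \<le> \<bar>h $ i\<bar> * D" for z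
          using D by (auto simp: abs_mult split: prod.split intro!: mult_left_mono)
        show "integrable ?P (\<lambda>(x, t). U (x + t *\<^sub>R 0))" by (rule translate_along_integrable[OF U])
      qed (use m in measurable)
      then show ?thesis by (simp add: case_prod_unfold)
    qed
    have "(\<integral>x. U (x + h) * \<phi> x \<partial>lborel) = (\<integral>x. U x * \<phi> (x - h) \<partial>lborel)"
      using lborel_integral_translate[of "\<lambda>x. U x * \<phi> (x - h)" h] by simp
    then have "(\<integral>x. U (x + h) * \<phi> x \<partial>lborel) - (\<integral>x. U x * \<phi> x \<partial>lborel)
        = (\<integral>x. U x * (\<phi> (x - h) - \<phi> x) \<partial>lborel)"
      using U\<phi> by (simp add: right_diff_distrib)
    also have "\<dots> = - (\<integral>x. \<integral>t. (\<Sum>i\<in>UNIV. U x * (h $ i * partial i \<phi> (x - t *\<^sub>R h))) \<partial>unit_interval_measure \<partial>lborel)"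
      by (simp add: smooth_segment_integral[OF \<phi>] flip: sum_distrib_left)
    also have "\<dots> = - (\<integral>t. \<integral>x. (\<Sum>i\<in>UNIV. U x * (h $ i * partial i \<phi> (x - t *\<^sub>R h))) \<partial>lborel \<partial>unit_interval_measure)"
    proof (subst Fubini_integral)
      have "integrable ?P (\<lambda>z. \<Sum>i\<in>UNIV. case z of (x, t) \<Rightarrow> U x * (h $ i * partial i \<phi> (x - t *\<^sub>R h)))"
        using int1 by auto
      then show "integrable ?P (\<lambda>(x, t). \<Sum>i\<in>UNIV. U x * (h $ i * partial i \<phi> (x - t *\<^sub>R h)))"
        by (simp add: case_prod_unfold)
    qed simp
    also have "\<dots> = (\<integral>t. \<integral>x. G (x + t *\<^sub>R h) \<bullet> h * \<phi> x \<partial>lborel \<partial>unit_interval_measure)"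
    proof -
      have "- (\<integral>x. (\<Sum>i\<in>UNIV. U x * (h $ i * partial i \<phi> (x - t *\<^sub>R h))) \<partial>lborel)
          = (\<integral>x. G (x + t *\<^sub>R h) \<bullet> h * \<phi> x \<partial>lborel)" if t: "t \<in> {0..1}" for t
      proof -
        define \<psi> where "\<psi> x = \<phi> (x + - (t *\<^sub>R h))" for x
        have \<psi>: "smooth \<psi>" unfolding \<psi>_def by (intro allI C_diff_translate \<phi>[rule_format])
        have p\<psi>: "partial i \<psi> x = partial i \<phi> (x - t *\<^sub>R h)" for i x
          unfolding \<psi>_def using partial_translate[of \<phi> x "- (t *\<^sub>R h)"] smooth_differentiable[OF \<phi>] by simp
        have \<psi>_zero: "\<psi> x = 0" if "x \<notin> ball x0 (R + r)" for x
          unfolding \<psi>_def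
        proof (rule zero)
          have "t * norm h \<le> r" using t h mult_mono[of t 1 "norm h" r] by auto
          then have "norm (t *\<^sub>R h) \<le> r" using t by simp
          moreover have "dist x0 x \<le> dist x0 (x + - (t *\<^sub>R h)) + norm (t *\<^sub>R h)"
            using dist_triangle[of x0 x "x + - (t *\<^sub>R h)"] by (simp add: dist_norm)
          ultimately show "x + - (t *\<^sub>R h) \<notin> ball x0 R" using that by auto
        qed
        have int: "integrable lborel (\<lambda>x. U x * partial i \<psi> x)" for i
          unfolding p\<psi> by (rule integrable_times_bounded[OF U _ D]) measurable
        have intG: "integrable lborel (\<lambda>x. G x $ i * \<psi> x)" for i
          using int\<phi>[OF Gi, of i "t *\<^sub>R h"] by (simp add: \<psi>_def)
        have "- (\<integral>x. (\<Sum>i\<in>UNIV. U x * (h $ i * partial i \<phi> (x - t *\<^sub>R h))) \<partial>lborel)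
            = - (\<integral>x. (\<Sum>i\<in>UNIV. h $ i * (U x * partial i \<psi> x)) \<partial>lborel)"
          by (simp add: p\<psi> mult.left_commute)
        also have "\<dots> = (\<Sum>i\<in>UNIV. h $ i * - (\<integral>x. U x * partial i \<psi> x \<partial>lborel))"
          using int by (simp add: sum_negf)
        also have "\<dots> = (\<Sum>i\<in>UNIV. h $ i * (\<integral>x. G x $ i * \<psi> x \<partial>lborel))"
          using wg[unfolded weak_gradient_in_def, rule_format, OF \<psi>[rule_format] \<psi>_zero] by simp
        also have "\<dots> = (\<integral>x. (\<Sum>i\<in>UNIV. h $ i * (G x $ i * \<psi> x)) \<partial>lborel)"
          using intG by simp
        also have "\<dots> = (\<integral>x. G x \<bullet> h * \<phi> (x - t *\<^sub>R h) \<partial>lborel)"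
          by (simp add: inner_vec_def sum_distrib_right sum_distrib_left \<psi>_def mult_ac)
        also have "\<dots> = (\<integral>x. G (x + t *\<^sub>R h) \<bullet> h * \<phi> x \<partial>lborel)"
        proof -
          have "(\<lambda>x. G x \<bullet> h * \<phi> (x - t *\<^sub>R h)) \<in> borel_measurable borel" by measurable
          from lborel_integral_translate[OF this, of "t *\<^sub>R h"] show ?thesis
            by (simp only: add_diff_cancel_right')
        qed
        finally show ?thesis .
      qed
      then show ?thesis
        by (subst Bochner_Integration.integral_minus[symmetric])
          (intro Bochner_Integration.integral_cong, auto simp: space_restrict_space)
    qed
    also have "\<dots> = (\<integral>x. \<integral>t. G (x + t *\<^sub>R h) \<bullet> h * \<phi> x \<partial>unit_interval_measure \<partial>lborel)"
    proof (rule Fubini_integral)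
      have "integrable ?P (\<lambda>z. (case z of (x, t) \<Rightarrow> G (x + t *\<^sub>R h) \<bullet> h) * \<phi> (fst z))"
        by (rule integrable_times_bounded[OF Gh_prod _ C]) measurable
      then show "integrable ?P (\<lambda>(x, t). G (x + t *\<^sub>R h) \<bullet> h * \<phi> x)"
        by (simp add: case_prod_unfold)
    qed
    also have "\<dots> = (\<integral>x. g x * \<phi> x \<partial>lborel)" by (simp add: g_def)
    finally show "(\<integral>x. (U (x + h) - U x - g x) * \<phi> x \<partial>lborel) = 0"
      using U\<phi> by (simp add: left_diff_distrib)
  qed
  then show ?thesis
    by (rule eventually_mono) (simp add: g_def)
qed

text \<open>
  The integral over a segment is raised to the power \<open>q\<close> by Jensen's inequality, and Tonelli's theorem
  together with translation invariance removes the average over the segment.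
\<close>

lemma difference_quotient_bound:
  fixes U :: "real ^ 'n::finite \<Rightarrow> real" and G :: "real ^ 'n \<Rightarrow> real ^ 'n"
  assumes U: "integrable lborel U" and G: "integrable lborel G"
    and wg: "weak_gradient_in (ball x0 (R + r)) U G" and R: "R > 0" and h: "norm h \<le> r" and q: "q > 1"
  shows "(\<integral>\<^sup>+x. ennreal (indicator (ball x0 R) x * \<bar>U (x + h) - U x\<bar> powr q) \<partial>lborel)
    \<le> ennreal (norm h powr q) * (\<integral>\<^sup>+x. ennreal (norm (G x) powr q) \<partial>lborel)"
proof -
  interpret pair_sigma_finite lborel unit_interval_measure by (rule pair_lborel_unit_interval)
  have [measurable]: "U \<in> borel_measurable borel" "G \<in> borel_measurable borel"
    using U G by (auto simp: borel_measurable_integrable)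
  have m: "(\<lambda>t. G (x + t *\<^sub>R h) \<bullet> h) \<in> borel_measurable unit_interval_measure" for x
    by (rule measurable_restrict_space1) measurable
  have mprod: "(\<lambda>(x, t). ennreal (norm (G (x + t *\<^sub>R h)) powr q)) \<in> borel_measurable (lborel \<Otimes>\<^sub>M unit_interval_measure)"
    by (rule translate_along_measurable[of "\<lambda>x. ennreal (norm (G x) powr q)"]) measurable
  have "(\<integral>\<^sup>+x. ennreal (indicator (ball x0 R) x * \<bar>U (x + h) - U x\<bar> powr q) \<partial>lborel)
      \<le> (\<integral>\<^sup>+x. \<integral>\<^sup>+t. ennreal (norm h powr q) * ennreal (norm (G (x + t *\<^sub>R h)) powr q) \<partial>unit_interval_measure \<partial>lborel)"
    using sobolev_segment_integral[OF U G wg R h]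
  proof (rule nn_integral_mono_AE[OF eventually_mono])
    fix x
    assume x: "x \<in> ball x0 R \<longrightarrow> U (x + h) - U x = (\<integral>t. G (x + t *\<^sub>R h) \<bullet> h \<partial>unit_interval_measure)"
    have "ennreal (\<bar>\<integral>t. G (x + t *\<^sub>R h) \<bullet> h \<partial>unit_interval_measure\<bar> powr q)
        \<le> (\<integral>\<^sup>+t. ennreal (\<bar>G (x + t *\<^sub>R h) \<bullet> h\<bar> powr q) \<partial>unit_interval_measure)"
      by (rule powr_integral_le_nn_integral_powr[OF q m]) simp
    also have "\<dots> \<le> (\<integral>\<^sup>+t. ennreal (norm h powr q) * ennreal (norm (G (x + t *\<^sub>R h)) powr q) \<partial>unit_interval_measure)"
    proof (rule nn_integral_mono)
      fix t
      have "\<bar>G (x + t *\<^sub>R h) \<bullet> h\<bar> powr q \<le> (norm h * norm (G (x + t *\<^sub>R h))) powr q"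
        using q Cauchy_Schwarz_ineq2[of "G (x + t *\<^sub>R h)" h] by (intro powr_mono2) (auto simp: mult.commute)
      also have "\<dots> = norm h powr q * norm (G (x + t *\<^sub>R h)) powr q" by (simp add: powr_mult)
      finally show "ennreal (\<bar>G (x + t *\<^sub>R h) \<bullet> h\<bar> powr q)
          \<le> ennreal (norm h powr q) * ennreal (norm (G (x + t *\<^sub>R h)) powr q)"
        by (simp add: ennreal_leI flip: ennreal_mult)
    qed
    finally show "ennreal (indicator (ball x0 R) x * \<bar>U (x + h) - U x\<bar> powr q)
        \<le> (\<integral>\<^sup>+t. ennreal (norm h powr q) * ennreal (norm (G (x + t *\<^sub>R h)) powr q) \<partial>unit_interval_measure)"
      using x by (cases "x \<in> ball x0 R") auto
  qed
  also have "\<dots> = (\<integral>\<^sup>+t. \<integral>\<^sup>+x. ennreal (norm h powr q) * ennreal (norm (G (x + t *\<^sub>R h)) powr q) \<partial>lborel \<partial>unit_interval_measure)"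
    using mprod by (intro Fubini'[symmetric]) (auto simp: case_prod_unfold)
  also have "\<dots> = (\<integral>\<^sup>+t. ennreal (norm h powr q) * (\<integral>\<^sup>+x. ennreal (norm (G x) powr q) \<partial>lborel) \<partial>unit_interval_measure)"
    using lborel_nn_integral_translate[of "\<lambda>x. ennreal (norm (G x) powr q)"]
    by (simp add: nn_integral_cmult)
  also have "\<dots> = ennreal (norm h powr q) * (\<integral>\<^sup>+x. ennreal (norm (G x) powr q) \<partial>lborel)"
    by simp
  finally show ?thesis .
qed

section \<open>The Caccioppoli-type estimate for translates\<close>

lemma borel_measurable_vec_nth [measurable (raw)]:
  fixes f :: "'a \<Rightarrow> real ^ 'n::finite"
  assumes "f \<in> borel_measurable M"
  shows "(\<lambda>x. f x $ i) \<in> borel_measurable M"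
  by (rule borel_measurable_continuous_on[OF _ assms]) (intro continuous_intros)

lemma norm_add_powr_le:
  fixes a b :: "'a::real_normed_vector"
  assumes "0 \<le> q"
  shows "norm (a + b) powr q \<le> 2 powr q * (norm a powr q + norm b powr q)"
proof -
  have "norm (a + b) \<le> 2 * max (norm a) (norm b)" using norm_triangle_ineq[of a b] by simp
  then have "norm (a + b) powr q \<le> (2 * max (norm a) (norm b)) powr q" using assms by (intro powr_mono2) auto
  also have "\<dots> = 2 powr q * max (norm a) (norm b) powr q" by (simp add: powr_mult)
  also have "max (norm a) (norm b) powr q \<le> norm a powr q + norm b powr q" by (simp add: max_def)
  finally show ?thesis by simp
qed

lemma integrable_norm_powr_add:
  fixes f g :: "'a \<Rightarrow> 'b::{second_countable_topology, real_normed_vector}"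
  assumes "0 \<le> q" and [measurable]: "f \<in> borel_measurable M" "g \<in> borel_measurable M"
    and "integrable M (\<lambda>x. norm (f x) powr q)" "integrable M (\<lambda>x. norm (g x) powr q)"
  shows "integrable M (\<lambda>x. norm (f x + g x) powr q)"
proof (rule Bochner_Integration.integrable_bound)
  show "integrable M (\<lambda>x. 2 powr q * (norm (f x) powr q + norm (g x) powr q))" using assms by simp
  show "AE x in M. norm (norm (f x + g x) powr q) \<le> norm (2 powr q * (norm (f x) powr q + norm (g x) powr q))"
    using norm_add_powr_le[OF assms(1)] by (intro AE_I2) (auto simp: abs_mult)
qed measurable

lemma integrable_norm_powr_diff:
  fixes f g :: "'a \<Rightarrow> 'b::{second_countable_topology, real_normed_vector}"
  assumes "0 \<le> q" "f \<in> borel_measurable M" "g \<in> borel_measurable M"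
    and "integrable M (\<lambda>x. norm (f x) powr q)" "integrable M (\<lambda>x. norm (g x) powr q)"
  shows "integrable M (\<lambda>x. norm (f x - g x) powr q)"
  using integrable_norm_powr_add[of q f M "\<lambda>x. - g x"] assms by simp

lemma integrable_norm_powr_bound:
  fixes f :: "'a \<Rightarrow> 'b::{second_countable_topology, real_normed_vector}"
    and g :: "'a \<Rightarrow> 'c::{second_countable_topology, real_normed_vector}"
  assumes "0 \<le> q" and [measurable]: "f \<in> borel_measurable M"
    and g: "integrable M (\<lambda>x. norm (g x) powr q)" and le: "\<And>x. norm (f x) \<le> C * norm (g x)"
  shows "integrable M (\<lambda>x. norm (f x) powr q)"
proof (rule Bochner_Integration.integrable_bound)
  show "integrable M (\<lambda>x. \<bar>C\<bar> powr q * norm (g x) powr q)" using g by simp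
  show "AE x in M. norm (norm (f x) powr q) \<le> norm (\<bar>C\<bar> powr q * norm (g x) powr q)"
  proof (rule AE_I2)
    fix x
    have "norm (f x) \<le> \<bar>C\<bar> * norm (g x)"
      using le[of x] mult_right_mono[OF abs_ge_self[of C], of "norm (g x)"] by simp
    then have "norm (f x) powr q \<le> (\<bar>C\<bar> * norm (g x)) powr q" using assms(1) by (intro powr_mono2) auto
    then show "norm (norm (f x) powr q) \<le> norm (\<bar>C\<bar> powr q * norm (g x) powr q)"
      by (simp add: powr_mult)
  qed
qed measurable

lemma integrable_inner_conjugate:
  fixes f g :: "'a \<Rightarrow> 'b::euclidean_space"
  assumes pq: "p > 1" "q > 1" "1/p + 1/q = 1"
    and [measurable]: "f \<in> borel_measurable M" "g \<in> borel_measurable M"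
    and f: "integrable M (\<lambda>x. norm (f x) powr p)" and g: "integrable M (\<lambda>x. norm (g x) powr q)"
  shows "integrable M (\<lambda>x. f x \<bullet> g x)"
proof (rule Bochner_Integration.integrable_bound)
  show "integrable M (\<lambda>x. norm (f x) * norm (g x))"
    using f g by (intro Hoelder(1)[OF pq]) auto
  show "AE x in M. norm (f x \<bullet> g x) \<le> norm (norm (f x) * norm (g x))"
    using Cauchy_Schwarz_ineq2 by (intro AE_I2) auto
qed measurable

lemma integrable_if_powr_integrable:
  fixes f :: "real ^ 'n::finite \<Rightarrow> 'b::{banach, second_countable_topology}"
  assumes q: "1 \<le> q" and [measurable]: "f \<in> borel_measurable borel"
    and f: "integrable lborel (\<lambda>x. norm (f x) powr q)" and zero: "\<And>x. x \<notin> cball x0 \<rho> \<Longrightarrow> f x = 0"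
  shows "integrable lborel f"
proof (rule Bochner_Integration.integrable_bound)
  show "integrable lborel (\<lambda>x. indicator (cball x0 \<rho>) x + norm (f x) powr q)"
    using f emeasure_bounded_finite[OF bounded_cball] by (intro Bochner_Integration.integrable_add integrable_real_indicator) auto
  show "AE x in lborel. norm (f x) \<le> norm (indicator (cball x0 \<rho>) x + norm (f x) powr q)"
  proof (rule AE_I2)
    fix x
    consider "x \<notin> cball x0 \<rho>" | "x \<in> cball x0 \<rho>" "norm (f x) \<le> 1" | "norm (f x) > 1" by linarith
    then show "norm (f x) \<le> norm (indicator (cball x0 \<rho>) x + norm (f x) powr q)"
    proof cases
      case 2
      then show ?thesis by (simp add: add_increasing2)
    next
      case 3
      then have "norm (f x) powr 1 \<le> norm (f x) powr q" using q by (intro powr_mono) auto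
      then have "norm (f x) \<le> norm (f x) powr q" by simp
      then show ?thesis by (simp add: indicator_def)
    qed (simp add: zero)
  qed
qed measurable

lemma integrable_times_continuous:
  fixes f g :: "real ^ 'n::finite \<Rightarrow> real"
  assumes f: "integrable lborel f" and zero: "\<And>x. x \<notin> cball x0 \<rho> \<Longrightarrow> f x = 0" and g: "continuous_on UNIV g"
  shows "integrable lborel (\<lambda>x. f x * g x)"
proof -
  have "compact (g ` cball x0 \<rho>)"
    by (intro compact_continuous_image compact_cball continuous_on_subset[OF g]) simp
  then obtain C where C: "\<forall>y\<in>g ` cball x0 \<rho>. norm y \<le> C"
    using compact_imp_bounded bounded_iff by blast
  have [measurable]: "g \<in> borel_measurable borel" using g by (rule borel_measurable_continuous_onI)
  have "integrable lborel (\<lambda>x. f x * (indicator (cball x0 \<rho>) x * g x))"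
  proof (rule integrable_times_bounded[OF f])
    show "\<bar>indicator (cball x0 \<rho>) x * g x\<bar> \<le> \<bar>C\<bar>" for x
      using C by (cases "x \<in> cball x0 \<rho>") force+
    show "(\<lambda>x. indicator (cball x0 \<rho>) x * g x) \<in> borel_measurable lborel"
      by (intro borel_measurable_times borel_measurable_indicator) auto
  qed
  moreover have "f x * (indicator (cball x0 \<rho>) x * g x) = f x * g x" for x
    using zero[of x] by (cases "x \<in> cball x0 \<rho>") auto
  ultimately show ?thesis by simp
qed

lemma weak_gradient_in_translate:
  assumes wg: "weak_gradient_in B U G" and sub: "\<And>x. x \<in> A \<Longrightarrow> x + a \<in> B"
    and [measurable]: "U \<in> borel_measurable borel" "G \<in> borel_measurable borel"
  shows "weak_gradient_in A (\<lambda>x. U (x + a)) (\<lambda>x. G (x + a))"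
  unfolding weak_gradient_in_def
proof (intro allI impI)
  fix \<phi> :: "real ^ 'a \<Rightarrow> real" and i
  assume \<phi>: "smooth \<phi>" and zero: "\<forall>x. x \<notin> A \<longrightarrow> \<phi> x = 0"
  define \<psi> where "\<psi> x = \<phi> (x + - a)" for x
  have \<psi>: "smooth \<psi>" unfolding \<psi>_def by (intro allI C_diff_translate \<phi>[rule_format])
  have p\<psi>: "partial i \<psi> x = partial i \<phi> (x + - a)" for x
    unfolding \<psi>_def by (rule partial_translate[OF smooth_differentiable[OF \<phi>]])
  note [measurable] = smooth_borel_measurable[OF \<psi>] smooth_borel_measurable[OF smooth_partial[OF \<psi>]]
  have "\<forall>x. x \<notin> B \<longrightarrow> \<psi> x = 0"
  proof (intro allI impI)
    fix x assume "x \<notin> B"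
    then have "x + - a \<notin> A" using sub[of "x + - a"] by auto
    then show "\<psi> x = 0" using zero unfolding \<psi>_def by blast
  qed
  then have "(\<integral>x. U x * partial i \<psi> x \<partial>lborel) = - (\<integral>x. G x $ i * \<psi> x \<partial>lborel)"
    using wg \<psi> unfolding weak_gradient_in_def by blast
  moreover have "(\<integral>x. U (x + a) * partial i \<psi> (x + a) \<partial>lborel) = (\<integral>x. U x * partial i \<psi> x \<partial>lborel)"
    by (rule lborel_integral_translate) measurable
  moreover have "(\<integral>x. G (x + a) $ i * \<psi> (x + a) \<partial>lborel) = (\<integral>x. G x $ i * \<psi> x \<partial>lborel)"
    by (rule lborel_integral_translate) measurable
  ultimately show "(\<integral>x. U (x + a) * partial i \<phi> x \<partial>lborel) = - (\<integral>x. G (x + a) $ i * \<phi> x \<partial>lborel)"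
    unfolding p\<psi> by (simp add: \<psi>_def)
qed

lemma weak_gradient_in_diff:
  fixes G1 G2 :: "real ^ 'n::finite \<Rightarrow> real ^ 'n"
  assumes wg: "weak_gradient_in B U1 G1" "weak_gradient_in B U2 G2"
    and int: "integrable lborel U1" "integrable lborel U2" "integrable lborel G1" "integrable lborel G2"
    and zero: "\<And>x. x \<notin> cball x0 \<rho> \<Longrightarrow> U1 x = 0" "\<And>x. x \<notin> cball x0 \<rho> \<Longrightarrow> U2 x = 0"
      "\<And>x. x \<notin> cball x0 \<rho> \<Longrightarrow> G1 x = 0" "\<And>x. x \<notin> cball x0 \<rho> \<Longrightarrow> G2 x = 0"
  shows "weak_gradient_in B (\<lambda>x. U1 x - U2 x) (\<lambda>x. G1 x - G2 x)"
  unfolding weak_gradient_in_def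
proof (intro allI impI)
  fix \<phi> :: "real ^ 'n \<Rightarrow> real" and i
  assume \<phi>: "smooth \<phi>" and supp: "\<forall>x. x \<notin> B \<longrightarrow> \<phi> x = 0"
  note c = smooth_continuous[OF \<phi>] smooth_continuous[OF smooth_partial[OF \<phi>]]
  have G: "integrable lborel (\<lambda>x. G1 x $ i)" "integrable lborel (\<lambda>x. G2 x $ i)"
    using integrable_bounded_linear[OF bounded_linear_vec_nth] int by blast+
  note I = integrable_times_continuous[OF int(1) zero(1) c(2)] integrable_times_continuous[OF int(2) zero(2) c(2)]
    integrable_times_continuous[OF G(1) _ c(1), of x0 \<rho>] integrable_times_continuous[OF G(2) _ c(1), of x0 \<rho>]
  have "(\<integral>x. U1 x * partial i \<phi> x \<partial>lborel) = - (\<integral>x. G1 x $ i * \<phi> x \<partial>lborel)"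
    "(\<integral>x. U2 x * partial i \<phi> x \<partial>lborel) = - (\<integral>x. G2 x $ i * \<phi> x \<partial>lborel)"
    using wg \<phi> supp unfolding weak_gradient_in_def by blast+
  then show "(\<integral>x. (U1 x - U2 x) * partial i \<phi> x \<partial>lborel) = - (\<integral>x. (G1 x - G2 x) $ i * \<phi> x \<partial>lborel)"
    using I zero by (simp add: left_diff_distrib)
qed

text \<open>
  For smooth \<open>\<phi>\<close> the product \<open>\<omega> \<phi>\<close> is an admissible test function in the ball, so the weak gradient
  extends from the ball to the whole space once multiplied by the cutoff.
\<close>

lemma weak_gradient_in_cutoff:
  fixes V :: "real ^ 'n::finite \<Rightarrow> real" and DV :: "real ^ 'n \<Rightarrow> real ^ 'n"
  assumes wg: "weak_gradient_in (ball x0 R) V DV" and int: "integrable lborel V" "integrable lborel DV"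
    and \<omega>: "smooth \<omega>" and supp: "\<And>x. x \<notin> ball x0 R \<Longrightarrow> \<omega> x = 0"
  shows "weak_gradient_in UNIV (\<lambda>x. \<omega> x * V x) (\<lambda>x. \<omega> x *\<^sub>R DV x + V x *\<^sub>R (\<chi> i. partial i \<omega> x))"
  unfolding weak_gradient_in_def
proof (intro allI impI)
  fix \<phi> :: "real ^ 'n \<Rightarrow> real" and i
  assume \<phi>: "smooth \<phi>"
  have supp': "\<omega> x = 0" if "x \<notin> cball x0 R" for x using that by (intro supp) auto
  have p\<omega>: "partial i \<omega> x = 0" if "x \<notin> cball x0 R" for x
    by (rule partial_zero_off_closed[OF closed_cball supp' that])
  have bounded: "integrable lborel (\<lambda>x. f x * (\<alpha> x * \<beta> x))"
    if f: "integrable lborel f" and \<alpha>: "smooth \<alpha>" "\<And>x. x \<notin> cball x0 R \<Longrightarrow> \<alpha> x = 0" and \<beta>: "smooth \<beta>"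
    for f \<alpha> \<beta> :: "real ^ 'n \<Rightarrow> real"
  proof -
    have \<alpha>\<beta>: "smooth (\<lambda>x. \<alpha> x * \<beta> x)" by (intro allI C_diff_mult \<alpha>(1)[rule_format] \<beta>[rule_format])
    have zero: "\<alpha> x * \<beta> x = 0" if "x \<notin> cball x0 R" for x using \<alpha>(2)[OF that] by simp
    obtain C where C: "\<And>x. \<bar>\<alpha> x * \<beta> x\<bar> \<le> C"
      using smooth_vanishing_bounded[OF \<alpha>\<beta> zero] by blast
    show ?thesis
      by (rule integrable_times_bounded[OF f _ C]) (use smooth_borel_measurable[OF \<alpha>\<beta>] in simp)
  qed
  have DVi: "integrable lborel (\<lambda>x. DV x $ i)" by (rule integrable_bounded_linear[OF bounded_linear_vec_nth int(2)])
  note I = bounded[OF int(1) \<omega> supp' smooth_partial[OF \<phi>]] bounded[OF int(1) smooth_partial[OF \<omega>] p\<omega> \<phi>]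
    bounded[OF DVi \<omega> supp' \<phi>]
  have pm: "partial i (\<lambda>x. \<omega> x * \<phi> x) x = \<omega> x * partial i \<phi> x + partial i \<omega> x * \<phi> x" for x
    by (rule partial_mult[OF smooth_differentiable[OF \<omega>] smooth_differentiable[OF \<phi>]])
  have "smooth (\<lambda>x. \<omega> x * \<phi> x)" by (intro allI C_diff_mult \<omega>[rule_format] \<phi>[rule_format])
  then have "(\<integral>x. V x * partial i (\<lambda>x. \<omega> x * \<phi> x) x \<partial>lborel) = - (\<integral>x. DV x $ i * (\<omega> x * \<phi> x) \<partial>lborel)"
    using wg[unfolded weak_gradient_in_def] supp by simp
  then have "(\<integral>x. V x * (\<omega> x * partial i \<phi> x) \<partial>lborel) =
      - ((\<integral>x. DV x $ i * (\<omega> x * \<phi> x) \<partial>lborel) + (\<integral>x. V x * (partial i \<omega> x * \<phi> x) \<partial>lborel))"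
    using I unfolding pm by (simp add: distrib_left)
  also have "\<dots> = - (\<integral>x. DV x $ i * (\<omega> x * \<phi> x) + V x * (partial i \<omega> x * \<phi> x) \<partial>lborel)"
    using I by simp
  finally show "(\<integral>x. \<omega> x * V x * partial i \<phi> x \<partial>lborel) =
      - (\<integral>x. (\<omega> x *\<^sub>R DV x + V x *\<^sub>R (\<chi> i. partial i \<omega> x)) $ i * \<phi> x \<partial>lborel)"
    by (simp add: algebra_simps)
qed

text \<open>
  This crude form of Young's inequality replaces Hoelder's inequality with the exponents \<open>q / 2\<close> and
  \<open>q / (q - 2)\<close>, the second of which degenerates at \<open>q = 2\<close>.
\<close>

lemma sq_times_powr_le:
  fixes \<delta> M q :: real
  assumes "0 \<le> \<delta>" "0 \<le> M" "2 \<le> q"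
  shows "\<delta>\<^sup>2 * M powr (q - 2) \<le> \<delta> powr q + M powr q"
proof -
  have sq: "z\<^sup>2 * z powr (q - 2) = z powr q" if "0 \<le> z" for z
    using that powr_add[of z 2 "q - 2"] by (cases "z = 0") auto
  show ?thesis
  proof (cases "\<delta> \<le> M")
    case True
    then have "\<delta>\<^sup>2 * M powr (q - 2) \<le> M\<^sup>2 * M powr (q - 2)" using assms by (intro mult_right_mono power_mono) auto
    then show ?thesis using sq[of M] assms by (simp add: add_increasing)
  next
    case False
    then have "\<delta>\<^sup>2 * M powr (q - 2) \<le> \<delta>\<^sup>2 * \<delta> powr (q - 2)" using assms by (intro mult_left_mono powr_mono2) auto
    then show ?thesis using sq[of \<delta>] assms by (simp add: add_increasing2)
  qed
qed

text \<open>
  The gradient of the test function produces a cross term with the gradient \<open>e\<close> of the cutoff. By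
  \<open>H_growth\<close> it is a product of \<open>\<eta> D\<close> and \<open>b\<close> below, and Young's inequality absorbs the first factor
  into half of the monotonicity term. The parameter \<open>k\<close> is the length of the translation, \<open>d\<close> the
  increment of the solution.
\<close>

lemma pointwise_energy_bound:
  fixes \<xi> \<zeta> e :: "real ^ 'n::finite"
  assumes q: "2 \<le> q" and \<eta>: "0 \<le> \<eta>" "\<eta> \<le> 1" and e: "norm e \<le> L" and k: "k > 0"
  shows "2 / q\<^sup>2 * (\<eta>\<^sup>2 * (norm (H (q/2) \<xi> - H (q/2) \<zeta>))\<^sup>2)
    \<le> (H (q - 1) \<xi> - H (q - 1) \<zeta>) \<bullet> (\<eta>\<^sup>2 *\<^sub>R (\<xi> - \<zeta>) + d *\<^sub>R (2 * \<eta>) *\<^sub>R e)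
      + 2 * q\<^sup>2 * L\<^sup>2 * k\<^sup>2 * ((\<bar>d\<bar> / k) powr q + norm \<xi> powr q + norm \<zeta> powr q)"
proof -
  define D where "D = norm (H (q/2) \<xi> - H (q/2) \<zeta>)"
  define M where "M = max (excess \<xi>) (excess \<zeta>)"
  define b where "b = L * \<bar>d\<bar> * M powr (q/2 - 1)"
  define X where "X = H (q - 1) \<xi> - H (q - 1) \<zeta>"
  have L: "0 \<le> L" using e norm_ge_zero order_trans by blast
  have M: "0 \<le> M" by (simp add: M_def le_max_iff_disj)
  have growth: "norm X \<le> 2 * M powr (q/2 - 1) * D" unfolding X_def M_def D_def by (rule H_growth[OF q])
  have "\<bar>d * (2 * \<eta>) * (X \<bullet> e)\<bar> \<le> \<bar>d\<bar> * (2 * \<eta>) * ((2 * M powr (q/2 - 1) * D) * L)"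
  proof -
    have "\<bar>X \<bullet> e\<bar> \<le> norm X * norm e" by (rule Cauchy_Schwarz_ineq2)
    also have "\<dots> \<le> (2 * M powr (q/2 - 1) * D) * L" using growth e L by (intro mult_mono) (auto simp: D_def)
    finally show ?thesis using \<eta> unfolding abs_mult by (intro mult_mono) auto
  qed
  also have "\<dots> = 4 * (\<eta> * D) * b" by (simp add: b_def)
  also have "\<dots> \<le> 2 / q\<^sup>2 * (\<eta> * D)\<^sup>2 + 2 * q\<^sup>2 * b\<^sup>2"
  proof -
    have "0 \<le> 2 * (\<eta> * D / q - q * b)\<^sup>2" by simp
    also have "\<dots> = 2 / q\<^sup>2 * (\<eta> * D)\<^sup>2 + 2 * q\<^sup>2 * b\<^sup>2 - 4 * (\<eta> * D) * b"
      using q by (simp add: power2_eq_square field_simps)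
    finally show ?thesis by simp
  qed
  also have "b\<^sup>2 \<le> L\<^sup>2 * (k\<^sup>2 * ((\<bar>d\<bar> / k) powr q + norm \<xi> powr q + norm \<zeta> powr q))"
  proof -
    have "(M powr (q/2 - 1))\<^sup>2 = M powr (q - 2)" by (simp add: power2_eq_square flip: powr_add)
    then have "b\<^sup>2 = L\<^sup>2 * (k\<^sup>2 * ((\<bar>d\<bar> / k)\<^sup>2 * M powr (q - 2)))"
      using k by (simp add: b_def power_mult_distrib power_divide)
    also have "\<dots> \<le> L\<^sup>2 * (k\<^sup>2 * ((\<bar>d\<bar> / k) powr q + M powr q))"
      using sq_times_powr_le[OF _ M q, of "\<bar>d\<bar> / k"] k by (intro mult_left_mono) auto
    also have "\<dots> \<le> L\<^sup>2 * (k\<^sup>2 * ((\<bar>d\<bar> / k) powr q + norm \<xi> powr q + norm \<zeta> powr q))"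
    proof -
      have "excess \<xi> powr q \<le> norm \<xi> powr q" "excess \<zeta> powr q \<le> norm \<zeta> powr q"
        using q excess_le_norm by (intro powr_mono2, auto)+
      then have "M powr q \<le> norm \<xi> powr q + norm \<zeta> powr q"
        by (auto simp: M_def max_def intro: add_increasing add_increasing2)
      then show ?thesis by (intro mult_left_mono) auto
    qed
    finally show ?thesis .
  qed
  finally have cross: "\<bar>d * (2 * \<eta>) * (X \<bullet> e)\<bar> \<le> 2 / q\<^sup>2 * (\<eta> * D)\<^sup>2
      + 2 * q\<^sup>2 * (L\<^sup>2 * (k\<^sup>2 * ((\<bar>d\<bar> / k) powr q + norm \<xi> powr q + norm \<zeta> powr q)))"
    using q by simp
  have "4 / q\<^sup>2 * (\<eta> * D)\<^sup>2 = \<eta>\<^sup>2 * (4 / q\<^sup>2 * D\<^sup>2)" by (simp add: power_mult_distrib)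
  also have "\<dots> \<le> \<eta>\<^sup>2 * (X \<bullet> (\<xi> - \<zeta>))"
    using H_monotonicity[OF q, of \<xi> \<zeta>] unfolding D_def X_def by (intro mult_left_mono) auto
  finally have "4 / q\<^sup>2 * (\<eta> * D)\<^sup>2 \<le> \<eta>\<^sup>2 * (X \<bullet> (\<xi> - \<zeta>))" .
  moreover have "4 / q\<^sup>2 * (\<eta> * D)\<^sup>2 = 2 / q\<^sup>2 * (\<eta> * D)\<^sup>2 + 2 / q\<^sup>2 * (\<eta> * D)\<^sup>2" by simp
  moreover have "X \<bullet> (\<eta>\<^sup>2 *\<^sub>R (\<xi> - \<zeta>) + d *\<^sub>R (2 * \<eta>) *\<^sub>R e) = \<eta>\<^sup>2 * (X \<bullet> (\<xi> - \<zeta>)) + d * (2 * \<eta>) * (X \<bullet> e)"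
    by (simp add: inner_add_right)
  ultimately have "2 / q\<^sup>2 * (\<eta> * D)\<^sup>2 \<le> X \<bullet> (\<eta>\<^sup>2 *\<^sub>R (\<xi> - \<zeta>) + d *\<^sub>R (2 * \<eta>) *\<^sub>R e)
      + 2 * q\<^sup>2 * (L\<^sup>2 * (k\<^sup>2 * ((\<bar>d\<bar> / k) powr q + norm \<xi> powr q + norm \<zeta> powr q)))"
    using cross by linarith
  then show ?thesis by (simp add: X_def D_def power_mult_distrib mult.assoc)
qed

lemma borel_measurable_H [measurable (raw)]:
  assumes [measurable]: "f \<in> borel_measurable M"
  shows "(\<lambda>x. H a (f x)) \<in> borel_measurable M"
  unfolding H_def by measurable

lemma norm_H_powr_le:
  assumes "0 \<le> a" "0 \<le> b"
  shows "norm (H a \<xi>) powr b \<le> norm \<xi> powr (a * b)"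
  using assms excess_le_norm[of \<xi>] by (simp add: norm_H powr_powr powr_mono2)

lemma integrable_norm_H_powr:
  fixes f :: "'a \<Rightarrow> real ^ 'n::finite"
  assumes "0 \<le> a" "0 \<le> b" and [measurable]: "f \<in> borel_measurable M"
    and f: "integrable M (\<lambda>x. norm (f x) powr (a * b))"
  shows "integrable M (\<lambda>x. norm (H a (f x)) powr b)"
  by (rule Bochner_Integration.integrable_bound[OF f]) (auto intro!: AE_I2 norm_H_powr_le assms)

text \<open>
  The equation is tested with \<open>W (x - h) - W x\<close>, where \<open>W = \<eta>\<^sup>2 (U (x + h) - U x)\<close>; translation
  of the integrals moves the difference to the nonlinearity and to the right-hand side \<open>F\<close>.
\<close>

lemma energy_estimate:
  fixes U F \<eta> :: "real ^ 'n::finite \<Rightarrow> real" and G :: "real ^ 'n \<Rightarrow> real ^ 'n"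
  assumes q: "2 \<le> q" and p: "p = q / (q - 1)" and R: "0 < R" and h: "norm h \<le> r" "h \<noteq> 0"
    and \<eta>: "smooth \<eta>" "\<And>x. 0 \<le> \<eta> x" "\<And>x. \<eta> x \<le> 1" "\<And>x. x \<notin> ball x0 R \<Longrightarrow> \<eta> x = 0"
    and L: "\<And>x. norm (\<chi> i. partial i \<eta> x) \<le> L"
    and [measurable]: "U \<in> borel_measurable borel" "G \<in> borel_measurable borel" "F \<in> borel_measurable borel"
    and zero: "\<And>x. x \<notin> ball x0 (R + r) \<Longrightarrow> U x = 0" "\<And>x. x \<notin> ball x0 (R + r) \<Longrightarrow> G x = 0"
    and Uq: "integrable lborel (\<lambda>x. \<bar>U x\<bar> powr q)" and Gq: "integrable lborel (\<lambda>x. norm (G x) powr q)"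
    and Fp: "integrable lborel (\<lambda>x. \<bar>F x\<bar> powr p)"
    and wg: "weak_gradient_in (ball x0 (R + r)) U G"
    and eq: "\<And>\<Phi> D\<Phi>. \<Phi> \<in> borel_measurable borel \<Longrightarrow> D\<Phi> \<in> borel_measurable borel \<Longrightarrow>
      integrable lborel (\<lambda>x. \<bar>\<Phi> x\<bar> powr q) \<Longrightarrow> integrable lborel (\<lambda>x. norm (D\<Phi> x) powr q) \<Longrightarrow>
      (\<And>x. x \<notin> ball x0 (R + r) \<Longrightarrow> \<Phi> x = 0) \<Longrightarrow> (\<And>x. x \<notin> ball x0 (R + r) \<Longrightarrow> D\<Phi> x = 0) \<Longrightarrow>
      weak_gradient_in UNIV \<Phi> D\<Phi> \<Longrightarrow>
      (\<integral>x. H (q - 1) (G x) \<bullet> D\<Phi> x \<partial>lborel) = (\<integral>x. F x * \<Phi> x \<partial>lborel)"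
  shows "2 / q\<^sup>2 * (\<integral>x. (\<eta> x)\<^sup>2 * (norm (H (q/2) (G (x + h)) - H (q/2) (G x)))\<^sup>2 \<partial>lborel)
    \<le> (\<integral>x. indicator (ball x0 R) x * \<bar>F (x + h) - F x\<bar> powr p \<partial>lborel) powr (1/p)
        * (norm h * (\<integral>x. norm (G x) powr q \<partial>lborel) powr (1/q))
      + 6 * q\<^sup>2 * L\<^sup>2 * (norm h)\<^sup>2 * (\<integral>x. norm (G x) powr q \<partial>lborel)"
    and "integrable lborel (\<lambda>x. (\<eta> x)\<^sup>2 * (norm (H (q/2) (G (x + h)) - H (q/2) (G x)))\<^sup>2)"
proof -
  let ?B = "ball x0 R" and ?B' = "ball x0 (R + r)"
  have q0: "0 \<le> q" "1 \<le> q" "1 < q" using q by auto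
  have pq: "p > 1" "1/p + 1/q = 1" using q by (auto simp: p field_simps)
  have p_eq: "(q - 1) * p = q" using q by (simp add: p)
  have r: "0 \<le> r" using h(1) norm_ge_zero order_trans by blast
  have k: "norm h > 0" using h by simp
  have L0: "0 \<le> L" using L norm_ge_zero order_trans by blast
  have shift: "x + h \<in> ?B'" if "x \<in> ?B" for x
    using that h(1) norm_triangle_ineq4[of "x0 - x" h] by (simp add: dist_norm diff_diff_eq)
  have B_sub: "x \<in> ?B'" if "x \<in> ?B" for x using that r by simp
  note [measurable] = smooth_borel_measurable[OF \<eta>(1)] smooth_borel_measurable[OF smooth_partial[OF \<eta>(1)]]
  have far: "x \<notin> ball x0 (R + r)" "x + h \<notin> ball x0 (R + r)" if "x \<notin> cball x0 (R + 2 * r)" for x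
    using that h(1) r norm_triangle_ineq[of "x0 - (x + h)" h] by (auto simp: dist_norm diff_diff_eq)

  define N where "N = (\<integral>x. norm (G x) powr q \<partial>lborel)"
  have N: "0 \<le> N" by (simp add: N_def)
  have Gq': "integrable lborel (\<lambda>x. norm (G (x + h)) powr q)" by (rule lborel_integrable_translate[OF Gq])
  have Uq': "integrable lborel (\<lambda>x. \<bar>U (x + h)\<bar> powr q)" by (rule lborel_integrable_translate[OF Uq])
  have U: "integrable lborel U"
    by (rule integrable_if_powr_integrable[OF q0(2), of _ x0 "R + r"]) (use Uq zero(1) in auto)
  have G: "integrable lborel G"
    by (rule integrable_if_powr_integrable[OF q0(2), of _ x0 "R + r"]) (use Gq zero(2) in auto)
  have U': "integrable lborel (\<lambda>x. U (x + h))" and G': "integrable lborel (\<lambda>x. G (x + h))"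
    by (rule lborel_integrable_translate U G)+

  define dU where "dU x = U (x + h) - U x" for x
  define dG where "dG x = G (x + h) - G x" for x
  define dH where "dH x = H (q - 1) (G (x + h)) - H (q - 1) (G x)" for x
  define e where "e x = (\<chi> i. partial i \<eta> x)" for x
  have [measurable]: "dU \<in> borel_measurable borel" "dG \<in> borel_measurable borel" "dH \<in> borel_measurable borel"
    unfolding dU_def[abs_def] dG_def[abs_def] dH_def[abs_def] by measurable
  have e_eq: "e = (\<lambda>x. \<Sum>i\<in>UNIV. partial i \<eta> x *\<^sub>R axis i 1)"
    unfolding e_def using basis_expansion[of "\<chi> i. partial i \<eta> _"] by (auto simp: scalar_mult_eq_scaleR)
  have [measurable]: "e \<in> borel_measurable borel" unfolding e_eq by measurable
  have [measurable]: "?B \<in> sets borel" by simp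
  have dUq: "integrable lborel (\<lambda>x. \<bar>dU x\<bar> powr q)"
    using integrable_norm_powr_diff[OF q0(1), of "\<lambda>x. U (x + h)" lborel U] Uq Uq' by (simp add: dU_def)
  have dGq: "integrable lborel (\<lambda>x. norm (dG x) powr q)"
    using integrable_norm_powr_diff[OF q0(1), of "\<lambda>x. G (x + h)" lborel G] Gq Gq' by (simp add: dG_def)
  have quotient: "(\<integral>x. indicator ?B x * \<bar>dU x\<bar> powr q \<partial>lborel) \<le> norm h powr q * N"
    and quotient_int: "integrable lborel (\<lambda>x. indicator ?B x * \<bar>dU x\<bar> powr q)"
  proof -
    show int: "integrable lborel (\<lambda>x. indicator ?B x * \<bar>dU x\<bar> powr q)"
      using integrable_mult_indicator[OF _ dUq, of ?B] by simp
    have "ennreal (\<integral>x. indicator ?B x * \<bar>dU x\<bar> powr q \<partial>lborel) \<le> ennreal (norm h powr q) * ennreal N"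
      using difference_quotient_bound[OF U G wg R h(1) q0(3)] int Gq
      by (simp add: nn_integral_eq_integral dU_def N_def)
    then show "(\<integral>x. indicator ?B x * \<bar>dU x\<bar> powr q \<partial>lborel) \<le> norm h powr q * N"
      using N by (simp flip: ennreal_mult)
  qed

  define W where "W x = (\<eta> x)\<^sup>2 * dU x" for x
  define DW where "DW x = (\<eta> x)\<^sup>2 *\<^sub>R dG x + dU x *\<^sub>R (2 * \<eta> x) *\<^sub>R e x" for x
  have [measurable]: "W \<in> borel_measurable borel" "DW \<in> borel_measurable borel"
    unfolding W_def[abs_def] DW_def[abs_def] by measurable
  have \<eta>_sq: "(\<eta> x)\<^sup>2 \<le> 1" for x using \<eta>(2,3)[of x] by (simp add: power_le_one)
  have W_zero: "W x = 0" "DW x = 0" if "x \<notin> ?B" for x using \<eta>(4)[OF that] by (simp_all add: W_def DW_def)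
  have W_le: "\<bar>W x\<bar> \<le> 1 * \<bar>dU x\<bar>" for x
    using \<eta>_sq[of x] by (simp add: W_def abs_mult mult_left_le_one_le)
  have Wq: "integrable lborel (\<lambda>x. \<bar>W x\<bar> powr q)"
    using integrable_norm_powr_bound[OF q0(1), of W lborel dU 1] dUq W_le by simp
  have DWq: "integrable lborel (\<lambda>x. norm (DW x) powr q)"
    unfolding DW_def
  proof (rule integrable_norm_powr_add[OF q0(1)])
    show "integrable lborel (\<lambda>x. norm ((\<eta> x)\<^sup>2 *\<^sub>R dG x) powr q)"
      by (rule integrable_norm_powr_bound[OF q0(1) _ dGq, of _ 1])
        (auto intro: mult_left_le_one_le \<eta>_sq)
    show "integrable lborel (\<lambda>x. norm (dU x *\<^sub>R (2 * \<eta> x) *\<^sub>R e x) powr q)"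
    proof (rule integrable_norm_powr_bound[OF q0(1), of _ _ dU "2 * L"])
      fix x
      have "2 * \<eta> x * norm (e x) \<le> 2 * 1 * L"
        using \<eta>(2,3)[of x] L[of x] by (intro mult_mono) (auto simp: e_def)
      then have "\<bar>dU x\<bar> * (2 * \<eta> x * norm (e x)) \<le> \<bar>dU x\<bar> * (2 * L)" by (intro mult_left_mono) auto
      then show "norm (dU x *\<^sub>R (2 * \<eta> x) *\<^sub>R e x) \<le> 2 * L * norm (dU x)"
        using \<eta>(2)[of x] by (simp add: abs_mult mult_ac)
    qed (use dUq in auto)
  qed measurable
  have W: "integrable lborel W"
    by (rule integrable_if_powr_integrable[OF q0(2), of _ x0 R]) (use Wq W_zero(1) in auto)
  have DW: "integrable lborel DW"
    by (rule integrable_if_powr_integrable[OF q0(2), of _ x0 R]) (use DWq W_zero(2) in auto)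

  have wgW: "weak_gradient_in UNIV W DW"
  proof -
    have "weak_gradient_in ?B U G"
      using wg B_sub unfolding weak_gradient_in_def by blast
    moreover have "weak_gradient_in ?B (\<lambda>x. U (x + h)) (\<lambda>x. G (x + h))"
      by (rule weak_gradient_in_translate[OF wg shift]) auto
    ultimately have "weak_gradient_in ?B dU dG"
      unfolding dU_def[abs_def] dG_def[abs_def]
      using weak_gradient_in_diff[of ?B "\<lambda>x. U (x + h)" "\<lambda>x. G (x + h)" U G x0 "R + 2 * r"] U G U' G' far zero
      by blast
    moreover have "integrable lborel dU" "integrable lborel dG"
      using U U' G G' unfolding dU_def[abs_def] dG_def[abs_def] by auto
    moreover have "smooth (\<lambda>x. \<eta> x * \<eta> x)" by (intro allI C_diff_mult \<eta>(1)[rule_format])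
    ultimately have "weak_gradient_in UNIV (\<lambda>x. \<eta> x * \<eta> x * dU x)
        (\<lambda>x. (\<eta> x * \<eta> x) *\<^sub>R dG x + dU x *\<^sub>R (\<chi> i. partial i (\<lambda>x. \<eta> x * \<eta> x) x))"
      by (rule weak_gradient_in_cutoff) (use \<eta>(4) in simp)
    moreover have "(\<chi> i. partial i (\<lambda>x. \<eta> x * \<eta> x) x) = (2 * \<eta> x) *\<^sub>R e x" for x
      by (simp add: vec_eq_iff e_def partial_mult[OF smooth_differentiable smooth_differentiable, OF \<eta>(1) \<eta>(1)])
    ultimately show ?thesis by (simp add: W_def[abs_def] DW_def[abs_def] power2_eq_square)
  qed

  define \<Phi> where "\<Phi> x = W (x - h) - W x" for x
  define D\<Phi> where "D\<Phi> x = DW (x - h) - DW x" for x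
  have W'q: "integrable lborel (\<lambda>x. \<bar>W (x - h)\<bar> powr q)" "integrable lborel (\<lambda>x. norm (DW (x - h)) powr q)"
    and W': "integrable lborel (\<lambda>x. W (x - h))" "integrable lborel (\<lambda>x. DW (x - h))"
    using lborel_integrable_translate[OF Wq, of "- h"] lborel_integrable_translate[OF DWq, of "- h"]
      lborel_integrable_translate[OF W, of "- h"] lborel_integrable_translate[OF DW, of "- h"] by simp_all
  have out: "x - h \<notin> ?B" "x \<notin> ?B" if "x \<notin> ?B'" for x
    using that shift[of "x - h"] B_sub[of x] by auto
  have tested: "(\<integral>x. H (q - 1) (G x) \<bullet> D\<Phi> x \<partial>lborel) = (\<integral>x. F x * \<Phi> x \<partial>lborel)"
  proof (rule eq)
    show "\<Phi> \<in> borel_measurable borel" "D\<Phi> \<in> borel_measurable borel"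
      unfolding \<Phi>_def[abs_def] D\<Phi>_def[abs_def] by measurable
    show "integrable lborel (\<lambda>x. \<bar>\<Phi> x\<bar> powr q)"
      using integrable_norm_powr_diff[OF q0(1), of "\<lambda>x. W (x - h)" lborel W] Wq W'q by (simp add: \<Phi>_def)
    show "integrable lborel (\<lambda>x. norm (D\<Phi> x) powr q)"
      using integrable_norm_powr_diff[OF q0(1), of "\<lambda>x. DW (x - h)" lborel DW] DWq W'q by (simp add: D\<Phi>_def)
    show "\<Phi> x = 0" "D\<Phi> x = 0" if "x \<notin> ?B'" for x
      using W_zero[OF out(1)[OF that]] W_zero[OF out(2)[OF that]] by (simp_all add: \<Phi>_def D\<Phi>_def)
    have "weak_gradient_in UNIV (\<lambda>x. W (x + - h)) (\<lambda>x. DW (x + - h))"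
      by (rule weak_gradient_in_translate[OF wgW]) auto
    moreover have "W (x - h) = 0" "DW (x - h) = 0" "W x = 0" "DW x = 0" if "x \<notin> cball x0 (R + r)" for x
      using W_zero[of "x - h"] W_zero[of x] out[of x] that by auto
    ultimately show "weak_gradient_in UNIV \<Phi> D\<Phi>"
      unfolding \<Phi>_def[abs_def] D\<Phi>_def[abs_def]
      using weak_gradient_in_diff[of UNIV "\<lambda>x. W (x - h)" "\<lambda>x. DW (x - h)" W DW x0 "R + r"] W W' DW wgW by simp
  qed

  have Hp: "integrable lborel (\<lambda>x. norm (H (q - 1) (G x)) powr p)"
    by (rule integrable_norm_H_powr) (use q pq Gq in \<open>auto simp: p_eq\<close>)
  have Hp': "integrable lborel (\<lambda>x. norm (H (q - 1) (G (x + h))) powr p)"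
    by (rule lborel_integrable_translate[OF Hp])
  have Fp': "integrable lborel (\<lambda>x. \<bar>F (x + h)\<bar> powr p)" by (rule lborel_integrable_translate[OF Fp])
  note conj = integrable_inner_conjugate[OF pq(1) q0(3) pq(2)]
  note conj_real = Hoelder[OF pq(1) q0(3) pq(2)]
  have IH: "integrable lborel (\<lambda>x. H (q - 1) (G x) \<bullet> DW x)"
      "integrable lborel (\<lambda>x. H (q - 1) (G (x + h)) \<bullet> DW x)"
      "integrable lborel (\<lambda>x. H (q - 1) (G x) \<bullet> DW (x - h))"
    using Hp Hp' DWq W'q by (auto intro!: conj)
  have IF: "integrable lborel (\<lambda>x. F x * W x)" "integrable lborel (\<lambda>x. F (x + h) * W x)"
      "integrable lborel (\<lambda>x. F x * W (x - h))"
    using Fp Fp' Wq W'q by (auto intro!: conj_real(1))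
  have difference_form: "(\<integral>x. dH x \<bullet> DW x \<partial>lborel) = (\<integral>x. (F (x + h) - F x) * W x \<partial>lborel)"
  proof -
    have "(\<integral>x. H (q - 1) (G (x + h)) \<bullet> DW x \<partial>lborel) = (\<integral>x. H (q - 1) (G x) \<bullet> DW (x - h) \<partial>lborel)"
      using lborel_integral_translate[of "\<lambda>x. H (q - 1) (G x) \<bullet> DW (x - h)" h] by simp
    moreover have "(\<integral>x. F (x + h) * W x \<partial>lborel) = (\<integral>x. F x * W (x - h) \<partial>lborel)"
      using lborel_integral_translate[of "\<lambda>x. F x * W (x - h)" h] by simp
    ultimately show ?thesis
      using tested IH IF by (simp add: dH_def \<Phi>_def D\<Phi>_def inner_diff_left inner_diff_right left_diff_distrib right_diff_distrib)
  qed

  have rhs: "(\<integral>x. (F (x + h) - F x) * W x \<partial>lborel)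
      \<le> (\<integral>x. indicator ?B x * \<bar>F (x + h) - F x\<bar> powr p \<partial>lborel) powr (1/p) * (norm h * N powr (1/q))"
  proof -
    define f where "f x = indicator ?B x * (F (x + h) - F x)" for x
    have [measurable]: "f \<in> borel_measurable borel" unfolding f_def[abs_def] by measurable
    have f_eq: "\<bar>f x\<bar> powr p = indicator ?B x * \<bar>F (x + h) - F x\<bar> powr p" for x
      by (simp add: f_def indicator_def)
    have "integrable lborel (\<lambda>x. \<bar>F (x + h) - F x\<bar> powr p)"
      using integrable_norm_powr_diff[of p "\<lambda>x. F (x + h)" lborel F] Fp Fp' pq by simp
    then have fp: "integrable lborel (\<lambda>x. \<bar>f x\<bar> powr p)"
      unfolding f_eq using integrable_mult_indicator[of ?B lborel "\<lambda>x. \<bar>F (x + h) - F x\<bar> powr p"] by simp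
    have "(\<integral>x. (F (x + h) - F x) * W x \<partial>lborel) = (\<integral>x. f x * W x \<partial>lborel)"
      by (intro Bochner_Integration.integral_cong) (auto simp: f_def indicator_def W_zero)
    also have "\<dots> \<le> (\<integral>x. \<bar>f x\<bar> powr p \<partial>lborel) powr (1/p) * (\<integral>x. \<bar>W x\<bar> powr q \<partial>lborel) powr (1/q)"
      using conj_real(2)[of f lborel W] fp Wq by simp
    also have "\<dots> \<le> (\<integral>x. \<bar>f x\<bar> powr p \<partial>lborel) powr (1/p) * (norm h powr q * N) powr (1/q)"
    proof (intro mult_left_mono powr_mono2)
      have "(\<integral>x. \<bar>W x\<bar> powr q \<partial>lborel) \<le> (\<integral>x. indicator ?B x * \<bar>dU x\<bar> powr q \<partial>lborel)"
      proof (rule integral_mono[OF Wq quotient_int])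
        fix x show "\<bar>W x\<bar> powr q \<le> indicator ?B x * \<bar>dU x\<bar> powr q"
          using W_le[of x] W_zero(1)[of x] q by (cases "x \<in> ?B") (auto intro: powr_mono2)
      qed
      with quotient show "(\<integral>x. \<bar>W x\<bar> powr q \<partial>lborel) \<le> norm h powr q * N" by simp
    qed (use q in auto)
    also have "(norm h powr q * N) powr (1/q) = norm h * N powr (1/q)"
      using N q by (simp add: powr_mult powr_powr)
    finally show ?thesis by (simp add: f_eq)
  qed

  define E where "E x = (\<eta> x)\<^sup>2 * (norm (H (q/2) (G (x + h)) - H (q/2) (G x)))\<^sup>2" for x
  \<comment> \<open>\<open>T\<close> collects the terms left after absorption; each of the three has integral at most \<open>N\<close>.\<close>
  define T where "T x = indicator ?B x * \<bar>dU x\<bar> powr q / norm h powr q + norm (G (x + h)) powr q + norm (G x) powr q" for x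
  have [measurable]: "E \<in> borel_measurable borel" unfolding E_def[abs_def] by measurable
  have pointwise: "2 / q\<^sup>2 * E x \<le> dH x \<bullet> DW x + 2 * q\<^sup>2 * L\<^sup>2 * (norm h)\<^sup>2 * T x" for x
  proof (cases "x \<in> ?B")
    case True
    have "norm (e x) \<le> L" using L by (simp add: e_def)
    from pointwise_energy_bound[OF q \<eta>(2)[of x] \<eta>(3)[of x] this k, of "G (x + h)" "G x" "dU x"] True
    show ?thesis by (simp add: E_def dH_def DW_def T_def dG_def powr_divide)
  next
    case False
    then show ?thesis using W_zero[of x] \<eta>(4)[of x] by (simp add: E_def T_def)
  qed
  have T_int: "integrable lborel T"
    unfolding T_def[abs_def] using quotient_int Gq Gq' by simp
  have dH_int: "integrable lborel (\<lambda>x. dH x \<bullet> DW x)"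
    unfolding dH_def using IH by (simp add: inner_diff_left)
  have E_nonneg: "0 \<le> E x" for x by (simp add: E_def)
  show E_int: "integrable lborel (\<lambda>x. (\<eta> x)\<^sup>2 * (norm (H (q/2) (G (x + h)) - H (q/2) (G x)))\<^sup>2)"
  proof -
    have "integrable lborel (\<lambda>x. 2 / q\<^sup>2 * E x)"
    proof (rule Bochner_Integration.integrable_bound)
      show "integrable lborel (\<lambda>x. dH x \<bullet> DW x + 2 * q\<^sup>2 * L\<^sup>2 * (norm h)\<^sup>2 * T x)"
        using dH_int T_int by simp
      show "AE x in lborel. norm (2 / q\<^sup>2 * E x) \<le> norm (dH x \<bullet> DW x + 2 * q\<^sup>2 * L\<^sup>2 * (norm h)\<^sup>2 * T x)"
        using pointwise E_nonneg by (intro AE_I2) (simp add: order_trans[OF _ abs_ge_self])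
    qed measurable
    then have "integrable lborel (\<lambda>x. q\<^sup>2 / 2 * (2 / q\<^sup>2 * E x))" by (rule integrable_mult_right)
    moreover have "q\<^sup>2 / 2 * (2 / q\<^sup>2 * E x) = E x" for x using q by simp
    ultimately show ?thesis by (simp add: E_def)
  qed
  have T_le: "(\<integral>x. T x \<partial>lborel) \<le> 3 * N"
  proof -
    have "(\<integral>x. T x \<partial>lborel) = (\<integral>x. indicator ?B x * \<bar>dU x\<bar> powr q \<partial>lborel) / norm h powr q
        + (\<integral>x. norm (G (x + h)) powr q \<partial>lborel) + N"
      unfolding T_def N_def using quotient_int Gq Gq' by simp
    moreover have "(\<integral>x. norm (G (x + h)) powr q \<partial>lborel) = N"
      unfolding N_def by (rule lborel_integral_translate) measurable
    moreover have "(\<integral>x. indicator ?B x * \<bar>dU x\<bar> powr q \<partial>lborel) / norm h powr q \<le> N"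
      using quotient k by (simp add: divide_le_eq mult.commute)
    ultimately show ?thesis by simp
  qed
  have "2 / q\<^sup>2 * (\<integral>x. E x \<partial>lborel) = (\<integral>x. 2 / q\<^sup>2 * E x \<partial>lborel)" by simp
  also have "\<dots> \<le> (\<integral>x. dH x \<bullet> DW x + 2 * q\<^sup>2 * L\<^sup>2 * (norm h)\<^sup>2 * T x \<partial>lborel)"
    using E_int dH_int T_int pointwise by (intro integral_mono) (auto simp: E_def)
  also have "\<dots> = (\<integral>x. dH x \<bullet> DW x \<partial>lborel) + 2 * q\<^sup>2 * L\<^sup>2 * (norm h)\<^sup>2 * (\<integral>x. T x \<partial>lborel)"
    using dH_int T_int by simp
  also have "\<dots> \<le> (\<integral>x. indicator ?B x * \<bar>F (x + h) - F x\<bar> powr p \<partial>lborel) powr (1/p) * (norm h * N powr (1/q))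
      + 2 * q\<^sup>2 * L\<^sup>2 * (norm h)\<^sup>2 * (3 * N)"
    using rhs T_le unfolding difference_form by (intro add_mono mult_left_mono) auto
  finally show "2 / q\<^sup>2 * (\<integral>x. (\<eta> x)\<^sup>2 * (norm (H (q/2) (G (x + h)) - H (q/2) (G x)))\<^sup>2 \<partial>lborel)
    \<le> (\<integral>x. indicator ?B x * \<bar>F (x + h) - F x\<bar> powr p \<partial>lborel) powr (1/p)
        * (norm h * (\<integral>x. norm (G x) powr q \<partial>lborel) powr (1/q))
      + 6 * q\<^sup>2 * L\<^sup>2 * (norm h)\<^sup>2 * (\<integral>x. norm (G x) powr q \<partial>lborel)"
    by (simp add: E_def N_def)
qed

section \<open>Borel representatives\<close>

text \<open>
  The Fubini argument along segments needs joint measurability of \<open>G (x + t h)\<close> in \<open>(x, t)\<close> for the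
  product of Borel algebras, so the Lebesgue measurable data are replaced by Borel functions.
\<close>

lemma borel_representative:
  fixes v :: "real ^ 'n::finite \<Rightarrow> 'b::euclidean_space"
  assumes v: "v \<in> borel_measurable (lebesgue_on S)" and S: "S \<in> sets borel"
  obtains V where "V \<in> borel_measurable borel" "AE x in lborel. indicator S x *\<^sub>R v x = V x" "\<And>x. x \<notin> S \<Longrightarrow> V x = 0"
proof -
  have "(\<lambda>x. indicator S x *\<^sub>R v x) \<in> borel_measurable lebesgue"
    using v S by (subst (asm) borel_measurable_restrict_space_iff) auto
  then have "(\<lambda>x. (indicator S x *\<^sub>R v x) \<bullet> b) \<in> borel_measurable lebesgue" for b
    by (rule borel_measurable_inner) simp
  then have "\<forall>b. \<exists>g. g \<in> borel_measurable lborel \<and> (AE x in lborel. (indicator S x *\<^sub>R v x) \<bullet> b = g x)"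
    using completion_ex_borel_measurable_real by blast
  from choice[OF this] obtain g where [measurable]: "\<And>b. g b \<in> borel_measurable borel"
    and g: "\<And>b. AE x in lborel. (indicator S x *\<^sub>R v x) \<bullet> b = g b x"
    by auto
  have [measurable]: "S \<in> sets borel" by (rule S)
  define V where "V x = (\<Sum>b\<in>Basis. (indicator S x * g b x) *\<^sub>R b)" for x
  show thesis
  proof
    show "V \<in> borel_measurable borel" unfolding V_def[abs_def] by measurable
    have "AE x in lborel. \<forall>b\<in>Basis. (indicator S x *\<^sub>R v x) \<bullet> b = g b x"
      using g by (subst AE_finite_all) auto
    then show "AE x in lborel. indicator S x *\<^sub>R v x = V x"
    proof eventually_elim
      case (elim x)
      have "indicator S x *\<^sub>R v x = (\<Sum>b\<in>Basis. ((indicator S x *\<^sub>R v x) \<bullet> b) *\<^sub>R b)"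
        by (simp only: euclidean_representation)
      also have "\<dots> = V x"
        unfolding V_def
      proof (intro sum.cong refl)
        fix b :: 'b assume "b \<in> Basis"
        with elim have "(indicator S x *\<^sub>R v x) \<bullet> b = g b x" by blast
        then show "((indicator S x *\<^sub>R v x) \<bullet> b) *\<^sub>R b = (indicator S x * g b x) *\<^sub>R b"
          by (cases "x \<in> S") simp_all
      qed
      finally show ?case .
    qed
    show "V x = 0" if "x \<notin> S" for x using that by (simp add: V_def)
  qed
qed

lemma lebesgue_on_transfer:
  fixes k K :: "real ^ 'n::finite \<Rightarrow> 'b::euclidean_space"
  assumes S: "S \<in> sets borel" and K: "K \<in> borel_measurable borel"
    and ae: "AE x in lborel. indicator S x *\<^sub>R k x = K x"
  shows "k \<in> borel_measurable (lebesgue_on S)"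
    and "(\<integral>x. k x \<partial>lebesgue_on S) = (\<integral>x. K x \<partial>lborel)"
    and "integrable (lebesgue_on S) k \<longleftrightarrow> integrable lborel K"
proof -
  have K': "K \<in> borel_measurable lebesgue" using K by (simp add: measurable_completion)
  have ae': "AE x in lebesgue. K x = indicator S x *\<^sub>R k x"
    using AE_completion[OF ae] by eventually_elim simp
  have m: "(\<lambda>x. indicator S x *\<^sub>R k x) \<in> borel_measurable lebesgue"
    by (rule borel_measurable_AE[OF K' ae'])
  then show "k \<in> borel_measurable (lebesgue_on S)"
    using S by (subst borel_measurable_restrict_space_iff) auto
  show "(\<integral>x. k x \<partial>lebesgue_on S) = (\<integral>x. K x \<partial>lborel)"
    using S integral_cong_AE[OF K' m ae'] integral_completion[of K lborel] K
    by (simp add: integral_restrict_space)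
  show "integrable (lebesgue_on S) k \<longleftrightarrow> integrable lborel K"
    using S integrable_cong_AE[OF K' m ae'] integrable_completion[of K lborel] K
    by (simp add: integrable_restrict_space)
qed

lemma AE_lborel_translate:
  fixes a :: "'a::euclidean_space"
  assumes "AE x in lborel. P x"
  shows "AE x in lborel. P (x + a)"
proof -
  have "AE x in distr lborel borel ((+) a). P x"
    unfolding lborel_distr_plus by (rule assms)
  then have "AE x in lborel. P (a + x)" by (rule AE_distrD[rotated]) simp
  then show ?thesis by (simp add: add.commute)
qed

lemma Lp_space_subset:
  fixes v :: "real ^ 'n::finite \<Rightarrow> 'b::euclidean_space"
  assumes v: "v \<in> Lp_space m S" and S: "S \<in> sets borel" "T \<in> sets borel" "T \<subseteq> S"
  shows "v \<in> Lp_space m T"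
proof -
  have vm: "v \<in> borel_measurable (lebesgue_on S)" using v by (simp add: Lp_space_def)
  obtain V where [measurable]: "V \<in> borel_measurable borel" and ae: "AE x in lborel. indicator S x *\<^sub>R v x = V x"
    and "\<And>x. x \<notin> S \<Longrightarrow> V x = 0"
    by (rule borel_representative[OF vm S(1)]) (rule that; assumption)
  have [measurable]: "T \<in> sets borel" "S \<in> sets borel" by (rule S)+
  have "AE x in lborel. indicator T x *\<^sub>R v x = indicator T x *\<^sub>R V x"
    using ae by eventually_elim (use S(3) in \<open>auto simp: indicator_def\<close>)
  from lebesgue_on_transfer(1)[OF S(2) _ this] have m: "v \<in> borel_measurable (lebesgue_on T)" by simp
  have ae': "AE x in lborel. indicator T x *\<^sub>R norm (v x) powr m = indicator T x *\<^sub>R norm (V x) powr m"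
    using ae by eventually_elim (use S(3) in \<open>auto simp: indicator_def\<close>)
  have "AE x in lborel. indicator S x *\<^sub>R norm (v x) powr m = indicator S x *\<^sub>R norm (V x) powr m"
    using ae by eventually_elim (auto simp: indicator_def)
  from lebesgue_on_transfer(3)[OF S(1) _ this] v
  have "integrable lborel (\<lambda>x. indicator S x *\<^sub>R norm (V x) powr m)" by (simp add: Lp_space_def)
  from integrable_mult_indicator[OF _ this, of T] S
  have "integrable lborel (\<lambda>x. indicator T x *\<^sub>R indicator S x *\<^sub>R norm (V x) powr m)" by simp
  moreover have "indicator T x *\<^sub>R indicator S x *\<^sub>R norm (V x) powr m = indicator T x *\<^sub>R norm (V x) powr m" for x
    using S(3) by (auto simp: indicator_def)
  ultimately have "integrable lborel (\<lambda>x. indicator T x *\<^sub>R norm (V x) powr m)" by (simp only:)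
  then have "integrable (lebesgue_on T) (\<lambda>x. norm (v x) powr m)"
    using lebesgue_on_transfer(3)[OF S(2) _ ae'] by simp
  with m show ?thesis by (simp add: Lp_space_def)
qed

lemma Lp_space_representative:
  fixes v :: "real ^ 'n::finite \<Rightarrow> 'b::euclidean_space"
  assumes v: "v \<in> Lp_space m S" and S: "S \<in> sets borel"
  obtains V where "V \<in> borel_measurable borel" "AE x in lborel. indicator S x *\<^sub>R v x = V x"
    "\<And>x. x \<notin> S \<Longrightarrow> V x = 0" "integrable lborel (\<lambda>x. norm (V x) powr m)"
    "(\<integral>x. norm (V x) powr m \<partial>lborel) powr (1/m) = Lp_norm m S v"
proof -
  have vm: "v \<in> borel_measurable (lebesgue_on S)" using v by (simp add: Lp_space_def)
  obtain V where V[measurable]: "V \<in> borel_measurable borel" and ae: "AE x in lborel. indicator S x *\<^sub>R v x = V x"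
    and zero: "\<And>x. x \<notin> S \<Longrightarrow> V x = 0"
    by (rule borel_representative[OF vm S]) (rule that; assumption)
  have ae': "AE x in lborel. indicator S x *\<^sub>R norm (v x) powr m = norm (V x) powr m"
    using ae by eventually_elim (use zero in \<open>auto simp: indicator_def split: if_splits\<close>)
  have m: "(\<lambda>x. norm (V x) powr m) \<in> borel_measurable borel" by measurable
  note T = lebesgue_on_transfer[OF S m ae']
  show thesis
    by (rule that[OF V ae zero]) (use T v in \<open>auto simp: Lp_space_def Lp_norm_def\<close>)
qed

lemma besov_quotient_eq:
  fixes v V :: "real ^ 'n::finite \<Rightarrow> real"
  assumes S[measurable]: "S \<in> sets borel" and V[measurable]: "V \<in> borel_measurable borel"
    and ae: "AE x in lborel. indicator S x *\<^sub>R v x = V x"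
  shows "besov_quotient \<beta> m S v h =
    (\<integral>x. indicator {x \<in> S. x + h \<in> S} x * (\<bar>V (x + h) - V x\<bar> powr m / norm h powr (\<beta> * m)) \<partial>lborel) powr (1/m)"
proof -
  have S': "{x \<in> S. x + h \<in> S} \<in> sets borel" by measurable
  note [measurable] = S'
  have "AE x in lborel. indicator {x \<in> S. x + h \<in> S} x *\<^sub>R (\<bar>v (x + h) - v x\<bar> powr m / norm h powr (\<beta> * m)) =
      indicator {x \<in> S. x + h \<in> S} x * (\<bar>V (x + h) - V x\<bar> powr m / norm h powr (\<beta> * m))"
    using ae AE_lborel_translate[OF ae, of h] by eventually_elim (auto simp: indicator_def split: if_splits)
  moreover have "(\<lambda>x. indicator {x \<in> S. x + h \<in> S} x * (\<bar>V (x + h) - V x\<bar> powr m / norm h powr (\<beta> * m)))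
      \<in> borel_measurable borel" by measurable
  ultimately have "(\<integral>x. \<bar>v (x + h) - v x\<bar> powr m / norm h powr (\<beta> * m) \<partial>lebesgue_on {x \<in> S. x + h \<in> S}) =
      (\<integral>x. indicator {x \<in> S. x + h \<in> S} x * (\<bar>V (x + h) - V x\<bar> powr m / norm h powr (\<beta> * m)) \<partial>lborel)"
    by (intro lebesgue_on_transfer(2)[OF S'])
  then show ?thesis by (simp only: besov_quotient_def)
qed

lemma partial_zero_outside_ball:
  fixes \<phi> :: "real ^ 'n::finite \<Rightarrow> real"
  assumes \<phi>: "smooth \<phi>" and zero: "\<And>x. x \<notin> ball x0 \<rho> \<Longrightarrow> \<phi> x = 0" and x: "x \<notin> ball x0 \<rho>"
  shows "partial i \<phi> x = 0"
proof -
  have "{x. partial i \<phi> x \<noteq> 0} \<subseteq> cball x0 \<rho>"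
    using partial_zero_off_closed[OF closed_cball, of x0 \<rho> \<phi>] zero by fastforce
  moreover have "open {x. partial i \<phi> x \<noteq> 0}"
    using smooth_continuous[OF smooth_partial[OF \<phi>]] by (intro open_Collect_neq) auto
  ultimately have "{x. partial i \<phi> x \<noteq> 0} \<subseteq> interior (cball x0 \<rho>)" by (rule interior_maximal)
  with x show ?thesis by auto
qed

lemma cball_subset_open_enlarge:
  fixes \<Omega> :: "(real ^ 'n::finite) set"
  assumes "open \<Omega>" "cball x0 \<rho> \<subseteq> \<Omega>" "0 < \<rho>"
  obtains \<rho>' where "\<rho> < \<rho>'" "cball x0 \<rho>' \<subseteq> \<Omega>"
proof -
  obtain \<epsilon> where \<epsilon>: "\<epsilon> > 0" "(\<Union>x\<in>cball x0 \<rho>. cball x \<epsilon>) \<subseteq> \<Omega>"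
    using compact_subset_open_imp_cball_epsilon_subset[OF compact_cball assms(1,2)] by blast
  show thesis
  proof
    show "\<rho> < \<rho> + \<epsilon>" using \<epsilon> by simp
    show "cball x0 (\<rho> + \<epsilon>) \<subseteq> \<Omega>"
    proof
      fix x assume x: "x \<in> cball x0 (\<rho> + \<epsilon>)"
      define t where "t = \<rho> / (\<rho> + \<epsilon>)"
      have t: "0 \<le> t" "t \<le> 1" "t * (\<rho> + \<epsilon>) = \<rho>" "(1 - t) * (\<rho> + \<epsilon>) = \<epsilon>"
        using assms(3) \<epsilon>(1) by (auto simp: t_def field_simps)
      define y where "y = x0 + t *\<^sub>R (x - x0)"
      have "norm (x - x0) \<le> \<rho> + \<epsilon>" using x by (simp add: dist_norm norm_minus_commute)
      then have "t * norm (x - x0) \<le> \<rho>" "(1 - t) * norm (x - x0) \<le> \<epsilon>"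
        using t mult_left_mono[of "norm (x - x0)" "\<rho> + \<epsilon>" t] mult_left_mono[of "norm (x - x0)" "\<rho> + \<epsilon>" "1 - t"] by auto
      moreover have "y - x0 = t *\<^sub>R (x - x0)" "x - y = (1 - t) *\<^sub>R (x - x0)"
        by (simp_all add: y_def algebra_simps)
      ultimately have "dist y x0 \<le> \<rho>" "dist x y \<le> \<epsilon>"
        using t(1,2) by (simp_all add: dist_norm)
      then have "y \<in> cball x0 \<rho>" "x \<in> cball y \<epsilon>" by (simp_all add: dist_commute)
      then show "x \<in> \<Omega>" using \<epsilon>(2) by blast
    qed
  qed
qed

text \<open>
  A cutoff equal to one on the ball turns \<open>f\<close> into a function of the Besov space on the whole
  space, which bounds the quotients on the ball and so gives its Besov norm a meaning.
\<close>

lemma besov_loc_ball_representative: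
  fixes f :: "real ^ 'n::finite \<Rightarrow> real"
  assumes f: "f \<in> besov_loc \<alpha> p \<Omega>" and \<Omega>: "open \<Omega>" "cball x0 \<rho> \<subseteq> \<Omega>" "0 < \<rho>" and p: "1 \<le> p"
  obtains F where "F \<in> borel_measurable borel" "AE x in lborel. x \<in> ball x0 \<rho> \<longrightarrow> f x = F x"
    "integrable lborel (\<lambda>x. \<bar>F x\<bar> powr p)" "0 \<le> besov_norm \<alpha> p (ball x0 \<rho>) f"
    "\<And>R h. h \<noteq> 0 \<Longrightarrow> \<forall>x\<in>ball x0 R. x \<in> ball x0 \<rho> \<and> x + h \<in> ball x0 \<rho> \<Longrightarrow>
      (\<integral>x. indicator (ball x0 R) x * \<bar>F (x + h) - F x\<bar> powr p \<partial>lborel) powr (1/p)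
        \<le> norm h powr \<alpha> * besov_norm \<alpha> p (ball x0 \<rho>) f"
proof -
  let ?B = "ball x0 \<rho>"
  obtain \<rho>' where \<rho>': "\<rho> < \<rho>'" "cball x0 \<rho>' \<subseteq> \<Omega>" using cball_subset_open_enlarge[OF \<Omega>] .
  obtain \<psi> :: "real ^ 'n \<Rightarrow> real" where \<psi>: "smooth \<psi>" "\<And>x. 0 \<le> \<psi> x" "\<And>x. \<psi> x \<le> 1"
    "\<And>x. dist x x0 \<le> \<rho> \<Longrightarrow> \<psi> x = 1" "\<And>x. \<rho>' \<le> dist x x0 \<Longrightarrow> \<psi> x = 0"
    by (rule smooth_cutoff_exists[OF less_imp_le[OF \<Omega>(3)] \<rho>'(1), where ?x0.0 = x0]) (rule that; assumption)
  have "\<psi> \<in> test_functions \<Omega>"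
    by (rule smooth_vanishing_outside_ball_test_function[OF \<psi>(1) _ \<rho>'(2)]) (use \<psi>(5) in \<open>auto simp: dist_commute\<close>)
  then have b: "(\<lambda>x. \<psi> x * f x) \<in> besov \<alpha> p UNIV" using f by (auto simp: besov_loc_def)
  then have L: "(\<lambda>x. \<psi> x * f x) \<in> Lp_space p UNIV" by (simp add: besov_def)
  obtain F where F[measurable]: "F \<in> borel_measurable borel"
    and ae: "AE x in lborel. indicator UNIV x *\<^sub>R (\<psi> x * f x) = F x"
    and "\<And>x. x \<notin> UNIV \<Longrightarrow> F x = 0" and Fp: "integrable lborel (\<lambda>x. norm (F x) powr p)"
    and "(\<integral>x. norm (F x) powr p \<partial>lborel) powr (1/p) = Lp_norm p UNIV (\<lambda>x. \<psi> x * f x)"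
    by (rule Lp_space_representative[OF L space_in_borel]) (rule that; assumption)
  have aeB: "AE x in lborel. indicator ?B x *\<^sub>R f x = indicator ?B x * F x"
    using ae by eventually_elim (auto simp: indicator_def \<psi>(4) dist_commute)
  have B[measurable]: "?B \<in> sets borel" by simp
  have FB: "(\<lambda>x. indicator ?B x * F x) \<in> borel_measurable borel" by measurable
  define k where "k h x = \<bar>F (x + h) - F x\<bar> powr p / norm h powr (\<alpha> * p)" for h x
  have [measurable]: "k h \<in> borel_measurable borel" for h unfolding k_def[abs_def] by measurable
  have k0: "0 \<le> k h x" for h x by (simp add: k_def)
  have ki: "integrable lborel (k h)" for h
    using integrable_norm_powr_diff[of p "\<lambda>x. F (x + h)" lborel F] Fp lborel_integrable_translate[OF Fp, of h] p
    by (simp add: k_def[abs_def])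
  define D where "D h = {x \<in> ?B. x + h \<in> ?B}" for h
  have [measurable]: "D h \<in> sets borel" for h unfolding D_def by measurable
  have Di: "integrable lborel (\<lambda>x. indicator (D h) x * k h x)" for h
    using integrable_mult_indicator[OF _ ki, of "D h" h] by simp
  have qB: "besov_quotient \<alpha> p ?B f h = (\<integral>x. indicator (D h) x * k h x \<partial>lborel) powr (1/p)" for h
  proof -
    have "(\<lambda>x. indicator (D h) x * (\<bar>indicator ?B (x + h) * F (x + h) - indicator ?B x * F x\<bar> powr p / norm h powr (\<alpha> * p)))
        = (\<lambda>x. indicator (D h) x * k h x)"
      by (auto simp: D_def k_def indicator_def)
    then show ?thesis by (simp only: besov_quotient_eq[OF B FB aeB] D_def[symmetric])
  qed
  have qU: "besov_quotient \<alpha> p UNIV (\<lambda>x. \<psi> x * f x) h = (\<integral>x. k h x \<partial>lborel) powr (1/p)" for h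
    by (simp add: besov_quotient_eq[OF _ F ae] k_def)
  have q_le: "besov_quotient \<alpha> p ?B f h \<le> besov_quotient \<alpha> p UNIV (\<lambda>x. \<psi> x * f x) h" for h
    unfolding qB qU using Di[of h] ki[of h] p k0
    by (intro powr_mono2 integral_mono) (auto simp: indicator_def)
  obtain M where M: "\<And>h. h \<noteq> 0 \<Longrightarrow> besov_quotient \<alpha> p UNIV (\<lambda>x. \<psi> x * f x) h \<le> M"
    using b by (auto simp: besov_def bdd_above_def)
  have "bdd_above (besov_quotient \<alpha> p ?B f ` (UNIV - {0}))"
    by (rule bdd_aboveI2[where M = M], rule order_trans[OF q_le M]) simp
  then have sup: "besov_quotient \<alpha> p ?B f h \<le> besov_norm \<alpha> p ?B f" if "h \<noteq> 0" for h
    using cSUP_upper[of h "UNIV - {0}" "besov_quotient \<alpha> p ?B f"] that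
    by (simp add: besov_norm_def besov_seminorm_def Lp_norm_def add_increasing)
  show thesis
  proof (rule that[OF F])
    show "AE x in lborel. x \<in> ?B \<longrightarrow> f x = F x"
      using aeB by eventually_elim (auto simp: indicator_def)
    show "integrable lborel (\<lambda>x. \<bar>F x\<bar> powr p)" using Fp by simp
    \<comment> \<open>Any nonzero translation shows that the supremum of the quotients is nonnegative.\<close>
    have "0 \<le> besov_quotient \<alpha> p ?B f (axis undefined 1)" by (simp add: besov_quotient_def)
    also have "\<dots> \<le> besov_norm \<alpha> p ?B f" by (rule sup) (simp add: axis_eq_0_iff)
    finally show "0 \<le> besov_norm \<alpha> p ?B f" .
    fix R h assume h: "h \<noteq> 0" and sub: "\<forall>x\<in>ball x0 R. x \<in> ?B \<and> x + h \<in> ?B"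
    have "(\<integral>x. indicator (ball x0 R) x * \<bar>F (x + h) - F x\<bar> powr p \<partial>lborel)
        \<le> (\<integral>x. norm h powr (\<alpha> * p) * (indicator (D h) x * k h x) \<partial>lborel)"
    proof (rule integral_mono)
      have "integrable lborel (\<lambda>x. \<bar>F (x + h) - F x\<bar> powr p)"
        using integrable_norm_powr_diff[of p "\<lambda>x. F (x + h)" lborel F] Fp lborel_integrable_translate[OF Fp, of h] p
        by simp
      from integrable_mult_indicator[OF _ this, of "ball x0 R"]
      show "integrable lborel (\<lambda>x. indicator (ball x0 R) x * \<bar>F (x + h) - F x\<bar> powr p)" by simp
      show "indicator (ball x0 R) x * \<bar>F (x + h) - F x\<bar> powr p \<le> norm h powr (\<alpha> * p) * (indicator (D h) x * k h x)" for x
        using sub h k0[of h x] by (cases "x \<in> ball x0 R") (auto simp: D_def k_def indicator_def)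
    qed (use Di in simp)
    then have "(\<integral>x. indicator (ball x0 R) x * \<bar>F (x + h) - F x\<bar> powr p \<partial>lborel) powr (1/p)
        \<le> (norm h powr (\<alpha> * p) * (\<integral>x. indicator (D h) x * k h x \<partial>lborel)) powr (1/p)"
      using p by (intro powr_mono2) auto
    also have "\<dots> = norm h powr \<alpha> * besov_quotient \<alpha> p ?B f h"
      using p k0 by (simp add: qB powr_mult powr_powr)
    also have "\<dots> \<le> norm h powr \<alpha> * besov_norm \<alpha> p ?B f"
      by (intro mult_left_mono sup[OF h]) simp
    finally show "(\<integral>x. indicator (ball x0 R) x * \<bar>F (x + h) - F x\<bar> powr p \<partial>lborel) powr (1/p)
        \<le> norm h powr \<alpha> * besov_norm \<alpha> p ?B f" .
  qed
qed

section \<open>The local estimate for weak solutions\<close>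

lemma has_weak_gradient_imp_weak_gradient_in:
  fixes u U :: "real ^ 'n::finite \<Rightarrow> real"
  assumes wg: "has_weak_gradient \<Omega> u Du" and \<Omega>: "open \<Omega>" "cball x0 \<rho> \<subseteq> \<Omega>"
    and U[measurable]: "U \<in> borel_measurable borel" and G[measurable]: "G \<in> borel_measurable borel"
    and aeU: "AE x in lborel. x \<in> ball x0 \<rho> \<longrightarrow> U x = u x" and aeG: "AE x in lborel. x \<in> ball x0 \<rho> \<longrightarrow> G x = Du x"
  shows "weak_gradient_in (ball x0 \<rho>) U G"
  unfolding weak_gradient_in_def
proof (intro allI impI)
  fix \<phi> :: "real ^ 'n \<Rightarrow> real" and i
  assume \<phi>: "smooth \<phi>" and supp: "\<forall>x. x \<notin> ball x0 \<rho> \<longrightarrow> \<phi> x = 0"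
  have \<Omega>b: "\<Omega> \<in> sets borel" using \<Omega>(1) by simp
  note [measurable] = smooth_borel_measurable[OF \<phi>] smooth_borel_measurable[OF smooth_partial[OF \<phi>]]
  have p0: "partial i \<phi> x = 0" if "x \<notin> ball x0 \<rho>" for x
    using partial_zero_outside_ball[OF \<phi> _ that] supp by blast
  have in\<Omega>: "x \<in> \<Omega>" if "x \<in> ball x0 \<rho>" for x using \<Omega>(2) that by auto
  have "\<phi> \<in> test_functions \<Omega>"
    using smooth_vanishing_outside_ball_test_function[OF \<phi> _ \<Omega>(2)] supp by blast
  then have "(\<integral>x. u x * partial i \<phi> x \<partial>lebesgue_on \<Omega>) = - (\<integral>x. Du x $ i * \<phi> x \<partial>lebesgue_on \<Omega>)"
    using wg unfolding has_weak_gradient_def by blast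
  moreover have "(\<integral>x. u x * partial i \<phi> x \<partial>lebesgue_on \<Omega>) = (\<integral>x. U x * partial i \<phi> x \<partial>lborel)"
  proof (rule lebesgue_on_transfer(2)[OF \<Omega>b])
    show "AE x in lborel. indicator \<Omega> x *\<^sub>R (u x * partial i \<phi> x) = U x * partial i \<phi> x"
      using aeU
    proof eventually_elim
      case (elim x)
      then show ?case using p0[of x] in\<Omega>[of x] by (cases "x \<in> ball x0 \<rho>") auto
    qed
  qed measurable
  moreover have "(\<integral>x. Du x $ i * \<phi> x \<partial>lebesgue_on \<Omega>) = (\<integral>x. G x $ i * \<phi> x \<partial>lborel)"
  proof (rule lebesgue_on_transfer(2)[OF \<Omega>b])
    show "AE x in lborel. indicator \<Omega> x *\<^sub>R (Du x $ i * \<phi> x) = G x $ i * \<phi> x"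
      using aeG
    proof eventually_elim
      case (elim x)
      then show ?case using supp in\<Omega>[of x] by (cases "x \<in> ball x0 \<rho>") auto
    qed
  qed measurable
  ultimately show "(\<integral>x. U x * partial i \<phi> x \<partial>lborel) = - (\<integral>x. G x $ i * \<phi> x \<partial>lborel)" by simp
qed

lemma borel_Lp_space:
  fixes \<Phi> :: "real ^ 'n::finite \<Rightarrow> 'b::euclidean_space"
  assumes [measurable]: "\<Phi> \<in> borel_measurable borel" and int: "integrable lborel (\<lambda>x. norm (\<Phi> x) powr m)"
    and S[measurable]: "S \<in> sets borel"
  shows "\<Phi> \<in> Lp_space m S"
proof -
  have int': "integrable lborel (\<lambda>x. indicator S x *\<^sub>R norm (\<Phi> x) powr m)"
    by (rule integrable_mult_indicator[OF _ int]) simp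
  have m1: "(\<lambda>x. indicator S x *\<^sub>R \<Phi> x) \<in> borel_measurable borel"
    and m2: "(\<lambda>x. indicator S x *\<^sub>R norm (\<Phi> x) powr m) \<in> borel_measurable borel" by measurable
  have "\<Phi> \<in> borel_measurable (lebesgue_on S)"
    by (rule lebesgue_on_transfer(1)[OF S m1 AE_I2[OF refl]])
  moreover have "integrable (lebesgue_on S) (\<lambda>x. norm (\<Phi> x) powr m)"
    using lebesgue_on_transfer(3)[OF S m2 AE_I2[OF refl]] int' by blast
  ultimately show ?thesis unfolding Lp_space_def by blast
qed

lemma weak_gradient_in_imp_sobolev_W1:
  fixes \<Phi> :: "real ^ 'n::finite \<Rightarrow> real"
  assumes wg: "weak_gradient_in UNIV \<Phi> D\<Phi>" and \<Omega>: "open \<Omega>" "cball x0 \<rho> \<subseteq> \<Omega>" and q: "1 \<le> q"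
    and [measurable]: "\<Phi> \<in> borel_measurable borel" "D\<Phi> \<in> borel_measurable borel"
    and int: "integrable lborel (\<lambda>x. \<bar>\<Phi> x\<bar> powr q)" "integrable lborel (\<lambda>x. norm (D\<Phi> x) powr q)"
    and zero: "\<And>x. x \<notin> ball x0 \<rho> \<Longrightarrow> \<Phi> x = 0" "\<And>x. x \<notin> ball x0 \<rho> \<Longrightarrow> D\<Phi> x = 0"
  shows "sobolev_W1 q \<Omega> \<Phi> D\<Phi>"
proof -
  have \<Omega>b: "\<Omega> \<in> sets borel" using \<Omega>(1) by simp
  have in\<Omega>: "x \<in> \<Omega>" if "x \<in> ball x0 \<rho>" for x using \<Omega>(2) that by auto
  have "integrable lborel \<Phi>" "integrable lborel D\<Phi>"
    by (rule integrable_if_powr_integrable[OF q, of _ x0 \<rho>]; use int zero in auto)+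
  then have "integrable lborel (\<lambda>x. norm (\<Phi> x) powr 1)" "integrable lborel (\<lambda>x. norm (D\<Phi> x) powr 1)"
    by simp_all
  then have loc: "\<Phi> \<in> Lp_loc 1 \<Omega>" "D\<Phi> \<in> Lp_loc 1 \<Omega>"
    by (auto simp: Lp_loc_def intro!: borel_Lp_space borel_compact)
  have "(\<integral>x. \<Phi> x * partial i \<phi> x \<partial>lebesgue_on \<Omega>) = - (\<integral>x. D\<Phi> x $ i * \<phi> x \<partial>lebesgue_on \<Omega>)"
    if "\<phi> \<in> test_functions \<Omega>" for \<phi> i
  proof -
    have \<phi>: "smooth \<phi>" using that by (simp add: test_functions_def)
    note [measurable] = smooth_borel_measurable[OF \<phi>] smooth_borel_measurable[OF smooth_partial[OF \<phi>]]
    have i1: "indicator \<Omega> x *\<^sub>R (\<Phi> x * partial i \<phi> x) = \<Phi> x * partial i \<phi> x"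
      and i2: "indicator \<Omega> x *\<^sub>R (D\<Phi> x $ i * \<phi> x) = D\<Phi> x $ i * \<phi> x" for x
      using zero[of x] in\<Omega>[of x] by (cases "x \<in> ball x0 \<rho>"; simp)+
    have m1: "(\<lambda>x. \<Phi> x * partial i \<phi> x) \<in> borel_measurable borel"
      and m2: "(\<lambda>x. D\<Phi> x $ i * \<phi> x) \<in> borel_measurable borel" by measurable
    have "(\<integral>x. \<Phi> x * partial i \<phi> x \<partial>lebesgue_on \<Omega>) = (\<integral>x. \<Phi> x * partial i \<phi> x \<partial>lborel)"
      "(\<integral>x. D\<Phi> x $ i * \<phi> x \<partial>lebesgue_on \<Omega>) = (\<integral>x. D\<Phi> x $ i * \<phi> x \<partial>lborel)"
      by (rule lebesgue_on_transfer(2)[OF \<Omega>b m1 AE_I2[OF i1]] lebesgue_on_transfer(2)[OF \<Omega>b m2 AE_I2[OF i2]])+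
    moreover have "(\<integral>x. \<Phi> x * partial i \<phi> x \<partial>lborel) = - (\<integral>x. D\<Phi> x $ i * \<phi> x \<partial>lborel)"
      using wg \<phi> unfolding weak_gradient_in_def by blast
    ultimately show ?thesis by simp
  qed
  moreover have "\<Phi> \<in> Lp_space q \<Omega>" "D\<Phi> \<in> Lp_space q \<Omega>"
    using int by (auto intro!: borel_Lp_space \<Omega>b)
  ultimately show ?thesis using loc by (auto simp: sobolev_W1_def has_weak_gradient_def)
qed

text \<open>
  On the enlarged ball \<open>u\<close> and \<open>Du\<close> are represented by Borel functions extended by zero, and \<open>f\<close> by a
  Borel function with integrable power \<open>p\<close>.
  Points of the ball of radius \<open>R\<close> stay inside it after a translation by \<open>h\<close>, so these functions satisfy
  the hypotheses of \<open>energy_estimate\<close>.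
\<close>

lemma local_estimate_with_cutoff:
  fixes f u \<eta> :: "real ^ 'n::finite \<Rightarrow> real" and Du :: "real ^ 'n \<Rightarrow> real ^ 'n"
  assumes q: "2 \<le> q" and p: "p = q / (q - 1)" and R: "0 < R" and h: "norm h \<le> r" "h \<noteq> 0"
    and \<eta>: "smooth \<eta>" "\<And>x. 0 \<le> \<eta> x" "\<And>x. \<eta> x \<le> 1" "\<And>x. dist x x0 \<le> R / 2 \<Longrightarrow> \<eta> x = 1"
      "\<And>x. R \<le> dist x x0 \<Longrightarrow> \<eta> x = 0"
    and L: "\<And>x. norm (\<chi> i. partial i \<eta> x) \<le> L"
    and \<Omega>: "open \<Omega>" "cball x0 (R + r) \<subseteq> \<Omega>"
    and f: "f \<in> besov_loc \<alpha> p \<Omega>" and sol: "local_weak_solution q \<Omega> f u Du"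
  defines "B' \<equiv> ball x0 (R + r)"
  shows "(\<integral>\<^sup>+x. ennreal ((norm (H (q/2) (Du (x + h)) - H (q/2) (Du x)))\<^sup>2) \<partial>lebesgue_on (ball x0 (R/2)))
    \<le> ennreal (q\<^sup>2 / 2 * (1 + 6 * q\<^sup>2 * L\<^sup>2) *
        (besov_norm \<alpha> p B' f * Lp_norm q B' Du * norm h powr (\<alpha> + 1) + Lp_norm q B' Du powr q * (norm h)\<^sup>2))" (is "?I \<le> ?b")
    and "0 \<le> besov_norm \<alpha> p B' f"
proof -
  have r: "0 \<le> r" using h(1) norm_ge_zero order_trans by blast
  have pos: "0 < R + r" using R r by simp
  have q1: "1 \<le> q" using q by simp
  have p1: "1 \<le> p" using q by (simp add: p)
  have B'b: "B' \<in> sets borel" and \<Omega>b: "\<Omega> \<in> sets borel" using \<Omega>(1) by (simp_all add: B'_def)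
  have in\<Omega>: "x \<in> \<Omega>" if "x \<in> B'" for x using \<Omega>(2) that by (auto simp: B'_def)
  have shift: "x + h \<in> B'" if "x \<in> ball x0 R" for x
    using that h(1) norm_triangle_ineq4[of "x0 - x" h] by (simp add: dist_norm diff_diff_eq B'_def)
  have sub: "x \<in> B'" if "x \<in> ball x0 R" for x using that r by (simp add: B'_def)
  have W1: "has_weak_gradient \<Omega> u Du" "u \<in> Lp_loc q \<Omega>" "Du \<in> Lp_loc q \<Omega>"
    and weak: "\<And>\<phi> D\<phi> K. sobolev_W1 q \<Omega> \<phi> D\<phi> \<Longrightarrow> compact K \<Longrightarrow> K \<subseteq> \<Omega> \<Longrightarrow>
        AE x in lebesgue_on \<Omega>. x \<notin> K \<longrightarrow> \<phi> x = 0 \<Longrightarrow>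
        (\<integral>x. H (q - 1) (Du x) \<bullet> D\<phi> x \<partial>lebesgue_on \<Omega>) = (\<integral>x. f x * \<phi> x \<partial>lebesgue_on \<Omega>)"
    using sol unfolding local_weak_solution_def sobolev_W1_loc_def by blast+
  have cb: "cball x0 (R + r) \<in> sets borel" "B' \<subseteq> cball x0 (R + r)" by (auto simp: B'_def)
  have "u \<in> Lp_space q (cball x0 (R + r))" "Du \<in> Lp_space q (cball x0 (R + r))"
    using W1(2,3) \<Omega>(2) by (auto simp: Lp_loc_def)
  then have uB: "u \<in> Lp_space q B'" and DuB: "Du \<in> Lp_space q B'"
    using Lp_space_subset cb B'b by blast+
  obtain U where U[measurable]: "U \<in> borel_measurable borel" and aeU0: "AE x in lborel. indicator B' x *\<^sub>R u x = U x"
    and U0: "\<And>x. x \<notin> B' \<Longrightarrow> U x = 0" and Uq: "integrable lborel (\<lambda>x. norm (U x) powr q)"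
    and "(\<integral>x. norm (U x) powr q \<partial>lborel) powr (1/q) = Lp_norm q B' u"
    by (rule Lp_space_representative[OF uB B'b]) (rule that; assumption)
  obtain G where G[measurable]: "G \<in> borel_measurable borel" and aeG0: "AE x in lborel. indicator B' x *\<^sub>R Du x = G x"
    and G0: "\<And>x. x \<notin> B' \<Longrightarrow> G x = 0" and Gq: "integrable lborel (\<lambda>x. norm (G x) powr q)"
    and GN: "(\<integral>x. norm (G x) powr q \<partial>lborel) powr (1/q) = Lp_norm q B' Du"
    by (rule Lp_space_representative[OF DuB B'b]) (rule that; assumption)
  have aeU: "AE x in lborel. x \<in> B' \<longrightarrow> U x = u x"
    using aeU0 by eventually_elim (auto simp: indicator_def split: if_splits)
  have aeG: "AE x in lborel. x \<in> B' \<longrightarrow> G x = Du x"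
    using aeG0 by eventually_elim (auto simp: indicator_def split: if_splits)
  obtain F where F[measurable]: "F \<in> borel_measurable borel" and aeF: "AE x in lborel. x \<in> B' \<longrightarrow> f x = F x"
    and Fp: "integrable lborel (\<lambda>x. \<bar>F x\<bar> powr p)" and bn: "0 \<le> besov_norm \<alpha> p B' f"
    and Fh: "\<And>R h. h \<noteq> 0 \<Longrightarrow> \<forall>x\<in>ball x0 R. x \<in> B' \<and> x + h \<in> B' \<Longrightarrow>
      (\<integral>x. indicator (ball x0 R) x * \<bar>F (x + h) - F x\<bar> powr p \<partial>lborel) powr (1/p)
        \<le> norm h powr \<alpha> * besov_norm \<alpha> p B' f"
    by (rule besov_loc_ball_representative[OF f \<Omega> pos p1, folded B'_def]) (rule that; assumption)
  show "0 \<le> besov_norm \<alpha> p B' f" by (rule bn)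
  define N where "N = (\<integral>x. norm (G x) powr q \<partial>lborel)"
  have N: "0 \<le> N" by (simp add: N_def)
  have Nq: "Lp_norm q B' Du powr q = N" using N q by (simp add: powr_powr flip: GN N_def)
  have wg: "weak_gradient_in (ball x0 (R + r)) U G"
    by (rule has_weak_gradient_imp_weak_gradient_in[OF W1(1) \<Omega> U G]) (use aeU aeG in \<open>simp_all add: B'_def\<close>)
  have eq: "(\<integral>x. H (q - 1) (G x) \<bullet> D\<Phi> x \<partial>lborel) = (\<integral>x. F x * \<Phi> x \<partial>lborel)"
    if m[measurable]: "\<Phi> \<in> borel_measurable borel" "D\<Phi> \<in> borel_measurable borel"
      and int: "integrable lborel (\<lambda>x. \<bar>\<Phi> x\<bar> powr q)" "integrable lborel (\<lambda>x. norm (D\<Phi> x) powr q)"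
      and z: "\<And>x. x \<notin> ball x0 (R + r) \<Longrightarrow> \<Phi> x = 0" "\<And>x. x \<notin> ball x0 (R + r) \<Longrightarrow> D\<Phi> x = 0"
      and wg\<Phi>: "weak_gradient_in UNIV \<Phi> D\<Phi>" for \<Phi> D\<Phi>
  proof -
    have "sobolev_W1 q \<Omega> \<Phi> D\<Phi>"
      by (rule weak_gradient_in_imp_sobolev_W1[OF wg\<Phi> \<Omega> q1 m int z])
    moreover have "AE x in lebesgue_on \<Omega>. x \<notin> cball x0 (R + r) \<longrightarrow> \<Phi> x = 0"
      using z(1) by (intro AE_I2) auto
    ultimately have "(\<integral>x. H (q - 1) (Du x) \<bullet> D\<Phi> x \<partial>lebesgue_on \<Omega>) = (\<integral>x. f x * \<Phi> x \<partial>lebesgue_on \<Omega>)"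
      by (intro weak[OF _ compact_cball \<Omega>(2)])
    moreover have "(\<integral>x. H (q - 1) (Du x) \<bullet> D\<Phi> x \<partial>lebesgue_on \<Omega>) = (\<integral>x. H (q - 1) (G x) \<bullet> D\<Phi> x \<partial>lborel)"
    proof (rule lebesgue_on_transfer(2)[OF \<Omega>b])
      show "AE x in lborel. indicator \<Omega> x *\<^sub>R (H (q - 1) (Du x) \<bullet> D\<Phi> x) = H (q - 1) (G x) \<bullet> D\<Phi> x"
        using aeG
      proof eventually_elim
        case (elim x)
        then show ?case using z(2)[of x] in\<Omega>[of x] by (cases "x \<in> B'") (auto simp: B'_def)
      qed
    qed measurable
    moreover have "(\<integral>x. f x * \<Phi> x \<partial>lebesgue_on \<Omega>) = (\<integral>x. F x * \<Phi> x \<partial>lborel)"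
    proof (rule lebesgue_on_transfer(2)[OF \<Omega>b])
      show "AE x in lborel. indicator \<Omega> x *\<^sub>R (f x * \<Phi> x) = F x * \<Phi> x"
        using aeF
      proof eventually_elim
        case (elim x)
        then show ?case using z(1)[of x] in\<Omega>[of x] by (cases "x \<in> B'") (auto simp: B'_def)
      qed
    qed measurable
    ultimately show ?thesis by simp
  qed
  have \<eta>0: "\<eta> x = 0" if "x \<notin> ball x0 R" for x using \<eta>(5)[of x] that by (simp add: dist_commute)
  define E where "E x = (\<eta> x)\<^sup>2 * (norm (H (q/2) (G (x + h)) - H (q/2) (G x)))\<^sup>2" for x
  have E_nonneg: "0 \<le> E x" for x by (simp add: E_def)
  have Uq': "integrable lborel (\<lambda>x. \<bar>U x\<bar> powr q)" using Uq by simp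
  note energy = energy_estimate[OF q p R h \<eta>(1,2,3) \<eta>0 L U G F U0[unfolded B'_def] G0[unfolded B'_def] Uq' Gq Fp wg eq,
      folded E_def N_def]
  have energy_bound: "2 / q\<^sup>2 * (\<integral>x. E x \<partial>lborel)
      \<le> (norm h powr \<alpha> * besov_norm \<alpha> p B' f) * (norm h * N powr (1/q)) + 6 * q\<^sup>2 * L\<^sup>2 * (norm h)\<^sup>2 * N"
  proof -
    have "(\<integral>x. indicator (ball x0 R) x * \<bar>F (x + h) - F x\<bar> powr p \<partial>lborel) powr (1/p)
        \<le> norm h powr \<alpha> * besov_norm \<alpha> p B' f"
      by (rule Fh[OF h(2)]) (use shift sub in blast)
    then show ?thesis
      by (intro order_trans[OF energy(1)] add_right_mono mult_right_mono) auto
  qed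
  have "(\<integral>x. E x \<partial>lborel) \<le> q\<^sup>2 / 2 * (1 + 6 * q\<^sup>2 * L\<^sup>2) *
        (besov_norm \<alpha> p B' f * Lp_norm q B' Du * norm h powr (\<alpha> + 1) + Lp_norm q B' Du powr q * (norm h)\<^sup>2)"
  proof -
    define X Y C where "X = besov_norm \<alpha> p B' f * Lp_norm q B' Du * norm h powr (\<alpha> + 1)"
      and "Y = Lp_norm q B' Du powr q * (norm h)\<^sup>2" and "C = 6 * q\<^sup>2 * L\<^sup>2"
    have X: "(norm h powr \<alpha> * besov_norm \<alpha> p B' f) * (norm h * N powr (1/q)) = X"
      by (simp add: X_def GN[folded N_def] powr_add mult_ac)
    have "0 \<le> Lp_norm q B' Du" by (simp add: Lp_norm_def)
    then have nonneg: "0 \<le> X" "0 \<le> Y" "0 \<le> C" using bn by (simp_all add: X_def Y_def C_def)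
    have "(\<integral>x. E x \<partial>lborel) = q\<^sup>2 / 2 * (2 / q\<^sup>2 * (\<integral>x. E x \<partial>lborel))" using q by simp
    also have "\<dots> \<le> q\<^sup>2 / 2 * (X + C * Y)"
      using energy_bound unfolding X by (intro mult_left_mono) (auto simp: Y_def C_def Nq mult_ac)
    also have "\<dots> \<le> q\<^sup>2 / 2 * ((1 + C) * (X + Y))"
    proof (rule mult_left_mono)
      have "(1 + C) * (X + Y) - (X + C * Y) = Y + C * X" by (simp add: algebra_simps)
      also have "0 \<le> \<dots>" using nonneg by simp
      finally show "X + C * Y \<le> (1 + C) * (X + Y)" by simp
    qed simp
    finally show ?thesis by (simp add: X_def Y_def C_def mult.assoc)
  qed
  moreover have "?I
      \<le> ennreal (\<integral>x. E x \<partial>lborel)"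
  proof -
    have "?I
        = (\<integral>\<^sup>+x. ennreal ((norm (H (q/2) (Du (x + h)) - H (q/2) (Du x)))\<^sup>2) * indicator (ball x0 (R/2)) x \<partial>lborel)"
      by (subst nn_integral_restrict_space) (simp_all add: nn_integral_completion)
    also have "\<dots> \<le> (\<integral>\<^sup>+x. ennreal (E x) \<partial>lborel)"
    proof (rule nn_integral_mono_AE)
      show "AE x in lborel. ennreal ((norm (H (q/2) (Du (x + h)) - H (q/2) (Du x)))\<^sup>2) * indicator (ball x0 (R/2)) x \<le> ennreal (E x)"
        using aeG AE_lborel_translate[OF aeG, of h]
      proof eventually_elim
        case (elim x)
        show ?case
        proof (cases "x \<in> ball x0 (R/2)")
          case True
          then have "x \<in> ball x0 R" using R by simp
          with elim shift sub have "G x = Du x" "G (x + h) = Du (x + h)" by auto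
          moreover have "\<eta> x = 1" using True by (intro \<eta>(4)) (simp add: dist_commute)
          ultimately show ?thesis using True by (simp add: E_def)
        qed simp
      qed
    qed
    also have "\<dots> = ennreal (\<integral>x. E x \<partial>lborel)"
      by (rule nn_integral_eq_integral[OF energy(2) AE_I2[OF E_nonneg]])
    finally show ?thesis .
  qed
  ultimately show "?I
    \<le> ?b"
    by (meson ennreal_leI order_trans)
qed

text \<open>
  The cutoff is chosen once for the ball of radius \<open>R\<close> at the origin and then translated, so that its
  gradient bound, and with it the constant, depends on \<open>R\<close>, \<open>q\<close> and the dimension alone.
\<close>

lemma local_estimate:
  fixes q p R :: real
  assumes q: "2 \<le> q" and p: "p = q / (q - 1)" and R: "0 < R"
  shows "\<exists>c>0. \<forall>(\<Omega> :: (real ^ 'n::finite) set) \<alpha> f u Du x0 r h.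
    open \<Omega> \<longrightarrow> f \<in> besov_loc \<alpha> p \<Omega> \<longrightarrow> local_weak_solution q \<Omega> f u Du \<longrightarrow> cball x0 (R + r) \<subseteq> \<Omega> \<longrightarrow>
    norm h \<le> r \<longrightarrow> h \<noteq> 0 \<longrightarrow>
    0 \<le> besov_norm \<alpha> p (ball x0 (R + r)) f \<and>
    (\<integral>\<^sup>+x. ennreal ((norm (H (q/2) (Du (x + h)) - H (q/2) (Du x)))\<^sup>2) \<partial>lebesgue_on (ball x0 (R/2)))
    \<le> ennreal (c * (besov_norm \<alpha> p (ball x0 (R + r)) f * Lp_norm q (ball x0 (R + r)) Du * norm h powr (\<alpha> + 1)
        + Lp_norm q (ball x0 (R + r)) Du powr q * (norm h)\<^sup>2))"
proof -
  have half: "0 \<le> R/2" "R/2 < R" using R by auto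
  obtain \<eta> :: "real ^ 'n \<Rightarrow> real" where \<eta>: "smooth \<eta>" "\<And>x. 0 \<le> \<eta> x" "\<And>x. \<eta> x \<le> 1"
    "\<And>x. dist x 0 \<le> R/2 \<Longrightarrow> \<eta> x = 1" "\<And>x. R \<le> dist x 0 \<Longrightarrow> \<eta> x = 0"
    by (rule smooth_cutoff_exists[OF half, where ?x0.0 = 0]) (rule that; assumption)
  have zero: "\<eta> x = 0" if "x \<notin> cball 0 R" for x using \<eta>(5)[of x] that by simp
  obtain C where C: "0 \<le> C" "\<And>i x. \<bar>partial i \<eta> x\<bar> \<le> C"
    by (rule smooth_partial_bounded[OF \<eta>(1), where ?x0.0 = 0 and R = R, OF zero]) (assumption, (rule that; assumption))
  define L where "L = (\<Sum>i\<in>(UNIV :: 'n set). C)"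
  have L: "norm (\<chi> i. partial i \<eta> x) \<le> L" for x
  proof -
    have "norm (\<chi> i. partial i \<eta> x) \<le> (\<Sum>i\<in>UNIV. \<bar>(\<chi> i. partial i \<eta> x) $ i\<bar>)" by (rule norm_le_l1_cart)
    also have "\<dots> \<le> L" unfolding L_def using C(2) by (intro sum_mono) simp
    finally show ?thesis .
  qed
  define c where "c = q\<^sup>2 / 2 * (1 + 6 * q\<^sup>2 * L\<^sup>2)"
  have "0 < 1 + 6 * q\<^sup>2 * L\<^sup>2" by (intro add_pos_nonneg) auto
  then have "c > 0" using q unfolding c_def by (intro mult_pos_pos) auto
  moreover have "0 \<le> besov_norm \<alpha> p (ball x0 (R + r)) f \<and>
    (\<integral>\<^sup>+x. ennreal ((norm (H (q/2) (Du (x + h)) - H (q/2) (Du x)))\<^sup>2) \<partial>lebesgue_on (ball x0 (R/2)))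
    \<le> ennreal (c * (besov_norm \<alpha> p (ball x0 (R + r)) f * Lp_norm q (ball x0 (R + r)) Du * norm h powr (\<alpha> + 1)
        + Lp_norm q (ball x0 (R + r)) Du powr q * (norm h)\<^sup>2))"
    if \<Omega>: "open \<Omega>" "f \<in> besov_loc \<alpha> p \<Omega>" "local_weak_solution q \<Omega> f u Du" "cball x0 (R + r) \<subseteq> \<Omega>"
      and h: "norm h \<le> r" "h \<noteq> 0"
    for \<Omega> :: "(real ^ 'n) set" and \<alpha> f u Du x0 r h
  proof -
    define \<theta> where "\<theta> x = \<eta> (x + - x0)" for x
    have d: "dist x x0 = dist (x + - x0) 0" for x by (simp add: dist_norm)
    have \<theta>: "smooth \<theta>" unfolding \<theta>_def by (intro allI C_diff_translate \<eta>(1)[rule_format])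
    have p\<theta>: "partial i \<theta> x = partial i \<eta> (x + - x0)" for i x
      unfolding \<theta>_def by (rule partial_translate[OF smooth_differentiable[OF \<eta>(1)]])
    have L\<theta>: "norm (\<chi> i. partial i \<theta> x) \<le> L" for x unfolding p\<theta> by (rule L)
    have \<theta>': "0 \<le> \<theta> x" "\<theta> x \<le> 1" "dist x x0 \<le> R/2 \<Longrightarrow> \<theta> x = 1" "R \<le> dist x x0 \<Longrightarrow> \<theta> x = 0" for x
      using \<eta>(2-5)[of "x + - x0"] unfolding \<theta>_def d by blast+
    show ?thesis
      using local_estimate_with_cutoff[OF q p R h \<theta> \<theta>' L\<theta> \<Omega>(1,4,2,3)] unfolding c_def by blast
  qed
  ultimately show ?thesis by blast
qed

section \<open>Local Besov regularity\<close>

lemma sum_sq_le: "(a + b)\<^sup>2 \<le> 2 * a\<^sup>2 + 2 * b\<^sup>2" for a b :: real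
proof -
  have "2 * a\<^sup>2 + 2 * b\<^sup>2 - (a + b)\<^sup>2 = (a - b)\<^sup>2" by (simp add: power2_eq_square algebra_simps)
  also have "0 \<le> \<dots>" by simp
  finally show ?thesis by simp
qed

lemma smooth_compact_support_lipschitz:
  fixes \<phi> :: "real ^ 'n::finite \<Rightarrow> real"
  assumes \<phi>: "smooth \<phi>" and zero: "\<And>x. x \<notin> cball x0 \<rho> \<Longrightarrow> \<phi> x = 0"
  obtains L where "0 \<le> L" "\<And>x y. \<bar>\<phi> x - \<phi> y\<bar> \<le> L * norm (x - y)"
proof -
  obtain C where C: "0 \<le> C" "\<And>i x. \<bar>partial i \<phi> x\<bar> \<le> C"
    by (rule smooth_partial_bounded[OF \<phi>, where ?x0.0 = x0 and R = \<rho>, OF zero]) (assumption, (rule that; assumption))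
  define L where "L = (\<Sum>i\<in>(UNIV :: 'n set). C)"
  have "onorm (\<lambda>h. \<Sum>i\<in>UNIV. h $ i * partial i \<phi> x) \<le> L" for x
  proof (rule onorm_le)
    fix h :: "real ^ 'n"
    have "norm (\<Sum>i\<in>UNIV. h $ i * partial i \<phi> x) \<le> (\<Sum>i\<in>UNIV. norm (h $ i * partial i \<phi> x))" by (rule norm_sum)
    also have "\<dots> \<le> (\<Sum>i\<in>(UNIV :: 'n set). norm h * C)"
      using C component_le_norm_cart by (intro sum_mono) (auto simp: abs_mult intro!: mult_mono)
    finally show "norm (\<Sum>i\<in>UNIV. h $ i * partial i \<phi> x) \<le> L * norm h"
      by (simp add: L_def mult_ac)
  qed
  then have "norm (\<phi> x - \<phi> y) \<le> L * norm (x - y)" for x y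
    by (intro differentiable_bound[OF convex_UNIV has_derivative_partial[OF smooth_differentiable[OF \<phi>]]]) auto
  moreover have "0 \<le> L" using C(1) by (simp add: L_def sum_nonneg)
  ultimately show thesis using that[of L] by simp
qed

text \<open>
  The discrete product rule: the increment of \<open>\<phi> V\<close> splits into an increment of \<open>V\<close> near the support
  of \<open>\<phi>\<close> and one of the Lipschitz function \<open>\<phi>\<close>.
\<close>

lemma localized_translate_bound:
  fixes V :: "real ^ 'n::finite \<Rightarrow> real ^ 'n" and \<phi> :: "real ^ 'n \<Rightarrow> real"
  assumes C: "\<And>x. \<bar>\<phi> x\<bar> \<le> C" and L: "\<And>x y. \<bar>\<phi> x - \<phi> y\<bar> \<le> L * norm (x - y)"
    and K: "x \<notin> A \<Longrightarrow> \<phi> x = 0 \<and> \<phi> (x + h) = 0"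
  shows "(\<phi> (x + h) * V (x + h) $ i - \<phi> x * V x $ i)\<^sup>2
    \<le> 2 * C\<^sup>2 * (indicator A x * (norm (V (x + h) - V x))\<^sup>2) + 2 * (L * norm h)\<^sup>2 * (norm (V x))\<^sup>2"
proof (cases "x \<in> A")
  case True
  have "(\<phi> (x + h) * (V (x + h) - V x) $ i)\<^sup>2 \<le> (C * norm (V (x + h) - V x))\<^sup>2"
    unfolding abs_le_square_iff[symmetric] abs_mult
    using C[of "x + h"] component_le_norm_cart[of "V (x + h) - V x" i] by (intro mult_mono) auto
  moreover have "((\<phi> (x + h) - \<phi> x) * V x $ i)\<^sup>2 \<le> (L * norm h * norm (V x))\<^sup>2"
    unfolding abs_le_square_iff[symmetric] abs_mult
    using L[of "x + h" x] mult_right_mono[OF abs_ge_self[of L] norm_ge_zero[of h]] component_le_norm_cart[of "V x" i]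
    by (intro mult_mono) auto
  moreover have "\<phi> (x + h) * V (x + h) $ i - \<phi> x * V x $ i
      = \<phi> (x + h) * (V (x + h) - V x) $ i + (\<phi> (x + h) - \<phi> x) * V x $ i"
    by (simp add: algebra_simps)
  ultimately show ?thesis
    using True sum_sq_le[of "\<phi> (x + h) * (V (x + h) - V x) $ i" "(\<phi> (x + h) - \<phi> x) * V x $ i"]
    by (simp add: power_mult_distrib)
qed (use K in simp)

text \<open>
  Near the support of a test function the local estimate applies on finitely many half balls, in every
  direction \<open>h\<close>, and gives the bound for small \<open>h\<close>, where \<open>\<bar>h\<bar>\<^sup>2 \<le> \<bar>h\<bar>\<^sup>\<alpha>\<^sup>+\<^sup>1\<close>. For the other \<open>h\<close> the square integral
  of the increment is at most four times that of the function.
\<close>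

lemma H_gradient_besov_loc:
  fixes f u :: "real ^ 'n::finite \<Rightarrow> real" and Du :: "real ^ 'n \<Rightarrow> real ^ 'n"
  assumes q: "2 \<le> q" and p: "p = q / (q - 1)" and \<Omega>: "open \<Omega>" and \<alpha>: "0 < \<alpha>" "\<alpha> < 1"
    and f: "f \<in> besov_loc \<alpha> p \<Omega>" and sol: "local_weak_solution q \<Omega> f u Du"
  shows "(\<lambda>x. H (q/2) (Du x)) \<in> besov_loc_vec ((\<alpha> + 1) / 2) 2 \<Omega>"
  unfolding besov_loc_vec_def besov_loc_def mem_Collect_eq
proof (intro allI ballI)
  fix i :: 'n and \<phi> :: "real ^ 'n \<Rightarrow> real" assume "\<phi> \<in> test_functions \<Omega>"
  define K where "K = closure {x. \<phi> x \<noteq> 0}"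
  have \<phi>: "smooth \<phi>" and K: "compact K" "K \<subseteq> \<Omega>"
    using \<open>\<phi> \<in> test_functions \<Omega>\<close> unfolding test_functions_def K_def by simp_all
  have K0: "\<phi> x = 0" if "x \<notin> K" for x
    using that closure_subset[of "{x. \<phi> x \<noteq> 0}"] unfolding K_def by blast
  obtain \<rho> where "\<forall>x\<in>K. norm x \<le> \<rho>" using compact_imp_bounded[OF K(1)] unfolding bounded_iff by blast
  then have \<rho>: "K \<subseteq> cball 0 \<rho>" by auto
  have zero: "\<phi> x = 0" if "x \<notin> cball 0 \<rho>" for x using K0 \<rho> that by blast
  obtain C where C: "0 \<le> C" "\<And>x. \<bar>\<phi> x\<bar> \<le> C"
    by (rule smooth_vanishing_bounded[OF \<phi>, where ?x0.0 = 0 and R = \<rho>, OF zero]) (assumption, (rule that; assumption))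
  obtain L where L: "0 \<le> L" "\<And>x y. \<bar>\<phi> x - \<phi> y\<bar> \<le> L * norm (x - y)"
    by (rule smooth_compact_support_lipschitz[OF \<phi>, where ?x0.0 = 0 and \<rho> = \<rho>, OF zero]) (assumption, (rule that; assumption))
  obtain \<epsilon> where \<epsilon>: "\<epsilon> > 0" "(\<Union>x\<in>K. cball x \<epsilon>) \<subseteq> \<Omega>"
    using compact_subset_open_imp_cball_epsilon_subset[OF K(1) \<Omega> K(2)] by blast
  \<comment> \<open>Three steps of length at most \<open>\<delta>\<close> from \<open>K\<close> stay in \<open>\<Omega>\<close>, and \<open>\<delta> \<le> 1\<close> lets \<open>\<bar>h\<bar>\<^sup>\<alpha>\<^sup>+\<^sup>1\<close> dominate \<open>\<bar>h\<bar>\<^sup>2\<close>.\<close>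
  define \<delta> where "\<delta> = min \<epsilon> 1 / 4"
  have \<delta>: "0 < \<delta>" "4 * \<delta> \<le> \<epsilon>" "\<delta> \<le> 1" using \<epsilon>(1) by (auto simp: \<delta>_def)
  define N where "N t = {x + y | x y. x \<in> K \<and> y \<in> cball 0 t}" for t
  have N_compact: "compact (N t)" for t unfolding N_def by (intro compact_sums K compact_cball)
  have N_step: "x + y \<in> N (s + t)" if x: "x \<in> N s" and y: "norm y \<le> t" for x y s t
  proof -
    obtain a b where "x = a + b" "a \<in> K" "norm b \<le> s" using x by (auto simp: N_def)
    moreover then have "norm (b + y) \<le> s + t" using y norm_triangle_ineq[of b y] by linarith
    moreover have "x + y = a + (b + y)" using calculation(1) by (simp add: add.assoc)
    ultimately show ?thesis
      unfolding N_def mem_Collect_eq by (intro exI[of _ a] exI[of _ "b + y"]) (simp add: add.assoc)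
  qed
  have N_mono: "N s \<subseteq> N t" if "s \<le> t" for s t
    using N_step[of _ s 0 "t - s"] that by auto
  have N_\<Omega>: "N \<epsilon> \<subseteq> \<Omega>"
  proof
    fix z assume "z \<in> N \<epsilon>"
    then obtain x y where "z = x + y" "x \<in> K" "norm y \<le> \<epsilon>" by (auto simp: N_def)
    then have "z \<in> cball x \<epsilon>" by (simp add: dist_norm)
    with \<open>x \<in> K\<close> \<epsilon>(2) show "z \<in> \<Omega>" by blast
  qed
  have K_N: "x \<in> N t" if "x \<in> K" "0 \<le> t" for x t
    unfolding N_def using that by (intro CollectI exI[of _ x] exI[of _ 0]) auto

  have "Du \<in> Lp_loc q \<Omega>" using sol unfolding local_weak_solution_def sobolev_W1_loc_def by simp
  then have Du: "Du \<in> Lp_space q (N \<epsilon>)" using N_compact[of \<epsilon>] N_\<Omega> unfolding Lp_loc_def by simp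
  have Nb: "N \<epsilon> \<in> sets borel" by (rule borel_compact[OF N_compact])
  obtain G where G[measurable]: "G \<in> borel_measurable borel" and aeG0: "AE x in lborel. indicator (N \<epsilon>) x *\<^sub>R Du x = G x"
    and "\<And>x. x \<notin> N \<epsilon> \<Longrightarrow> G x = 0" and Gq: "integrable lborel (\<lambda>x. norm (G x) powr q)"
    and "(\<integral>x. norm (G x) powr q \<partial>lborel) powr (1/q) = Lp_norm q (N \<epsilon>) Du"
    by (rule Lp_space_representative[OF Du Nb]) (rule that; assumption)
  have aeG: "AE x in lborel. x \<in> N \<epsilon> \<longrightarrow> Du x = G x"
    using aeG0 by eventually_elim (auto simp: indicator_def)
  define V where "V x = H (q/2) (G x)" for x
  have [measurable]: "V \<in> borel_measurable borel" unfolding V_def[abs_def] by measurable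
  have V2: "integrable lborel (\<lambda>x. (norm (V x))\<^sup>2)"
  proof -
    have "integrable lborel (\<lambda>x. norm (H (q/2) (G x)) powr 2)"
      by (rule integrable_norm_H_powr) (use q Gq in auto)
    then show ?thesis by (simp add: V_def)
  qed
  define S where "S = (\<integral>x. (norm (V x))\<^sup>2 \<partial>lborel)"
  have S: "0 \<le> S" by (simp add: S_def)
  define g where "g x = \<phi> x * V x $ i" for x
  have [measurable]: "\<phi> \<in> borel_measurable borel" by (rule smooth_borel_measurable[OF \<phi>])
  have g[measurable]: "g \<in> borel_measurable borel" unfolding g_def[abs_def] by measurable
  have aeg: "AE x in lborel. indicator UNIV x *\<^sub>R (\<phi> x * H (q/2) (Du x) $ i) = g x"
    using aeG
  proof eventually_elim
    case (elim x)
    show ?case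
    proof (cases "x \<in> K")
      case True
      then have "x \<in> N \<epsilon>" using \<epsilon>(1) by (intro K_N) auto
      with elim show ?thesis by (simp add: g_def V_def)
    qed (simp add: g_def K0)
  qed
  have g2: "integrable lborel (\<lambda>x. (g x)\<^sup>2)"
  proof (rule Bochner_Integration.integrable_bound)
    show "integrable lborel (\<lambda>x. C\<^sup>2 * (norm (V x))\<^sup>2)" using V2 by simp
    have "(g x)\<^sup>2 \<le> (C * norm (V x))\<^sup>2" for x
      unfolding g_def abs_le_square_iff[symmetric] abs_mult
      using C(2)[of x] component_le_norm_cart[of "V x" i] by (intro mult_mono) auto
    then show "AE x in lborel. norm ((g x)\<^sup>2) \<le> norm (C\<^sup>2 * (norm (V x))\<^sup>2)"
      by (intro AE_I2) (simp add: power_mult_distrib)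
  qed measurable

  \<comment> \<open>Finitely many half balls, with room around each for the local estimate, cover \<open>N \<delta>\<close>.\<close>
  obtain c where c0: "c > 0" and c: "\<forall>(\<Omega> :: (real ^ 'n) set) \<alpha> f u Du x0 r h.
    open \<Omega> \<longrightarrow> f \<in> besov_loc \<alpha> p \<Omega> \<longrightarrow> local_weak_solution q \<Omega> f u Du \<longrightarrow> cball x0 (\<delta> + r) \<subseteq> \<Omega> \<longrightarrow>
    norm h \<le> r \<longrightarrow> h \<noteq> 0 \<longrightarrow>
    0 \<le> besov_norm \<alpha> p (ball x0 (\<delta> + r)) f \<and>
    (\<integral>\<^sup>+x. ennreal ((norm (H (q/2) (Du (x + h)) - H (q/2) (Du x)))\<^sup>2) \<partial>lebesgue_on (ball x0 (\<delta>/2)))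
    \<le> ennreal (c * (besov_norm \<alpha> p (ball x0 (\<delta> + r)) f * Lp_norm q (ball x0 (\<delta> + r)) Du * norm h powr (\<alpha> + 1)
        + Lp_norm q (ball x0 (\<delta> + r)) Du powr q * (norm h)\<^sup>2))"
    using local_estimate[OF q p \<delta>(1)] by (elim exE conjE) (rule that; assumption)
  obtain D where D: "finite D" "D \<subseteq> N \<delta>" "N \<delta> \<subseteq> (\<Union>a\<in>D. ball a (\<delta>/2))"
    by (rule compactE_image[OF N_compact[of \<delta>], of "N \<delta>" "\<lambda>a. ball a (\<delta>/2)"])
      (use \<delta>(1) in \<open>auto intro: that\<close>)
  define A where "A a = c * (besov_norm \<alpha> p (ball a (\<delta> + \<delta>)) f * Lp_norm q (ball a (\<delta> + \<delta>)) Du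
      + Lp_norm q (ball a (\<delta> + \<delta>)) Du powr q)" for a
  have ball_est: "(\<integral>\<^sup>+x. ennreal (indicator (ball a (\<delta>/2)) x * (norm (V (x + h) - V x))\<^sup>2) \<partial>lborel)
      \<le> ennreal (A a * norm h powr (\<alpha> + 1))" and A_nonneg: "0 \<le> A a"
    if a: "a \<in> D" and h: "h \<noteq> 0" "norm h \<le> \<delta>" for a h
  proof -
    have "cball a (\<delta> + \<delta>) \<subseteq> \<Omega>"
    proof
      fix x assume "x \<in> cball a (\<delta> + \<delta>)"
      then have "a + (x - a) \<in> N (\<delta> + (\<delta> + \<delta>))"
        using a D(2) by (intro N_step) (auto simp: dist_norm norm_minus_commute)
      then show "x \<in> \<Omega>" using N_mono[of "\<delta> + (\<delta> + \<delta>)" \<epsilon>] N_\<Omega> \<delta> by auto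
    qed
    with c \<Omega> f sol h have bn: "0 \<le> besov_norm \<alpha> p (ball a (\<delta> + \<delta>)) f"
      and est: "(\<integral>\<^sup>+x. ennreal ((norm (H (q/2) (Du (x + h)) - H (q/2) (Du x)))\<^sup>2) \<partial>lebesgue_on (ball a (\<delta>/2)))
        \<le> ennreal (c * (besov_norm \<alpha> p (ball a (\<delta> + \<delta>)) f * Lp_norm q (ball a (\<delta> + \<delta>)) Du * norm h powr (\<alpha> + 1)
          + Lp_norm q (ball a (\<delta> + \<delta>)) Du powr q * (norm h)\<^sup>2))"
      by blast+
    have Ln: "0 \<le> Lp_norm q (ball a (\<delta> + \<delta>)) Du" by (simp add: Lp_norm_def)
    show "0 \<le> A a" using bn Ln c0 by (simp add: A_def)
    have "(norm h)\<^sup>2 = norm h powr 2" by simp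
    also have "\<dots> \<le> norm h powr (\<alpha> + 1)" using h \<delta> \<alpha> by (intro powr_mono') auto
    finally have h2: "(norm h)\<^sup>2 \<le> norm h powr (\<alpha> + 1)" .
    have "(\<integral>\<^sup>+x. ennreal (indicator (ball a (\<delta>/2)) x * (norm (V (x + h) - V x))\<^sup>2) \<partial>lborel)
        = (\<integral>\<^sup>+x. ennreal ((norm (H (q/2) (Du (x + h)) - H (q/2) (Du x)))\<^sup>2) * indicator (ball a (\<delta>/2)) x \<partial>lborel)"
    proof (rule nn_integral_cong_AE)
      show "AE x in lborel. ennreal (indicator (ball a (\<delta>/2)) x * (norm (V (x + h) - V x))\<^sup>2)
          = ennreal ((norm (H (q/2) (Du (x + h)) - H (q/2) (Du x)))\<^sup>2) * indicator (ball a (\<delta>/2)) x"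
        using aeG AE_lborel_translate[OF aeG, of h]
      proof eventually_elim
        case (elim x)
        show ?case
        proof (cases "x \<in> ball a (\<delta>/2)")
          case True
          then have "a + (x - a) \<in> N (\<delta> + \<delta>)"
            using a D(2) \<delta>(1) by (intro N_step) (auto simp: dist_norm norm_minus_commute)
          then have x: "x \<in> N (\<delta> + \<delta>)" by simp
          then have "x + h \<in> N (\<delta> + \<delta> + \<delta>)" using h by (intro N_step)
          with x have "x \<in> N \<epsilon>" "x + h \<in> N \<epsilon>"
            using N_mono[of "\<delta> + \<delta>" \<epsilon>] N_mono[of "\<delta> + \<delta> + \<delta>" \<epsilon>] \<delta> by auto
          with elim True show ?thesis by (simp add: V_def)
        qed simp
      qed
    qed
    also have "\<dots> = (\<integral>\<^sup>+x. ennreal ((norm (H (q/2) (Du (x + h)) - H (q/2) (Du x)))\<^sup>2) \<partial>lebesgue_on (ball a (\<delta>/2)))"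
      by (subst nn_integral_restrict_space) (simp_all add: nn_integral_completion)
    also note est
    also have "c * (besov_norm \<alpha> p (ball a (\<delta> + \<delta>)) f * Lp_norm q (ball a (\<delta> + \<delta>)) Du * norm h powr (\<alpha> + 1)
          + Lp_norm q (ball a (\<delta> + \<delta>)) Du powr q * (norm h)\<^sup>2) \<le> A a * norm h powr (\<alpha> + 1)"
      unfolding A_def mult.assoc[of c] using c0 Ln h2
      by (intro mult_left_mono) (auto simp: distrib_right intro: mult_left_mono)
    finally show "(\<integral>\<^sup>+x. ennreal (indicator (ball a (\<delta>/2)) x * (norm (V (x + h) - V x))\<^sup>2) \<partial>lborel)
      \<le> ennreal (A a * norm h powr (\<alpha> + 1))" by (simp add: ennreal_leI)
  qed

  define Q where "Q h = (\<integral>x. (g (x + h) - g x)\<^sup>2 \<partial>lborel)" for h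
  define Z where "Z = (\<integral>x. (g x)\<^sup>2 \<partial>lborel)"
  have Z: "0 \<le> Z" by (simp add: Z_def)
  have g2': "integrable lborel (\<lambda>x. (g (x + h))\<^sup>2)" for h by (rule lborel_integrable_translate[OF g2])
  have Q_le: "(g (x + h) - g x)\<^sup>2 \<le> 2 * (g (x + h))\<^sup>2 + 2 * (g x)\<^sup>2" for x h
    using sum_sq_le[of "g (x + h)" "- g x"] by simp
  have Q_int: "integrable lborel (\<lambda>x. (g (x + h) - g x)\<^sup>2)" for h
    by (rule Bochner_Integration.integrable_bound[where f = "\<lambda>x. 2 * (g (x + h))\<^sup>2 + 2 * (g x)\<^sup>2"])
      (use g2 g2' Q_le in \<open>auto intro!: AE_I2\<close>)
  have Q_far: "Q h \<le> 4 * Z" for h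
  proof -
    have "Q h \<le> (\<integral>x. 2 * (g (x + h))\<^sup>2 + 2 * (g x)\<^sup>2 \<partial>lborel)"
      unfolding Q_def using Q_int g2 g2' Q_le by (intro integral_mono) auto
    also have "\<dots> = 2 * (\<integral>x. (g (x + h))\<^sup>2 \<partial>lborel) + 2 * Z" using g2 g2' by (simp add: Z_def)
    also have "(\<integral>x. (g (x + h))\<^sup>2 \<partial>lborel) = Z"
      unfolding Z_def by (rule lborel_integral_translate) measurable
    finally show ?thesis by simp
  qed
  define T where "T = (\<Sum>a\<in>D. A a)"
  have Q_near: "Q h \<le> (2 * C\<^sup>2 * T + 2 * L\<^sup>2 * S) * norm h powr (\<alpha> + 1)" if h: "h \<noteq> 0" "norm h \<le> \<delta>" for h
  proof -
    let ?J = "\<lambda>a x. ennreal (indicator (ball a (\<delta>/2)) x * (norm (V (x + h) - V x))\<^sup>2)"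
    have T: "0 \<le> T" unfolding T_def using A_nonneg[OF _ h] by (intro sum_nonneg) auto
    have [measurable]: "N \<delta> \<in> sets borel" by (rule borel_compact[OF N_compact])
    have [measurable]: "ball a (\<delta>/2) \<in> sets borel" for a :: "real ^ 'n" by simp
    have off: "\<phi> x = 0 \<and> \<phi> (x + h) = 0" if "x \<notin> N \<delta>" for x
    proof -
      have "x \<notin> K" using that K_N \<delta>(1) by auto
      moreover have "x + h \<notin> K"
      proof
        assume "x + h \<in> K"
        then have "(x + h) + - h \<in> N (0 + \<delta>)" using h by (intro N_step K_N) auto
        with that show False by simp
      qed
      ultimately show ?thesis using K0 by blast
    qed
    have "ennreal (Q h) = (\<integral>\<^sup>+x. ennreal ((g (x + h) - g x)\<^sup>2) \<partial>lborel)"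
      unfolding Q_def by (rule nn_integral_eq_integral[symmetric, OF Q_int]) simp
    also have "\<dots> \<le> (\<integral>\<^sup>+x. ennreal (2 * C\<^sup>2) * (\<Sum>a\<in>D. ?J a x)
        + ennreal (2 * (L * norm h)\<^sup>2) * ennreal ((norm (V x))\<^sup>2) \<partial>lborel)"
    proof (rule nn_integral_mono)
      fix x
      have "indicator (N \<delta>) x \<le> (\<Sum>a\<in>D. indicator (ball a (\<delta>/2)) x :: real)"
      proof (cases "x \<in> N \<delta>")
        case True
        then obtain a where "a \<in> D" "x \<in> ball a (\<delta>/2)" using D(3) by blast
        then have "1 \<le> (\<Sum>a\<in>D. indicator (ball a (\<delta>/2)) x :: real)"
          using member_le_sum[of a D "\<lambda>a. indicator (ball a (\<delta>/2)) x :: real"] D(1) by simp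
        then show ?thesis using True by simp
      qed (simp add: sum_nonneg)
      then have "indicator (N \<delta>) x * (norm (V (x + h) - V x))\<^sup>2
          \<le> (\<Sum>a\<in>D. indicator (ball a (\<delta>/2)) x * (norm (V (x + h) - V x))\<^sup>2)"
        unfolding sum_distrib_right[symmetric] by (rule mult_right_mono) simp
      then have "2 * C\<^sup>2 * (indicator (N \<delta>) x * (norm (V (x + h) - V x))\<^sup>2)
          \<le> 2 * C\<^sup>2 * (\<Sum>a\<in>D. indicator (ball a (\<delta>/2)) x * (norm (V (x + h) - V x))\<^sup>2)"
        by (rule mult_left_mono) simp
      with localized_translate_bound[where V = V and i = i and x = x and A = "N \<delta>", OF C(2) L(2) off]
      have "(g (x + h) - g x)\<^sup>2 \<le> 2 * C\<^sup>2 * (\<Sum>a\<in>D. indicator (ball a (\<delta>/2)) x * (norm (V (x + h) - V x))\<^sup>2)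
          + 2 * (L * norm h)\<^sup>2 * (norm (V x))\<^sup>2"
        unfolding g_def by linarith
      then have "ennreal ((g (x + h) - g x)\<^sup>2) \<le> ennreal (2 * C\<^sup>2 * (\<Sum>a\<in>D. indicator (ball a (\<delta>/2)) x * (norm (V (x + h) - V x))\<^sup>2)
          + 2 * (L * norm h)\<^sup>2 * (norm (V x))\<^sup>2)"
        by (rule ennreal_leI)
      also have "\<dots> = ennreal (2 * C\<^sup>2) * (\<Sum>a\<in>D. ?J a x)
        + ennreal (2 * (L * norm h)\<^sup>2) * ennreal ((norm (V x))\<^sup>2)"
        by (subst sum_ennreal) (auto simp: ennreal_plus ennreal_mult sum_nonneg simp del: sum_ennreal)
      finally show "ennreal ((g (x + h) - g x)\<^sup>2) \<le> ennreal (2 * C\<^sup>2) * (\<Sum>a\<in>D. ?J a x)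
        + ennreal (2 * (L * norm h)\<^sup>2) * ennreal ((norm (V x))\<^sup>2)" .
    qed
    also have "\<dots> = (\<integral>\<^sup>+x. ennreal (2 * C\<^sup>2) * (\<Sum>a\<in>D. ?J a x) \<partial>lborel)
        + (\<integral>\<^sup>+x. ennreal (2 * (L * norm h)\<^sup>2) * ennreal ((norm (V x))\<^sup>2) \<partial>lborel)"
      by (rule nn_integral_add) measurable
    also have "\<dots> = ennreal (2 * C\<^sup>2) * (\<integral>\<^sup>+x. (\<Sum>a\<in>D. ?J a x) \<partial>lborel)
        + ennreal (2 * (L * norm h)\<^sup>2) * (\<integral>\<^sup>+x. ennreal ((norm (V x))\<^sup>2) \<partial>lborel)"
      by (intro arg_cong2[where f = "(+)"] nn_integral_cmult) measurable
    also have "\<dots> = ennreal (2 * C\<^sup>2) * (\<Sum>a\<in>D. \<integral>\<^sup>+x. ?J a x \<partial>lborel)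
        + ennreal (2 * (L * norm h)\<^sup>2) * (\<integral>\<^sup>+x. ennreal ((norm (V x))\<^sup>2) \<partial>lborel)"
      by (intro arg_cong2[where f = "(+)"] arg_cong2[where f = "(*)"] refl nn_integral_sum) measurable
    also have "\<dots> \<le> ennreal (2 * C\<^sup>2) * (\<Sum>a\<in>D. ennreal (A a * norm h powr (\<alpha> + 1))) + ennreal (2 * (L * norm h)\<^sup>2) * ennreal S"
    proof (intro add_mono mult_left_mono sum_mono)
      show "(\<integral>\<^sup>+x. ennreal ((norm (V x))\<^sup>2) \<partial>lborel) \<le> ennreal S"
        unfolding S_def by (subst nn_integral_eq_integral[OF V2]) auto
    qed (use ball_est[OF _ h] in auto)
    also have "\<dots> = ennreal (2 * C\<^sup>2 * (T * norm h powr (\<alpha> + 1)) + 2 * (L * norm h)\<^sup>2 * S)"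
    proof -
      have "(\<Sum>a\<in>D. ennreal (A a * norm h powr (\<alpha> + 1))) = ennreal (T * norm h powr (\<alpha> + 1))"
        using A_nonneg[OF _ h] by (subst sum_ennreal) (simp_all add: T_def sum_distrib_right)
      moreover have "ennreal a * ennreal b + ennreal c * ennreal d = ennreal (a * b + c * d)"
        if "0 \<le> a" "0 \<le> b" "0 \<le> c" "0 \<le> d" for a b c d
        using that by (simp add: ennreal_plus ennreal_mult)
      ultimately show ?thesis using T S by simp
    qed
    also have "2 * C\<^sup>2 * (T * norm h powr (\<alpha> + 1)) + 2 * (L * norm h)\<^sup>2 * S
        \<le> (2 * C\<^sup>2 * T + 2 * L\<^sup>2 * S) * norm h powr (\<alpha> + 1)"
    proof -
      have "(norm h)\<^sup>2 = norm h powr 2" by simp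
      also have "\<dots> \<le> norm h powr (\<alpha> + 1)" using h \<delta> \<alpha> by (intro powr_mono') auto
      finally have "2 * L\<^sup>2 * S * (norm h)\<^sup>2 \<le> 2 * L\<^sup>2 * S * norm h powr (\<alpha> + 1)"
        using S by (intro mult_left_mono) auto
      then show ?thesis by (simp add: power_mult_distrib algebra_simps)
    qed
    finally have "ennreal (Q h) \<le> ennreal ((2 * C\<^sup>2 * T + 2 * L\<^sup>2 * S) * norm h powr (\<alpha> + 1))"
      by (simp add: ennreal_leI)
    then show ?thesis using T S by simp
  qed
  define M where "M = max (2 * C\<^sup>2 * T + 2 * L\<^sup>2 * S) (4 * Z / \<delta> powr (\<alpha> + 1))"
  have Q_bound: "Q h / norm h powr (\<alpha> + 1) \<le> M" if h: "h \<noteq> 0" for h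
  proof (cases "norm h \<le> \<delta>")
    case True
    have "0 < norm h powr (\<alpha> + 1)" using h by simp
    with Q_near[OF h True] show ?thesis by (simp add: M_def divide_le_eq le_max_iff_disj)
  next
    case False
    then have "\<delta> powr (\<alpha> + 1) \<le> norm h powr (\<alpha> + 1)" using \<delta> \<alpha> by (intro powr_mono2) auto
    then have "Q h / norm h powr (\<alpha> + 1) \<le> 4 * Z / \<delta> powr (\<alpha> + 1)"
      using Q_far[of h] \<delta>(1) Z by (intro frac_le) auto
    then show ?thesis by (simp add: M_def)
  qed
  have sq: "\<bar>t\<bar> powr 2 = t\<^sup>2" for t :: real by simp
  have quotient: "besov_quotient ((\<alpha> + 1) / 2) 2 UNIV (\<lambda>x. \<phi> x * H (q/2) (Du x) $ i) h
      = (Q h / norm h powr (\<alpha> + 1)) powr (1/2)" for h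
  proof -
    have "(\<alpha> + 1) / 2 * 2 = \<alpha> + 1" by simp
    then show ?thesis unfolding besov_quotient_eq[OF space_in_borel g aeg] Q_def by (simp only:) (simp add: sq)
  qed
  have "bdd_above (besov_quotient ((\<alpha> + 1) / 2) 2 UNIV (\<lambda>x. \<phi> x * H (q/2) (Du x) $ i) ` (UNIV - {0}))"
  proof (rule bdd_aboveI2)
    fix h :: "real ^ 'n" assume "h \<in> UNIV - {0}"
    moreover have "0 \<le> Q h" by (simp add: Q_def)
    ultimately show "besov_quotient ((\<alpha> + 1) / 2) 2 UNIV (\<lambda>x. \<phi> x * H (q/2) (Du x) $ i) h \<le> M powr (1/2)"
      unfolding quotient using Q_bound[of h] by (intro powr_mono2) auto
  qed
  moreover have "(\<lambda>x. \<phi> x * H (q/2) (Du x) $ i) \<in> Lp_space 2 UNIV"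
  proof -
    have "AE x in lborel. indicator UNIV x *\<^sub>R (norm (\<phi> x * H (q/2) (Du x) $ i) powr 2) = (g x)\<^sup>2"
      using aeg by eventually_elim simp
    then have "integrable (lebesgue_on UNIV) (\<lambda>x. norm (\<phi> x * H (q/2) (Du x) $ i) powr 2)"
      using g2 by (subst lebesgue_on_transfer(3)[OF space_in_borel, where K = "\<lambda>x. (g x)\<^sup>2"]) auto
    then show ?thesis
      using lebesgue_on_transfer(1)[OF space_in_borel g aeg] by (simp add: Lp_space_def)
  qed
  ultimately show "(\<lambda>x. \<phi> x * H (q/2) (Du x) $ i) \<in> besov ((\<alpha> + 1) / 2) 2 UNIV"
    by (simp add: besov_def)
qed

section \<open>Neighbourhoods of balls\<close>

text \<open>
  If the closed ball left \<open>\<Omega>\<close>, then by connectedness it would contain a frontier point, whose distance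
  to the smaller ball is at most \<open>r\<close>.
\<close>

lemma cball_subset_if_setdist_frontier:
  fixes \<Omega> :: "'a::euclidean_space set"
  assumes \<Omega>: "open \<Omega>" "ball x0 R \<subseteq> \<Omega>" "0 < R" and r: "r < setdist (ball x0 R) (frontier \<Omega>)"
  shows "cball x0 (R + r) \<subseteq> \<Omega>"
proof (rule ccontr)
  assume "\<not> cball x0 (R + r) \<subseteq> \<Omega>"
  moreover have "cball x0 (R + r) \<inter> \<Omega> \<noteq> {}"
  proof -
    have "x0 \<in> cball x0 (R + r)" using \<open>\<not> cball x0 (R + r) \<subseteq> \<Omega>\<close> by (force simp: subset_iff intro: order_trans[OF zero_le_dist])
    moreover have "x0 \<in> \<Omega>" using \<Omega>(2,3) by auto
    ultimately show ?thesis by blast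
  qed
  ultimately have "cball x0 (R + r) \<inter> frontier \<Omega> \<noteq> {}"
    by (intro connected_Int_frontier) (auto intro: convex_connected)
  then obtain z where z: "dist x0 z \<le> R + r" "z \<in> frontier \<Omega>" by auto
  have "z \<notin> \<Omega>" using z(2) \<Omega>(1) by (simp add: frontier_def interior_open)
  then have far: "R \<le> dist x0 z" using \<Omega>(2) by force
  have "setdist (ball x0 R) (frontier \<Omega>) \<le> r"
  proof (rule field_le_epsilon)
    fix e :: real assume e: "0 < e"
    define t where "t = max 0 (R - e) / dist x0 z"
    have dz: "0 < dist x0 z" using far \<Omega>(3) by linarith
    have t: "0 \<le> t" "t * dist x0 z = max 0 (R - e)" "t \<le> 1"
      using dz far e by (auto simp: t_def divide_le_eq)
    define y where "y = x0 + t *\<^sub>R (z - x0)"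
    have "dist x0 y = t * dist x0 z" using t(1) by (simp add: y_def dist_norm norm_minus_commute)
    then have "y \<in> ball x0 R" using t e \<Omega>(3) by simp
    moreover have "z - y = (1 - t) *\<^sub>R (z - x0)" by (simp add: y_def algebra_simps)
    then have "dist z y = (1 - t) * dist z x0" using t(3) by (simp add: dist_norm)
    then have "dist y z = (1 - t) * dist x0 z" by (simp only: dist_commute)
    then have "dist y z \<le> r + e" using t(2) z(1) by (simp add: left_diff_distrib)
    ultimately show "setdist (ball x0 R) (frontier \<Omega>) \<le> r + e"
      using setdist_le_dist[of y "ball x0 R" z "frontier \<Omega>"] z(2) by simp
  qed
  with r show False by simp
qed

lemma ball_add_ball:
  fixes x0 :: "'a::euclidean_space"
  assumes "0 < R" "0 < r"
  shows "{x + y | x y. x \<in> ball x0 R \<and> y \<in> ball 0 r} = ball x0 (R + r)"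
proof (intro equalityI subsetI)
  fix z assume "z \<in> {x + y | x y. x \<in> ball x0 R \<and> y \<in> ball 0 r}"
  then obtain x y where "z = x + y" "dist x0 x < R" "norm y < r" by auto
  moreover have "dist x0 (x + y) \<le> dist x0 x + norm y"
    using dist_triangle[of x0 "x + y" x] by (simp add: dist_norm)
  ultimately show "z \<in> ball x0 (R + r)" by simp
next
  fix z assume "z \<in> ball x0 (R + r)"
  then have d: "dist x0 z < R + r" by simp
  define s where "s = R / (R + r)"
  have s: "0 < s" "s < 1" "s * (R + r) = R" "(1 - s) * (R + r) = r" using assms by (auto simp: s_def field_simps)
  have "s * norm (z - x0) < R" "(1 - s) * norm (z - x0) < r"
    using mult_strict_left_mono[OF d, of s] mult_strict_left_mono[OF d, of "1 - s"] s
    by (simp_all add: dist_norm norm_minus_commute)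
  then have "x0 + s *\<^sub>R (z - x0) \<in> ball x0 R" "(1 - s) *\<^sub>R (z - x0) \<in> ball 0 r"
    using s by (simp_all add: dist_norm)
  moreover have "z = (x0 + s *\<^sub>R (z - x0)) + (1 - s) *\<^sub>R (z - x0)" by (simp add: algebra_simps)
  ultimately show "z \<in> {x + y | x y. x \<in> ball x0 R \<and> y \<in> ball 0 r}" by blast
qed

theorem theorem4p1:
  fixes q p :: real
  assumes "CARD('n::finite) \<ge> 2" and "q \<ge> 2" and "p = q / (q - 1)"
  shows "\<exists>c :: real \<Rightarrow> real. (\<forall>R>0. c R > 0) \<and>
    (\<forall>(\<Omega> :: (real ^ 'n) set) (\<alpha> :: real) f u Du.
       open \<Omega> \<and> connected \<Omega> \<and> \<Omega> \<noteq> {} \<and> bounded \<Omega> \<and> 0 < \<alpha> \<and> \<alpha> < 1 \<and>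
       f \<in> besov_loc \<alpha> p \<Omega> \<and> local_weak_solution q \<Omega> f u Du \<longrightarrow>
       (\<lambda>x. H (q / 2) (Du x)) \<in> besov_loc_vec ((\<alpha> + 1) / 2) 2 \<Omega> \<and>
       (\<forall>x\<^sub>0 R r\<^sub>0 h s B'.
          R > 0 \<and> closure (ball x\<^sub>0 R) \<subseteq> \<Omega> \<and>
          \<bar>h\<bar> \<le> r\<^sub>0 \<and> r\<^sub>0 < setdist (ball x\<^sub>0 R) (frontier \<Omega>) / 2 \<and>
          B' = {x + y | x y. x \<in> ball x\<^sub>0 R \<and> y \<in> ball 0 r\<^sub>0} \<longrightarrow>
          (\<integral>\<^sup>+x. ennreal ((norm (shift s h (\<lambda>y. H (q / 2) (Du y)) x - H (q / 2) (Du x)))\<^sup>2)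
             \<partial>lebesgue_on (ball x\<^sub>0 (R / 2)))
          \<le> ennreal (c R * (besov_norm \<alpha> p B' f * Lp_norm q B' Du * \<bar>h\<bar> powr (\<alpha> + 1)
                            + Lp_norm q B' Du powr q * \<bar>h\<bar>\<^sup>2))))"
proof -
  define P where "P R c \<longleftrightarrow> 0 < c \<and> (\<forall>(\<Omega> :: (real ^ 'n) set) \<alpha> f u Du x0 r h.
    open \<Omega> \<longrightarrow> f \<in> besov_loc \<alpha> p \<Omega> \<longrightarrow> local_weak_solution q \<Omega> f u Du \<longrightarrow> cball x0 (R + r) \<subseteq> \<Omega> \<longrightarrow>
    norm h \<le> r \<longrightarrow> h \<noteq> 0 \<longrightarrow>
    0 \<le> besov_norm \<alpha> p (ball x0 (R + r)) f \<and>
    (\<integral>\<^sup>+x. ennreal ((norm (H (q/2) (Du (x + h)) - H (q/2) (Du x)))\<^sup>2) \<partial>lebesgue_on (ball x0 (R/2)))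
    \<le> ennreal (c * (besov_norm \<alpha> p (ball x0 (R + r)) f * Lp_norm q (ball x0 (R + r)) Du * norm h powr (\<alpha> + 1)
        + Lp_norm q (ball x0 (R + r)) Du powr q * (norm h)\<^sup>2)))" for R c
  have "\<exists>c. P R c" if "0 < R" for R
    using local_estimate[OF assms(2,3) that, where 'n = 'n] unfolding P_def .
  then have "\<forall>R. \<exists>c. 0 < R \<longrightarrow> P R c" by blast
  from choice[OF this] obtain c where c: "\<And>R. 0 < R \<Longrightarrow> P R (c R)" by blast
  show ?thesis
  proof (intro exI[of _ c] conjI allI impI)
    show "c R > 0" if "R > 0" for R using c[OF that] by (simp add: P_def)
  next
    fix \<Omega> :: "(real ^ 'n) set" and \<alpha> f u Du
    assume A: "open \<Omega> \<and> connected \<Omega> \<and> \<Omega> \<noteq> {} \<and> bounded \<Omega> \<and> 0 < \<alpha> \<and> \<alpha> < 1 \<and>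
       f \<in> besov_loc \<alpha> p \<Omega> \<and> local_weak_solution q \<Omega> f u Du"
    then show "(\<lambda>x. H (q / 2) (Du x)) \<in> besov_loc_vec ((\<alpha> + 1) / 2) 2 \<Omega>"
      by (intro H_gradient_besov_loc[OF assms(2,3)]) auto
    fix x0 :: "real ^ 'n" and R r h s B'
    assume B: "R > 0 \<and> closure (ball x0 R) \<subseteq> \<Omega> \<and> \<bar>h\<bar> \<le> r \<and> r < setdist (ball x0 R) (frontier \<Omega>) / 2 \<and>
          B' = {x + y | x y. x \<in> ball x0 R \<and> y \<in> ball 0 r}"
    show "(\<integral>\<^sup>+x. ennreal ((norm (shift s h (\<lambda>y. H (q / 2) (Du y)) x - H (q / 2) (Du x)))\<^sup>2)
             \<partial>lebesgue_on (ball x0 (R / 2)))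
          \<le> ennreal (c R * (besov_norm \<alpha> p B' f * Lp_norm q B' Du * \<bar>h\<bar> powr (\<alpha> + 1)
                            + Lp_norm q B' Du powr q * \<bar>h\<bar>\<^sup>2))"
    proof (cases "h = 0")
      case True
      then show ?thesis by (simp add: shift_def)
    next
      case False
      then have r: "0 < r" using B by linarith
      have R: "0 < R" using B by blast
      have B': "B' = ball x0 (R + r)" using B ball_add_ball[OF R r] by blast
      have "ball x0 R \<subseteq> \<Omega>" using B closure_subset[of "ball x0 R"] by blast
      moreover have "r < setdist (ball x0 R) (frontier \<Omega>)"
        using B setdist_pos_le[of "ball x0 R" "frontier \<Omega>"] by linarith
      ultimately have cb: "cball x0 (R + r) \<subseteq> \<Omega>"
        using A R by (intro cball_subset_if_setdist_frontier) auto
      have nh: "norm (h *\<^sub>R (axis s 1 :: real ^ 'n)) = \<bar>h\<bar>" by (simp add: norm_axis_1)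
      have n: "norm (h *\<^sub>R (axis s 1 :: real ^ 'n)) \<le> r" unfolding nh using B by blast
      have nz: "h *\<^sub>R (axis s 1 :: real ^ 'n) \<noteq> 0" using False by (simp add: axis_eq_0_iff)
      have a: "open \<Omega>" "f \<in> besov_loc \<alpha> p \<Omega>" "local_weak_solution q \<Omega> f u Du" using A by blast+
      from c[OF R, unfolded P_def, THEN conjunct2, rule_format, OF a cb n nz, THEN conjunct2]
      show ?thesis unfolding B' shift_def nh .
    qed
  qed
qed

end
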